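(* Fix integers $K\ge 2$, a real number $\theta\in(0,1)$, and a probability vector $\underline{p}=(p_1,\dots,p_K)$ with $p_k>0$ for all $k$. Let $D_K^{*}(\theta,\underline{p})=\lim_{n\to\infty}D^n_*(\theta,\underline{p})$ be the limiting minimum expected $\mathbb{L}_1$-distortion of a $\theta$-DP histogram sanitizing mechanism (defined in the context). Then: (a) The limit exists and $$D_K^{*}(\theta,\underline{p})=\frac{2\theta}{\mathrm{Ehr}_{\mathcal{P}}(\theta)}\,\frac{d\,\mathrm{Ehr}_{\mathcal{P}}(\theta)}{d\theta}-\frac{2\theta}{1-\theta},\qquad \mathrm{Ehr}_{\mathcal{P}}(z):=1+\sum_{d=1}^{\infty}L_{\mathcal{P}}(d)z^{d},$$ where $L_{\mathcal{P}}(d)$ is the number of points with integer coordinates in the polytope $$\mathcal{P}_d=\Big\{(x_1,\dots,x_K)\in\mathbb{R}^K:\ \sum_{k=1}^K x_k=0,\ \sum_{k=1}^K|x_k|\le 2d\Big\}.$$ In particular $D_K^{*}(\theta,\underline{p})$ does not depend on $\underline{p}$. (b) $$\mathrm{Ehr}_{\mathcal{P}}(\theta)=\frac{1}{1-\theta}+\sum_{d=1}^{\infty}\Big\{\sum_{r=1}^{K-1}\binom{K}{r}\binom{d+r-1}{r-1}\binom{d-1}{K-r-1}\Big\}\frac{\theta^{d}}{1-\theta}.$$ (c) $$D_K^{*}(\theta,\underline{p})=2\theta\Big\{\frac{K-1}{1-\theta}+\frac{S_{K-1}'(\theta)}{S_{K-1}(\theta)}\Big\},\qquad S_{K-1}(\theta)=\sum_{j=0}^{K-1}\theta^{j}\binom{K-1}{j}^{2},$$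 with $S'_{K-1}$ the derivative of $S_{K-1}$. Moreover, $D_K^*(\theta,\underline p)$ is attained in the limit by truncations of the geometric mechanism: letting $\mathcal{H}^n_{\mathrm{ext}}=\{\underline{h}\in\mathbb{Z}^K:\sum_k h_k=n\}$ and $\mathbb{U}(\underline{g}|\underline{h})=\big((1-\theta)\mathrm{Ehr}_{\mathcal{P}}(\theta)\big)^{-1}\theta^{|\underline{g}-\underline{h}|_1/2}$ for $\underline{h}\in\mathcal{H}^n$, $\underline{g}\in\mathcal{H}^n_{\mathrm{ext}}$, there exist deterministic maps $f_n:\mathcal{H}^n_{\mathrm{ext}}\to\mathcal{H}^n$ such that the mechanisms $\mathbb{W}^n(\underline{g}|\underline{h})=\sum_{\underline{b}\in\mathcal{H}^n_{\mathrm{ext}}:\,f_n(\underline{b})=\underline{g}}\mathbb{U}(\underline{b}|\underline{h})$ are $\theta$-DP HSMs with $\lim_{n\to\infty}D^n(\mathbb{W}^n,\underline{p})=D_K^*(\theta,\underline{p})$.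
   Context: For $n\in\mathbb{N}$ let $\mathcal{H}^n=\{(h_1,\dots,h_K)\in\mathbb{Z}^K: h_k\ge 0,\ \sum_k h_k=n\}$ (histograms of databases of $n$ records over a set of $K$ possible records). Two histograms $\underline{h},\underline{\hat h}\in\mathcal{H}^n$ are neighboring if $|\underline{h}-\underline{\hat h}|_1=2$. A histogram sanitizing mechanism (HSM) is a conditional pmf $\mathbb{W}(\cdot|\underline{h})$ on $\mathcal{H}^n$ for each $\underline{h}\in\mathcal{H}^n$; it is $\theta$-DP if $\theta\,\mathbb{W}(\underline{g}|\underline{h})\le \mathbb{W}(\underline{g}|\underline{\hat h})\le\theta^{-1}\mathbb{W}(\underline{g}|\underline{h})$ for all neighboring $\underline{h},\underline{\hat h}$ and all $\underline{g}$. Its expected $\mathbb{L}_1$-distortion is $D^n(\mathbb{W},\underline{p})=\sum_{\underline{h},\underline{g}\in\mathcal{H}^n}\binom{n}{h_1,\dots,h_K}\prod_k p_k^{h_k}\,\mathbb{W}(\underline{g}|\underline{h})\,|\underline{h}-\underline{g}|_1$, and $D^n_*(\theta,\underline{p})$ is the minimum of $D^n(\mathbb{W},\underline{p})$ over all $\theta$-DP HSMs. $D_K^*(\theta,\underline p)=\lim_{n\to\infty}D^n_*(\theta,\underline p)$. *)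

theory Defs
  imports "HOL-Analysis.Analysis"
begin

text \<open>Histograms over K records are represented as functions nat => int that vanish
  outside the index set {..<K} (record k corresponds to index k-1).\<close>

definition hist :: "nat \<Rightarrow> nat \<Rightarrow> (nat \<Rightarrow> int) set" where
  "hist K n = {h. (\<forall>k. K \<le> k \<longrightarrow> h k = 0) \<and> (\<forall>k<K. 0 \<le> h k) \<and> (\<Sum>k<K. h k) = int n}"

definition hist_ext :: "nat \<Rightarrow> nat \<Rightarrow> (nat \<Rightarrow> int) set" where
  "hist_ext K n = {h. (\<forall>k. K \<le> k \<longrightarrow> h k = 0) \<and> (\<Sum>k<K. h k) = int n}"

definition l1dist :: "nat \<Rightarrow> (nat \<Rightarrow> int) \<Rightarrow> (nat \<Rightarrow> int) \<Rightarrow> int" where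
  "l1dist K h g = (\<Sum>k<K. \<bar>h k - g k\<bar>)"

definition neighboring :: "nat \<Rightarrow> (nat \<Rightarrow> int) \<Rightarrow> (nat \<Rightarrow> int) \<Rightarrow> bool" where
  "neighboring K h h' \<longleftrightarrow> l1dist K h h' = 2"

definition is_HSM :: "nat \<Rightarrow> nat \<Rightarrow> ((nat \<Rightarrow> int) \<Rightarrow> (nat \<Rightarrow> int) \<Rightarrow> real) \<Rightarrow> bool" where
  "is_HSM K n W \<longleftrightarrow> (\<forall>h\<in>hist K n. (\<forall>g\<in>hist K n. 0 \<le> W g h) \<and> (\<Sum>g\<in>hist K n. W g h) = 1)"

definition is_DP :: "nat \<Rightarrow> nat \<Rightarrow> real \<Rightarrow> ((nat \<Rightarrow> int) \<Rightarrow> (nat \<Rightarrow> int) \<Rightarrow> real) \<Rightarrow> bool" where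
  "is_DP K n \<theta> W \<longleftrightarrow> (\<forall>h\<in>hist K n. \<forall>h'\<in>hist K n. neighboring K h h' \<longrightarrow>
      (\<forall>g\<in>hist K n. \<theta> * W g h \<le> W g h' \<and> W g h' \<le> W g h / \<theta>))"

definition multinom :: "nat \<Rightarrow> nat \<Rightarrow> (nat \<Rightarrow> int) \<Rightarrow> real" where
  "multinom K n h = fact n / (\<Prod>k<K. fact (nat (h k)))"

definition distortion :: "nat \<Rightarrow> nat \<Rightarrow> ((nat \<Rightarrow> int) \<Rightarrow> (nat \<Rightarrow> int) \<Rightarrow> real) \<Rightarrow> (nat \<Rightarrow> real) \<Rightarrow> real" where
  "distortion K n W p = (\<Sum>h\<in>hist K n. \<Sum>g\<in>hist K n.
      multinom K n h * (\<Prod>k<K. p k ^ nat (h k)) * W g h * real_of_int (l1dist K h g))"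

text \<open>Minimum expected distortion over all theta-DP HSMs (the infimum, which is attained).\<close>
definition Dstar :: "nat \<Rightarrow> nat \<Rightarrow> real \<Rightarrow> (nat \<Rightarrow> real) \<Rightarrow> real" where
  "Dstar K n \<theta> p = Inf {distortion K n W p | W. is_HSM K n W \<and> is_DP K n \<theta> W}"

definition LP :: "nat \<Rightarrow> nat \<Rightarrow> nat" where
  "LP K d = card {x :: nat \<Rightarrow> int. (\<forall>k. K \<le> k \<longrightarrow> x k = 0) \<and> (\<Sum>k<K. x k) = 0
                  \<and> (\<Sum>k<K. \<bar>x k\<bar>) \<le> 2 * int d}"

definition Ehr :: "nat \<Rightarrow> real \<Rightarrow> real" where
  "Ehr K z = 1 + (\<Sum>d. real (LP K (Suc d)) * z ^ Suc d)"

definition Spoly :: "nat \<Rightarrow> real \<Rightarrow> real" where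
  "Spoly m z = (\<Sum>j=0..m. z ^ j * real (m choose j) ^ 2)"

definition geomU :: "nat \<Rightarrow> real \<Rightarrow> (nat \<Rightarrow> int) \<Rightarrow> (nat \<Rightarrow> int) \<Rightarrow> real" where
  "geomU K \<theta> g h = \<theta> powr (real_of_int (l1dist K g h) / 2) / ((1 - \<theta>) * Ehr K \<theta>)"

end

theory Submission
  imports Defs
begin

text \<open>
  Write \<open>m = K - 1\<close> and let the level of a zero-sum vector \<open>x\<close> be \<open>d = |x|\<^sub>1 / 2\<close>. The prior is nearly
  constant on bounded balls around typical histograms, so the lower bound reduces to a statement about the
  lattice: if \<open>\<phi> \<ge> 0\<close> drops by at most a factor \<open>\<theta>\<close> along every edge, then its mean level is at least that
  of \<open>\<theta>\<close> raised to the level; equivalently every \<open>\<psi>\<close> that increases along the edges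
  \<open>x \<rightarrow> x + e\<^sub>i - e\<^sub>j\<close> leading from level \<open>d\<close> to level \<open>d + 1\<close> is positively correlated with the level.
  This follows from an explicit nonnegative flow on these edges whose divergence depends on the level only:
  it shows that the average of \<open>\<psi>(u - v)\<close> over pairs of compositions \<open>u, v\<close> of \<open>n\<close> into \<open>K\<close> parts is
  nondecreasing in \<open>n\<close>, and Chebyshev's sum inequality then gives the correlation. For constant \<open>\<psi>\<close> the
  same flow identity evaluates the generating function of the sphere sizes as \<open>S\<^sub>m(z) / (1 - z)\<^sup>m\<close>.

  For the upper bound, the geometric mechanism is truncated to a nearest histogram, which at most doubles
  the distance to the input and changes nothing unless the noise exceeds a multiple of \<open>n\<close>.
\<close>

section \<open>Spheres of the root lattice and a flow between them\<close>

text \<open>Why pairs of compositions: a pair \<open>u, v\<close> of compositions of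
  \<open>n\<close> splits into \<open>x = u - v\<close>, of some level \<open>d\<close>, and the
  common minimum, a composition of \<open>n - d\<close>. If pairs are weighted by
  \<open>\<theta> ^ n\<close>, the two parts become independent: \<open>x\<close> gets weight
  \<open>\<theta>\<close> to its level, the size of the minimum is negative binomial with mean
  \<open>K * \<theta> / (1 - \<theta>)\<close>. Correlation with \<open>n\<close> therefore passes
  to correlation with the level, and this mean is the shift that occurs in the later bounds. The
  obstacle is that the numbers of positive and negative coordinates vary over a sphere, so the
  degrees of a vertex are not determined by its level. Two flows are combined whose dependence on
  these numbers is complementary. What is left is a second difference of a profile \<open>H\<close>
  of the level; choosing for \<open>H\<close> the tail sums of the weights in \<open>layer\<close>
  gives, up to normalisation, the difference of consecutive averages. A mechanism lives on
  histograms and not on the whole lattice, so the lattice inequality is needed on balls of finite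
  radius \<open>R\<close>, with a truncated mean that converges as \<open>R\<close> grows.\<close>

definition sph :: "nat \<Rightarrow> nat \<Rightarrow> (nat \<Rightarrow> int) set" where
  "sph K d = {x. (\<forall>k. K \<le> k \<longrightarrow> x k = 0) \<and> (\<Sum>k<K. x k) = 0 \<and> (\<Sum>k<K. \<bar>x k\<bar>) = 2 * int d}"

definition posc :: "nat \<Rightarrow> (nat \<Rightarrow> int) \<Rightarrow> nat set" where
  "posc K x = {k. k < K \<and> 0 < x k}"

definition negc :: "nat \<Rightarrow> (nat \<Rightarrow> int) \<Rightarrow> nat set" where
  "negc K x = {k. k < K \<and> x k < 0}"

definition zerc :: "nat \<Rightarrow> (nat \<Rightarrow> int) \<Rightarrow> nat set" where
  "zerc K x = {k. k < K \<and> x k = 0}"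

definition shift :: "(nat \<Rightarrow> int) \<Rightarrow> nat \<Rightarrow> nat \<Rightarrow> (nat \<Rightarrow> int)" where
  "shift x i j = x(i := x i + 1, j := x j - 1)"

text \<open>The two sign conditions single out the moves by \<open>e_i - e_j\<close> that enlarge
  both \<open>|x_i|\<close> and \<open>|x_j|\<close>, so each of them raises the level by exactly
  one. A single zero coordinate would satisfy them with \<open>i = j\<close>, which has to be
  excluded.\<close>

definition upedge :: "nat \<Rightarrow> (nat \<Rightarrow> int) \<Rightarrow> (nat \<times> nat) set" where
  "upedge K x = {(i, j). i < K \<and> j < K \<and> i \<noteq> j \<and> 0 \<le> x i \<and> x j \<le> 0}"

lemma finite_bounded_fun:
  "finite {x :: nat \<Rightarrow> int. (\<forall>k. K \<le> k \<longrightarrow> x k = 0) \<and> (\<forall>k<K. x k \<in> {-B..B})}"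
proof -
  have "finite {x :: nat \<Rightarrow> int. \<forall>k. (k \<in> {..<K} \<longrightarrow> x k \<in> {-B..B}) \<and> (k \<notin> {..<K} \<longrightarrow> x k = 0)}"
    by (rule finite_set_of_finite_funs) auto
  then show ?thesis by (rule rev_finite_subset) auto
qed

lemma finite_l1_ball:
  "finite {x :: nat \<Rightarrow> int. (\<forall>k. K \<le> k \<longrightarrow> x k = 0) \<and> (\<Sum>k<K. \<bar>x k\<bar>) \<le> B}"
proof (rule rev_finite_subset[OF finite_bounded_fun[of K B]], safe)
  fix x :: "nat \<Rightarrow> int" and k
  assume s: "(\<Sum>k<K. \<bar>x k\<bar>) \<le> B" and "k < K"
  then have "\<bar>x k\<bar> \<le> (\<Sum>k<K. \<bar>x k\<bar>)" by (intro member_le_sum) auto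
  with s show "x k \<in> {-B..B}" by auto
qed

lemma finite_sph: "finite (sph K d)"
  by (rule finite_subset[OF _ finite_l1_ball[of K "2 * int d"]]) (auto simp: sph_def)

lemma finite_posc[simp]: "finite (posc K x)" and finite_negc[simp]: "finite (negc K x)"
  and finite_zerc[simp]: "finite (zerc K x)" and finite_upedge[simp]: "finite (upedge K x)"
proof -
  show "finite (upedge K x)"
    by (rule finite_subset[of _ "{..<K} \<times> {..<K}"]) (auto simp: upedge_def)
qed (auto simp: posc_def negc_def zerc_def)

lemma coord_decomp: "{..<K} = posc K x \<union> negc K x \<union> zerc K x"
  by (auto simp: posc_def negc_def zerc_def)

lemma coord_disjoint: "posc K x \<inter> negc K x = {}" "(posc K x \<union> negc K x) \<inter> zerc K x = {}"
   "posc K x \<inter> zerc K x = {}" "negc K x \<inter> zerc K x = {}"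
  by (auto simp: posc_def negc_def zerc_def)

lemma sum_coord:
  fixes f :: "nat \<Rightarrow> 'a::comm_monoid_add"
  shows "sum f {..<K} = sum f (posc K x) + sum f (negc K x) + sum f (zerc K x)"
  unfolding coord_decomp[of K x] using coord_disjoint[of K x]
  by (simp add: sum.union_disjoint)

lemma card_coord: "card (posc K x) + card (negc K x) + card (zerc K x) = K"
  using sum_coord[of "\<lambda>_. 1::nat" K x] by simp

lemma sph_sums:
  assumes "x \<in> sph K d"
  shows "(\<Sum>k\<in>posc K x. x k) = int d" "(\<Sum>k\<in>negc K x. - x k) = int d"
proof -
  have z: "(\<Sum>k\<in>zerc K x. x k) = 0" "(\<Sum>k\<in>zerc K x. \<bar>x k\<bar>) = 0" by (auto simp: zerc_def)
  have a: "(\<Sum>k\<in>posc K x. \<bar>x k\<bar>) = (\<Sum>k\<in>posc K x. x k)" "(\<Sum>k\<in>negc K x. \<bar>x k\<bar>) = (\<Sum>k\<in>negc K x. - x k)"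
    by (auto intro!: sum.cong simp: posc_def negc_def)
  have "(\<Sum>k<K. x k) = 0" "(\<Sum>k<K. \<bar>x k\<bar>) = 2 * int d" using assms by (auto simp: sph_def)
  then show "(\<Sum>k\<in>posc K x. x k) = int d" "(\<Sum>k\<in>negc K x. - x k) = int d"
    unfolding sum_coord[of _ K x] z a by (auto simp: sum_negf)
qed

lemma card_le_level:
  assumes "x \<in> sph K d"
  shows "card (posc K x) \<le> d" "card (negc K x) \<le> d"
proof -
  have "(\<Sum>k\<in>posc K x. 1) \<le> (\<Sum>k\<in>posc K x. x k)" by (rule sum_mono) (auto simp: posc_def)
  then show "card (posc K x) \<le> d" using sph_sums[OF assms] by simp
  have "(\<Sum>k\<in>negc K x. 1) \<le> (\<Sum>k\<in>negc K x. - x k)" by (rule sum_mono) (auto simp: negc_def)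
  then show "card (negc K x) \<le> d" using sph_sums[OF assms] by simp
qed

lemma sum_shift:
  fixes F :: "int \<Rightarrow> int"
  assumes "i < K" "j < K" "i \<noteq> j"
  shows "(\<Sum>k<K. F (shift x i j k)) = (\<Sum>k<K. F (x k)) + (F (x i + 1) - F (x i)) + (F (x j - 1) - F (x j))"
proof -
  have e: "(\<Sum>k<K. g k) = g i + g j + (\<Sum>k\<in>{..<K}-{i}-{j}. g k)" for g :: "nat \<Rightarrow> int"
    using assms by (simp add: sum.remove[of _ i] sum.remove[of _ j])
  have "(\<Sum>k\<in>{..<K}-{i}-{j}. F (shift x i j k)) = (\<Sum>k\<in>{..<K}-{i}-{j}. F (x k))"
    by (intro sum.cong) (auto simp: shift_def)
  then show ?thesis unfolding e[of "\<lambda>k. F (shift x i j k)"] e[of "\<lambda>k. F (x k)"]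
    using assms by (simp add: shift_def)
qed

text \<open>An edge between consecutive levels can be listed from its lower or from its upper end.
  Going down from \<open>y\<close> means choosing one positive and one negative coordinate freely,
  so the edges below \<open>y\<close> form a full product. Reindexing between the two lists turns
  outflow sums into inflow sums.\<close>

lemma up_edge_bij:
  "bij_betw (\<lambda>(x, i, j). (shift x i j, i, j))
     (SIGMA x:sph K d. upedge K x) (SIGMA y:sph K (Suc d). posc K y \<times> negc K y)"
proof (rule bij_betwI[where g = "\<lambda>(y, i, j). (shift y j i, i, j)"])
  show "(\<lambda>(x, i, j). (shift x i j, i, j)) \<in>
      (SIGMA x:sph K d. upedge K x) \<rightarrow> (SIGMA y:sph K (Suc d). posc K y \<times> negc K y)"
  proof safe
    fix x i j assume x: "x \<in> sph K d" and ij: "(i, j) \<in> upedge K x"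
    then have *: "i < K" "j < K" "i \<noteq> j" "0 \<le> x i" "x j \<le> 0" by (auto simp: upedge_def)
    show "shift x i j \<in> sph K (Suc d)"
      using x * sum_shift[OF *(1-3), of "\<lambda>t. t" x] sum_shift[OF *(1-3), of abs x]
      by (auto simp: sph_def shift_def)
    show "i \<in> posc K (shift x i j)" "j \<in> negc K (shift x i j)"
      using * by (auto simp: posc_def negc_def shift_def)
  qed
  show "(\<lambda>(y, i, j). (shift y j i, i, j)) \<in>
     (SIGMA y:sph K (Suc d). posc K y \<times> negc K y) \<rightarrow> (SIGMA x:sph K d. upedge K x)"
  proof safe
    fix y i j assume y: "y \<in> sph K (Suc d)" and "i \<in> posc K y" "j \<in> negc K y"
    then have *: "j < K" "i < K" "j \<noteq> i" "0 < y i" "y j < 0" by (auto simp: posc_def negc_def)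
    show "shift y j i \<in> sph K d"
      using y * sum_shift[OF *(1-3), of "\<lambda>t. t" y] sum_shift[OF *(1-3), of abs y]
      by (auto simp: sph_def shift_def)
    show "(i, j) \<in> upedge K (shift y j i)"
      using * by (auto simp: upedge_def shift_def)
  qed
qed (auto simp: shift_def upedge_def posc_def negc_def)

text \<open>
  Both flows are written in terms of the upper endpoint \<open>y\<close> of an edge. In \<open>growth_flow\<close>, the weight
  \<open>y\<^sub>i + |y\<^sub>j| - 1\<close> has the right inflow; the remaining terms have zero inflow and correct the outflow, so that
  outflow minus inflow is \<open>K (K - 1)\<close> at every vertex. The flow on the edges at \<open>d = 0\<close> relies on division by zero being \<open>0\<close>.
\<close>

definition growth_flow :: "nat \<Rightarrow> nat \<Rightarrow> (nat \<Rightarrow> int) \<Rightarrow> nat \<Rightarrow> nat \<Rightarrow> real" where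
  "growth_flow K d y i j = (let a = real_of_int (y i) - 1; b = - real_of_int (y j) - 1;
      p = real (card (posc K y)); q = real (card (negc K y))
    in 1 + ((p - 1) * b + (q - 1) * a + (p + q) * a * b) / real d)"

definition radial_flow :: "(nat \<Rightarrow> int) \<Rightarrow> nat \<Rightarrow> nat \<Rightarrow> real" where
  "radial_flow y i j = (real_of_int (y i) - 1) * (- real_of_int (y j) - 1)"

lemma real_sph_sums:
  assumes "x \<in> sph K d"
  shows "(\<Sum>k\<in>posc K x. real_of_int (x k)) = real d" "(\<Sum>k\<in>negc K x. real_of_int (x k)) = - real d"
  using arg_cong[OF sph_sums(1)[OF assms], of real_of_int] arg_cong[OF sph_sums(2)[OF assms], of real_of_int]
  by (simp_all add: sum_negf)

lemma flow_parts_nonneg: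
  assumes "i \<in> posc K y" "j \<in> negc K y"
  shows "0 \<le> growth_flow K d y i j" "0 \<le> radial_flow y i j"
proof -
  have "y i \<ge> 1" "y j \<le> -1" using assms by (auto simp: posc_def negc_def)
  then have ab: "real_of_int (y i) - 1 \<ge> 0" "- real_of_int (y j) - 1 \<ge> 0" by linarith+
  have "card (posc K y) \<ge> 1" "card (negc K y) \<ge> 1"
    using assms by (metis card_gt_0_iff One_nat_def Suc_leI empty_iff finite_posc finite_negc)+
  with ab show "0 \<le> growth_flow K d y i j" "0 \<le> radial_flow y i j"
    by (auto simp: growth_flow_def radial_flow_def Let_def intro!: add_nonneg_nonneg divide_nonneg_nonneg mult_nonneg_nonneg)
qed

text \<open>Expanded, this is \<open>D^2\<close> minus the inflow of \<open>growth_flow\<close> at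
  the same vertex. The complementarity is what lets the numbers of positive and negative coordinates
  cancel in \<open>flow\<close>.\<close>

lemma radial_flow_in:
  assumes "y \<in> sph K D"
  shows "(\<Sum>i\<in>posc K y. \<Sum>j\<in>negc K y. radial_flow y i j) =
    (real D - real (card (posc K y))) * (real D - real (card (negc K y)))"
  unfolding radial_flow_def sum_product[symmetric]
  by (simp add: sum_subtractf sum_negf real_sph_sums[OF assms])

lemma sph_nonzero_cards:
  assumes "y \<in> sph K (Suc d)"
  shows "posc K y \<noteq> {}" "negc K y \<noteq> {}"
  using sph_sums[OF assms] by auto

lemma growth_flow_in:
  assumes y: "y \<in> sph K (Suc d)"
  defines "p \<equiv> real (card (posc K y))" and "q \<equiv> real (card (negc K y))"
  shows "(\<Sum>i\<in>posc K y. \<Sum>j\<in>negc K y. growth_flow K d y i j) = real (Suc d) * (p + q) - p * q"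
proof -
  let ?P = "posc K y" and ?Q = "negc K y"
  have A: "(\<Sum>i\<in>?P. real_of_int (y i) - 1) = real (Suc d) - p"
    by (simp add: sum_subtractf real_sph_sums[OF y] p_def)
  have B: "(\<Sum>j\<in>?Q. - real_of_int (y j) - 1) = real (Suc d) - q"
    by (simp add: sum_subtractf sum_negf real_sph_sums[OF y] q_def)
  have AB: "(\<Sum>i\<in>?P. \<Sum>j\<in>?Q. (real_of_int (y i) - 1) * (- real_of_int (y j) - 1)) =
      (real (Suc d) - p) * (real (Suc d) - q)"
    unfolding sum_product[symmetric] A B ..
  have A': "(\<Sum>i\<in>?P. \<Sum>j\<in>?Q. real_of_int (y i) - 1) = q * (real (Suc d) - p)"
    by (simp add: A sum_distrib_left[symmetric] q_def)
  have B': "(\<Sum>i\<in>?P. \<Sum>j\<in>?Q. - real_of_int (y j) - 1) = p * (real (Suc d) - q)"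
    using B by (simp add: p_def)
  have "(\<Sum>i\<in>?P. \<Sum>j\<in>?Q. growth_flow K d y i j) = p * q + ((p - 1) * (p * (real (Suc d) - q))
      + (q - 1) * (q * (real (Suc d) - p)) + (p + q) * ((real (Suc d) - p) * (real (Suc d) - q))) / real d"
    unfolding A'[symmetric] B'[symmetric] AB[symmetric]
    unfolding growth_flow_def Let_def p_def[symmetric] q_def[symmetric]
    by (simp add: sum.distrib sum_divide_distrib[symmetric] sum_distrib_left[symmetric] p_def[symmetric] q_def[symmetric] mult.assoc
        del: of_nat_Suc sum_subtractf)
  also have "\<dots> = real (Suc d) * (p + q) - p * q"
  proof (cases "d = 0")
    \<comment> \<open>On level 1 both supports are singletons with entries 1 and -1, so the
      numerator vanishes and reading division by zero as 0 does no harm.\<close>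
    case True
    have "card ?P \<noteq> 0" "card ?Q \<noteq> 0" using sph_nonzero_cards[OF y] by auto
    then have "card ?P = 1" "card ?Q = 1" using card_le_level[OF y] True by linarith+
    then show ?thesis using True by (simp add: p_def q_def)
  next
    case False
    then show ?thesis by (simp add: field_simps)
  qed
  finally show ?thesis .
qed

lemma upedge_decomp:
  "upedge K x = (posc K x \<times> negc K x) \<union> (posc K x \<times> zerc K x) \<union> (zerc K x \<times> negc K x)
     \<union> ((zerc K x \<times> zerc K x) - (\<lambda>i. (i, i)) ` zerc K x)"
  by (auto simp: upedge_def posc_def negc_def zerc_def)

lemma sum_upedge:
  fixes f :: "nat \<Rightarrow> nat \<Rightarrow> real"
  shows "(\<Sum>(i, j)\<in>upedge K x. f i j) = (\<Sum>i\<in>posc K x. \<Sum>j\<in>negc K x. f i j)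
    + (\<Sum>i\<in>posc K x. \<Sum>j\<in>zerc K x. f i j) + (\<Sum>i\<in>zerc K x. \<Sum>j\<in>negc K x. f i j)
    + ((\<Sum>i\<in>zerc K x. \<Sum>j\<in>zerc K x. f i j) - (\<Sum>i\<in>zerc K x. f i i))"
proof -
  have 1: "(\<Sum>(i, j)\<in>(zerc K x \<times> zerc K x) - (\<lambda>i. (i, i)) ` zerc K x. f i j) =
     (\<Sum>i\<in>zerc K x. \<Sum>j\<in>zerc K x. f i j) - (\<Sum>i\<in>zerc K x. f i i)"
    by (subst sum_diff) (auto simp: sum.cartesian_product sum.reindex inj_on_def)
  show ?thesis unfolding upedge_decomp
    by (subst sum.union_disjoint; (force simp: posc_def negc_def zerc_def intro!: finite_subset[OF _ finite_cartesian_product])?)+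
       (simp add: 1 sum.cartesian_product)
qed

lemma cards_shift:
  assumes "(i, j) \<in> upedge K x"
  shows "card (posc K (shift x i j)) = card (posc K x) + (if x i = 0 then 1 else 0)"
        "card (negc K (shift x i j)) = card (negc K x) + (if x j = 0 then 1 else 0)"
proof -
  have "posc K (shift x i j) = insert i (posc K x)" "negc K (shift x i j) = insert j (negc K x)"
    using assms by (auto simp: upedge_def posc_def negc_def shift_def)
  then show "card (posc K (shift x i j)) = card (posc K x) + (if x i = 0 then 1 else 0)"
        "card (negc K (shift x i j)) = card (negc K x) + (if x j = 0 then 1 else 0)"
    using assms by (auto simp: posc_def negc_def upedge_def card_insert_if)
qed

lemma radial_flow_out:
  assumes x: "x \<in> sph K d"
  shows "(\<Sum>(i, j)\<in>upedge K x. radial_flow (shift x i j) i j) = (real d)\<^sup>2"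
proof -
  have "(\<Sum>(i, j)\<in>upedge K x. radial_flow (shift x i j) i j) = (\<Sum>(i, j)\<in>upedge K x. real_of_int (x i) * - real_of_int (x j))"
    by (intro sum.cong) (auto simp: radial_flow_def shift_def upedge_def)
  also have "\<dots> = (\<Sum>i\<in>posc K x. \<Sum>j\<in>negc K x. real_of_int (x i) * - real_of_int (x j))"
    unfolding sum_upedge by (simp add: zerc_def)
  also have "\<dots> = (real d)\<^sup>2"
    unfolding sum_product[symmetric] by (simp add: real_sph_sums[OF x] sum_negf power2_eq_square)
  finally show ?thesis .
qed

text \<open>An edge that uses a zero coordinate enlarges a support, so the coefficient
  \<open>p - 1\<close> or \<open>q - 1\<close> taken at the upper endpoint becomes \<open>p\<close>
  or \<open>q\<close> there. With these values the four kinds of edges add up to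
  \<open>(p + q + z)^2 - (p + q + z)\<close>, apart from the terms
  \<open>d * (p + q) - p * q\<close>, and \<open>p + q + z = K\<close>.\<close>

lemma growth_flow_out:
  assumes x: "x \<in> sph K d"
  defines "p \<equiv> real (card (posc K x))" and "q \<equiv> real (card (negc K x))"
  shows "(\<Sum>(i, j)\<in>upedge K x. growth_flow K d (shift x i j) i j) =
     real K * (real K - 1) + real d * (p + q) - p * q"
proof -
  define z where "z = real (card (zerc K x))"
  let ?P = "posc K x" and ?Q = "negc K x" and ?Z = "zerc K x"
  have K: "real K = p + q + z" using card_coord[of K x] unfolding p_def q_def z_def by linarith
  define F where "F i j = 1 + ((p + (if x i = 0 then 1 else 0) - 1) * (- real_of_int (x j))
     + (q + (if x j = 0 then 1 else 0) - 1) * real_of_int (x i)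
     + (p + q) * (real_of_int (x i) * (- real_of_int (x j)))) / real d" for i j
  have A: "(\<Sum>i\<in>?P. real_of_int (x i)) = real d" by (rule real_sph_sums[OF x])
  have B: "(\<Sum>j\<in>?Q. - real_of_int (x j)) = real d" by (simp add: sum_negf real_sph_sums[OF x])
  have AB: "(\<Sum>i\<in>?P. \<Sum>j\<in>?Q. real_of_int (x i) * - real_of_int (x j)) = real d * real d"
    unfolding sum_product[symmetric] A B ..
  have eq: "growth_flow K d (shift x i j) i j = F i j" if "(i, j) \<in> upedge K x" for i j
  proof -
    have sv: "shift x i j i = x i + 1" "shift x i j j = x j - 1"
      using that by (auto simp: upedge_def shift_def)
    show ?thesis
      unfolding growth_flow_def Let_def F_def cards_shift[OF that] sv p_def q_def by (simp add: algebra_simps)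
  qed
  have PQ: "(\<Sum>i\<in>?P. \<Sum>j\<in>?Q. F i j) = p * q + ((p - 1) * (p * d) + (q - 1) * (q * d) + (p + q) * (real d * real d)) / d"
  proof -
    have "(\<Sum>i\<in>?P. \<Sum>j\<in>?Q. F i j) = (\<Sum>i\<in>?P. \<Sum>j\<in>?Q. 1 + ((p - 1) * (- real_of_int (x j))
     + (q - 1) * real_of_int (x i) + (p + q) * (real_of_int (x i) * (- real_of_int (x j)))) / real d)"
      by (intro sum.cong) (auto simp: F_def posc_def negc_def)
    also have "\<dots> = p * q + ((p - 1) * (\<Sum>i\<in>?P. \<Sum>j\<in>?Q. - real_of_int (x j)) + (q - 1) * (\<Sum>i\<in>?P. \<Sum>j\<in>?Q. real_of_int (x i))
       + (p + q) * (\<Sum>i\<in>?P. \<Sum>j\<in>?Q. real_of_int (x i) * - real_of_int (x j))) / d"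
      by (simp only: sum.distrib sum_divide_distrib[symmetric] sum_distrib_left[symmetric]) (simp add: p_def q_def)
    also have "(\<Sum>i\<in>?P. \<Sum>j\<in>?Q. - real_of_int (x j)) = p * d" unfolding B by (simp add: p_def)
    also have "(\<Sum>i\<in>?P. \<Sum>j\<in>?Q. real_of_int (x i)) = q * d"
      by (simp add: sum_distrib_left[symmetric] A q_def)
    finally show ?thesis unfolding AB .
  qed
  have PZ: "(\<Sum>i\<in>?P. \<Sum>j\<in>?Z. F i j) = p * z + q * z * d / d"
  proof -
    have "(\<Sum>i\<in>?P. \<Sum>j\<in>?Z. F i j) = (\<Sum>i\<in>?P. \<Sum>j\<in>?Z. 1 + q * real_of_int (x i) / d)"
      by (intro sum.cong) (auto simp: F_def zerc_def)
    also have "\<dots> = p * z + z * (q * (\<Sum>i\<in>?P. real_of_int (x i)) / d)"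
      by (simp add: sum.distrib sum_divide_distrib[symmetric] sum_distrib_left[symmetric] p_def z_def distrib_left)
    finally show ?thesis unfolding A by simp
  qed
  have ZQ: "(\<Sum>i\<in>?Z. \<Sum>j\<in>?Q. F i j) = q * z + p * z * d / d"
  proof -
    have "(\<Sum>i\<in>?Z. \<Sum>j\<in>?Q. F i j) = (\<Sum>i\<in>?Z. \<Sum>j\<in>?Q. 1 + p * (- real_of_int (x j)) / d)"
      by (intro sum.cong) (auto simp: F_def zerc_def)
    also have "\<dots> = z * (q + p * (\<Sum>j\<in>?Q. - real_of_int (x j)) / d)"
      by (simp only: sum.distrib sum_divide_distrib[symmetric] sum_distrib_left[symmetric]) (simp add: q_def z_def distrib_left)
    finally show ?thesis unfolding B by (simp add: distrib_left)
  qed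
  have ZZ: "(\<Sum>i\<in>?Z. \<Sum>j\<in>?Z. F i j) = z * z" "(\<Sum>i\<in>?Z. F i i) = z"
    by (simp_all add: F_def zerc_def z_def)
  have "(\<Sum>(i, j)\<in>upedge K x. growth_flow K d (shift x i j) i j) = (\<Sum>(i, j)\<in>upedge K x. F i j)"
    by (intro sum.cong) (auto simp: eq)
  also have "\<dots> = real K * (real K - 1) + real d * (p + q) - p * q"
  proof (cases "d = 0")
    case True
    have "p = 0" "q = 0" using card_le_level[OF x] True by (simp_all add: p_def q_def)
    then show ?thesis unfolding sum_upedge PQ PZ ZQ ZZ K using True by (simp add: algebra_simps)
  next
    case False
    then show ?thesis unfolding sum_upedge PQ PZ ZQ ZZ K by (simp add: field_simps)
  qed
  finally show ?thesis .
qed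

text \<open>
  \<open>excess\<close> is the divergence of \<open>flow\<close>, in which the numbers of positive and negative coordinates cancel.
\<close>

definition flow :: "nat \<Rightarrow> (nat \<Rightarrow> real) \<Rightarrow> nat \<Rightarrow> (nat \<Rightarrow> int) \<Rightarrow> nat \<Rightarrow> nat \<Rightarrow> real" where
  "flow K H d y i j = H d * growth_flow K d y i j + (H d - H (Suc d)) * radial_flow y i j"

lemma flow_nonneg:
  assumes "i \<in> posc K y" "j \<in> negc K y" "antimono H" "\<And>d. 0 \<le> H d"
  shows "0 \<le> flow K H d y i j"
proof -
  have "H (Suc d) \<le> H d" using assms(3) by (simp add: antimonoD)
  then show ?thesis using flow_parts_nonneg(1)[OF assms(1,2), of d] flow_parts_nonneg(2)[OF assms(1,2)] assms(4) by (simp add: flow_def)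
qed

text \<open>Let \<open>D = Suc d\<close> and \<open>G = D * (p + q) - p * q\<close>. The inflow is
  \<open>H d * G + (H d - H D) * (D^2 - G)\<close>, that is
  \<open>H D * G + (H d - H D) * D^2\<close>; the outflow is
  \<open>H D * (G + K * (K - 1)) + (H D - H (D + 1)) * D^2\<close>. So \<open>G\<close> drops out of
  the difference.\<close>

lemma flow_balance_Suc:
  assumes y: "y \<in> sph K (Suc d)"
  shows "(\<Sum>(i, j)\<in>posc K y \<times> negc K y. flow K H d y i j)
     - (\<Sum>(i, j)\<in>upedge K y. flow K H (Suc d) (shift y i j) i j)
    = (real (Suc d))\<^sup>2 * (H d - 2 * H (Suc d) + H (Suc (Suc d))) - real K * (real K - 1) * H (Suc d)"
proof -
  have "(\<Sum>(i, j)\<in>posc K y \<times> negc K y. flow K H d y i j) =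
     H d * (\<Sum>i\<in>posc K y. \<Sum>j\<in>negc K y. growth_flow K d y i j) + (H d - H (Suc d)) * (\<Sum>i\<in>posc K y. \<Sum>j\<in>negc K y. radial_flow y i j)"
    by (simp add: flow_def sum.cartesian_product[symmetric] sum.distrib sum_distrib_left)
  moreover have "(\<Sum>(i, j)\<in>upedge K y. flow K H (Suc d) (shift y i j) i j) =
     H (Suc d) * (\<Sum>(i, j)\<in>upedge K y. growth_flow K (Suc d) (shift y i j) i j)
     + (H (Suc d) - H (Suc (Suc d))) * (\<Sum>(i, j)\<in>upedge K y. radial_flow (shift y i j) i j)"
    by (simp add: flow_def case_prod_unfold sum.distrib sum_distrib_left)
  ultimately show ?thesis
    unfolding growth_flow_in[OF y] radial_flow_in[OF y] growth_flow_out[OF y] radial_flow_out[OF y]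
    by (simp add: algebra_simps power2_eq_square)
qed

lemma flow_out_0:
  assumes x: "x \<in> sph K 0"
  shows "(\<Sum>(i, j)\<in>upedge K x. flow K H 0 (shift x i j) i j) = real K * (real K - 1) * H 0"
proof -
  have "(\<Sum>(i, j)\<in>upedge K x. flow K H 0 (shift x i j) i j) =
     H 0 * (\<Sum>(i, j)\<in>upedge K x. growth_flow K 0 (shift x i j) i j)
     + (H 0 - H 1) * (\<Sum>(i, j)\<in>upedge K x. radial_flow (shift x i j) i j)"
    by (simp add: flow_def case_prod_unfold sum.distrib sum_distrib_left)
  moreover have "card (posc K x) = 0" "card (negc K x) = 0" using card_le_level[OF x] by auto
  ultimately show ?thesis unfolding growth_flow_out[OF x] radial_flow_out[OF x] by simp
qed

definition excess :: "nat \<Rightarrow> (nat \<Rightarrow> real) \<Rightarrow> nat \<Rightarrow> real" where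
  "excess K H d = (real d)\<^sup>2 * (H (d - 1) - 2 * H d + H (Suc d)) - real K * (real K - 1) * H d"

text \<open>Summation by parts on the edges: every vertex collects \<psi> times inflow minus
  outflow. The two zeros of \<open>H\<close> stop the flow from leaving level \<open>Suc n\<close>,
  but this level still receives from level \<open>n\<close>; hence the sum on the right runs one
  level further.\<close>

lemma flow_identity:
  assumes H: "H (Suc n) = 0" "H (Suc (Suc n)) = 0"
  shows "(\<Sum>d\<le>n. \<Sum>x\<in>sph K d. \<Sum>(i, j)\<in>upedge K x. flow K H d (shift x i j) i j * (\<psi> (shift x i j) - \<psi> x))
    = (\<Sum>d\<le>Suc n. excess K H d * (\<Sum>x\<in>sph K d. \<psi> x))"
proof -
  define In where "In d y = (\<Sum>(i, j)\<in>posc K y \<times> negc K y. flow K H d y i j)" for d y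
  define Out where "Out d x = (\<Sum>(i, j)\<in>upedge K x. flow K H d (shift x i j) i j)" for d x
  have in_eq: "(\<Sum>x\<in>sph K d. \<Sum>(i, j)\<in>upedge K x. flow K H d (shift x i j) i j * \<psi> (shift x i j))
     = (\<Sum>y\<in>sph K (Suc d). In d y * \<psi> y)" for d
  proof -
    have "(\<Sum>x\<in>sph K d. \<Sum>(i, j)\<in>upedge K x. flow K H d (shift x i j) i j * \<psi> (shift x i j)) =
       (\<Sum>(x, i, j)\<in>(SIGMA x:sph K d. upedge K x). flow K H d (shift x i j) i j * \<psi> (shift x i j))"
      by (subst sum.Sigma) (auto simp: finite_sph)
    also have "\<dots> = (\<Sum>(y, i, j)\<in>(SIGMA y:sph K (Suc d). posc K y \<times> negc K y). flow K H d y i j * \<psi> y)"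
      by (subst sum.reindex_bij_betw[OF up_edge_bij, symmetric]) (simp add: case_prod_unfold)
    also have "\<dots> = (\<Sum>y\<in>sph K (Suc d). \<Sum>(i, j)\<in>posc K y \<times> negc K y. flow K H d y i j * \<psi> y)"
      by (subst sum.Sigma) (auto simp: finite_sph)
    also have "\<dots> = (\<Sum>y\<in>sph K (Suc d). In d y * \<psi> y)"
      by (simp add: In_def sum_distrib_right case_prod_unfold)
    finally show ?thesis .
  qed
  have out_eq: "(\<Sum>x\<in>sph K d. \<Sum>(i, j)\<in>upedge K x. flow K H d (shift x i j) i j * \<psi> x)
     = (\<Sum>x\<in>sph K d. Out d x * \<psi> x)" for d
    by (simp add: Out_def sum_distrib_right case_prod_unfold)
  have last: "Out (Suc n) x = 0" for x by (simp add: Out_def flow_def H)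
  have "(\<Sum>d\<le>n. \<Sum>x\<in>sph K d. \<Sum>(i, j)\<in>upedge K x. flow K H d (shift x i j) i j * (\<psi> (shift x i j) - \<psi> x))
    = (\<Sum>d\<le>n. (\<Sum>y\<in>sph K (Suc d). In d y * \<psi> y)) - (\<Sum>d\<le>n. \<Sum>x\<in>sph K d. Out d x * \<psi> x)"
    unfolding in_eq[symmetric] out_eq[symmetric] sum_subtractf[symmetric]
    by (simp add: right_diff_distrib case_prod_unfold)
  also have "(\<Sum>d\<le>n. \<Sum>x\<in>sph K d. Out d x * \<psi> x) = (\<Sum>d\<le>Suc n. \<Sum>x\<in>sph K d. Out d x * \<psi> x)"
    by (simp add: last)
  also have "\<dots> = (\<Sum>x\<in>sph K 0. Out 0 x * \<psi> x) + (\<Sum>d\<le>n. \<Sum>x\<in>sph K (Suc d). Out (Suc d) x * \<psi> x)"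
    by (rule sum.atMost_Suc_shift)
  also have "(\<Sum>d\<le>n. \<Sum>y\<in>sph K (Suc d). In d y * \<psi> y) - ((\<Sum>x\<in>sph K 0. Out 0 x * \<psi> x)
     + (\<Sum>d\<le>n. \<Sum>x\<in>sph K (Suc d). Out (Suc d) x * \<psi> x))
    = - (\<Sum>x\<in>sph K 0. Out 0 x * \<psi> x) + (\<Sum>d\<le>n. \<Sum>y\<in>sph K (Suc d). (In d y - Out (Suc d) y) * \<psi> y)"
    by (simp add: sum_subtractf left_diff_distrib)
  also have "\<dots> = excess K H 0 * (\<Sum>x\<in>sph K 0. \<psi> x) + (\<Sum>d\<le>n. excess K H (Suc d) * (\<Sum>x\<in>sph K (Suc d). \<psi> x))"
    using flow_balance_Suc[of _ K _ H] flow_out_0[of _ K H]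
    by (simp add: In_def Out_def excess_def sum_distrib_left sum_negf[symmetric])
  also have "\<dots> = (\<Sum>d\<le>Suc n. excess K H d * (\<Sum>x\<in>sph K d. \<psi> x))"
    by (rule sum.atMost_Suc_shift[symmetric])
  finally show ?thesis .
qed

section \<open>Binomial profiles and averages over pairs of compositions\<close>

lemma binomial_step: "real (Suc n) * real (Suc n + m choose m) = real (Suc n + m) * real (n + m choose m)"
proof -
  have "Suc n * (Suc (n + m) choose Suc n) = Suc (n + m) * (n + m choose n)"
    by (rule Suc_times_binomial_eq[symmetric, unfolded mult.commute[of _ "Suc _"]])
  moreover have "Suc (n + m) choose Suc n = Suc n + m choose m" "n + m choose n = n + m choose m"
    by (subst binomial_symmetric; simp)+
  ultimately have "Suc n * (Suc n + m choose m) = Suc (n + m) * (n + m choose m)" by simp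
  then have "real (Suc n * (Suc n + m choose m)) = real (Suc (n + m) * (n + m choose m))" by (simp only:)
  then show ?thesis by (simp only: of_nat_mult add_Suc)
qed

text \<open>By the hockey-stick identity this profile is the tail sum over levels
  \<open>j \<ge> d\<close> of the weights \<open>n + m - j choose m\<close> of \<open>layer\<close>.
  The divergence then compares the weights of two consecutive layers, with factors in the ratio of
  the squared numbers of compositions of \<open>Suc n\<close> and of \<open>n\<close>.\<close>

lemma excess_binomial:
  assumes "d \<le> Suc n" "0 < m"
  shows "excess (Suc m) (\<lambda>d. real (n + Suc m - d choose Suc m)) d =
     (real (Suc n))\<^sup>2 * real (Suc n + m - d choose m) - (real (Suc n + m))\<^sup>2 * real (n + m - d choose m)"
proof (cases "d = Suc n")
  case True
  then show ?thesis using assms(2)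
    by (simp add: excess_def binomial_eq_0)
next
  case False
  with assms(1) obtain k where n: "n = d + k" by (metis le_SucE le_iff_add)
  define B where "B = real (k + m choose m)"
  have 1: "real (k + Suc m choose Suc m) * (real m + 1) = (real k + real m + 1) * B"
    using Suc_times_binomial_eq[of "k + m" m] unfolding B_def
    by (metis (no_types, lifting) add.commute add_Suc_right of_nat_Suc of_nat_add of_nat_mult add.assoc)
  have 2: "real (Suc k + m choose m) * (real k + 1) = (real k + real m + 1) * B"
    using binomial_step[of k m] by (simp add: B_def algebra_simps)
  \<comment> \<open>Only for \<open>d > 0\<close>: at \<open>d = 0\<close> the truncated
    \<open>d - 1\<close> spoils the second difference, but there its factor \<open>d^2\<close>
    removes it.\<close>
  have pd: "real (n + Suc m - (d - 1) choose Suc m) - 2 * real (n + Suc m - d choose Suc m)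
     + real (n + Suc m - Suc d choose Suc m) = real (Suc k + m choose m) - B" if "d > 0"
  proof -
    have a: "n + Suc m - (d - 1) = Suc (k + Suc m)" "n + Suc m - d = Suc (k + m)" "n + Suc m - Suc d = k + m"
      using that by (auto simp: n)
    show ?thesis unfolding a by (simp add: B_def)
  qed
  have e: "excess (Suc m) (\<lambda>d. real (n + Suc m - d choose Suc m)) d = (real d)\<^sup>2 * (real (Suc k + m choose m) - B)
     - real m * ((real k + real m + 1) * B)"
  proof -
    have h: "n + Suc m - d = k + Suc m" by (simp add: n)
    have "real (Suc m) * (real (Suc m) - 1) * real (n + Suc m - d choose Suc m) = real m * ((real k + real m + 1) * B)"
      unfolding h 1[symmetric] by simp
    moreover have "(real d)\<^sup>2 * (real (n + Suc m - (d - 1) choose Suc m) - 2 * real (n + Suc m - d choose Suc m)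
     + real (n + Suc m - Suc d choose Suc m)) = (real d)\<^sup>2 * (real (Suc k + m choose m) - B)"
      by (cases "d = 0") (simp, simp only: pd)
    ultimately show ?thesis unfolding excess_def by (simp only:)
  qed
  define Y where "Y = real (Suc k + m choose m)"
  have Y: "Y * (real k + 1) = (real k + real m + 1) * B" using 2 by (simp only: Y_def)
  have "Suc n + m - d = Suc k + m" "n + m - d = k + m" by (auto simp: n)
  moreover have "real (Suc n) = real d + real k + 1" "real (Suc n + m) = real d + real k + 1 + real m"
    by (simp_all add: n)
  moreover have "(real d)\<^sup>2 * (Y - B) - real m * ((real k + real m + 1) * B)
     = (real d + real k + 1)\<^sup>2 * Y - (real d + real k + 1 + real m)\<^sup>2 * B"
    using Y by algebra
  ultimately show ?thesis unfolding e by (simp only: Y_def B_def)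
qed

text \<open>
  \<open>layer m \<psi> n\<close> is the sum of \<open>\<psi>(u - v)\<close> over all pairs of compositions \<open>u, v\<close> of \<open>n\<close> into \<open>m + 1\<close> parts:
  the pair is determined by \<open>u - v\<close> and the coordinatewise minimum of \<open>u\<close> and \<open>v\<close>.
\<close>

definition layer :: "nat \<Rightarrow> ((nat \<Rightarrow> int) \<Rightarrow> real) \<Rightarrow> nat \<Rightarrow> real" where
  "layer m \<psi> n = (\<Sum>d\<le>n. real (n + m - d choose m) * (\<Sum>x\<in>sph (Suc m) d. \<psi> x))"

lemma layer_diff:
  assumes "0 < m"
  shows "(real (Suc n))\<^sup>2 * layer m \<psi> (Suc n) - (real (Suc n + m))\<^sup>2 * layer m \<psi> n =
   (\<Sum>d\<le>Suc n. excess (Suc m) (\<lambda>d. real (n + Suc m - d choose Suc m)) d * (\<Sum>x\<in>sph (Suc m) d. \<psi> x))"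
proof -
  have "layer m \<psi> n = (\<Sum>d\<le>Suc n. real (n + m - d choose m) * (\<Sum>x\<in>sph (Suc m) d. \<psi> x))"
    using assms by (simp add: layer_def binomial_eq_0)
  moreover have "(\<Sum>d\<le>Suc n. excess (Suc m) (\<lambda>d. real (n + Suc m - d choose Suc m)) d * (\<Sum>x\<in>sph (Suc m) d. \<psi> x)) =
     (\<Sum>d\<le>Suc n. ((real (Suc n))\<^sup>2 * real (Suc n + m - d choose m) - (real (Suc n + m))\<^sup>2 * real (n + m - d choose m)) * (\<Sum>x\<in>sph (Suc m) d. \<psi> x))"
    by (intro sum.cong refl) (simp only: excess_binomial[OF _ assms] atMost_iff)
  ultimately show ?thesis
    by (simp only: layer_def[of m \<psi> "Suc n"] sum_distrib_left[of _ _ "{..Suc n}"] sum_subtractf left_diff_distrib mult.assoc)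
qed

text \<open>The number of pairs is \<open>(n + m choose m)^2\<close>, which grows from
  \<open>n\<close> to \<open>Suc n\<close> by the factor \<open>(Suc n + m)^2 / (Suc n)^2\<close>;
  so the inequality compares averages. The difference of its two sides is a nonnegative flow tested
  against the increments of \<psi> along edges.\<close>

lemma layer_mono:
  assumes m: "0 < m" and mono: "\<And>d x i j. d \<le> n \<Longrightarrow> x \<in> sph (Suc m) d \<Longrightarrow> (i, j) \<in> upedge (Suc m) x \<Longrightarrow> \<psi> x \<le> \<psi> (shift x i j)"
  shows "(real (Suc n + m))\<^sup>2 * layer m \<psi> n \<le> (real (Suc n))\<^sup>2 * layer m \<psi> (Suc n)"
proof -
  define H where "H d = real (n + Suc m - d choose Suc m)" for d
  have H0: "H (Suc n) = 0" "H (Suc (Suc n)) = 0" by (auto simp: H_def binomial_eq_0)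
  have "antimono H"
    unfolding H_def by (auto simp: antimono_def intro!: binomial_right_mono)
  have "0 \<le> (\<Sum>d\<le>n. \<Sum>x\<in>sph (Suc m) d. \<Sum>(i, j)\<in>upedge (Suc m) x. flow (Suc m) H d (shift x i j) i j * (\<psi> (shift x i j) - \<psi> x))"
  proof (intro sum_nonneg, safe)
    fix d x i j assume "d \<le> n" and x: "x \<in> sph (Suc m) d" and ij: "(i, j) \<in> upedge (Suc m) x"
    have "i \<in> posc (Suc m) (shift x i j)" "j \<in> negc (Suc m) (shift x i j)"
      using ij by (auto simp: upedge_def posc_def negc_def shift_def)
    then have "0 \<le> flow (Suc m) H d (shift x i j) i j"
      by (rule flow_nonneg) (use \<open>antimono H\<close> in \<open>auto simp: H_def\<close>)
    with mono[OF \<open>d \<le> n\<close> x ij]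
    show "0 \<le> flow (Suc m) H d (shift x i j) i j * (\<psi> (shift x i j) - \<psi> x)" by simp
  qed
  also have "\<dots> = (real (Suc n))\<^sup>2 * layer m \<psi> (Suc n) - (real (Suc n + m))\<^sup>2 * layer m \<psi> n"
    unfolding flow_identity[OF H0] layer_diff[OF m] H_def ..
  finally show ?thesis by simp
qed

lemma sph_0: "sph K 0 = {\<lambda>_. 0}"
proof -
  have "x = (\<lambda>_. 0)" if "x \<in> sph K 0" for x
  proof
    fix k
    have "(\<Sum>k<K. \<bar>x k\<bar>) = 0" using that by (auto simp: sph_def)
    then have "\<forall>k\<in>{..<K}. \<bar>x k\<bar> = 0" by (subst (asm) sum_nonneg_eq_0_iff) auto
    then show "x k = 0" using that by (cases "k < K") (auto simp: sph_def)
  qed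
  then show ?thesis by (auto simp: sph_def)
qed

text \<open>For constant \<psi> all increments along edges vanish and the comparison of consecutive
  layers becomes an equality, a recursion that the squared binomials satisfy too.\<close>

lemma layer_one:
  assumes m: "0 < m"
  shows "layer m (\<lambda>_. 1) n = (real (n + m choose m))\<^sup>2"
proof (induction n)
  case 0
  then show ?case by (simp add: layer_def sph_0)
next
  case (Suc n)
  have "(real (Suc n + m))\<^sup>2 * layer m (\<lambda>_. 1) n = (real (Suc n))\<^sup>2 * layer m (\<lambda>_. 1) (Suc n)"
  proof -
    define H where "H d = real (n + Suc m - d choose Suc m)" for d
    have H0: "H (Suc n) = 0" "H (Suc (Suc n)) = 0" by (auto simp: H_def binomial_eq_0)
    show ?thesis
      using flow_identity[OF H0, of "Suc m" "\<lambda>_. 1"] layer_diff[OF m, of n "\<lambda>_. 1"]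
      by (simp add: H_def case_prod_unfold del: of_nat_Suc sum.atMost_Suc)
  qed
  moreover have "real (Suc n) * real (Suc n + m choose m) = real (Suc n + m) * real (n + m choose m)"
    by (rule binomial_step)
  ultimately have "(real (Suc n))\<^sup>2 * layer m (\<lambda>_. 1) (Suc n) = (real (Suc n))\<^sup>2 * (real (Suc n + m choose m))\<^sup>2"
    unfolding Suc power_mult_distrib[symmetric] by (simp del: of_nat_Suc)
  then show ?case by (simp del: of_nat_Suc)
qed

section \<open>Generating functions\<close>

lemma binomial_series:
  fixes z :: real
  assumes "0 \<le> z" "z < 1"
  shows "(\<lambda>n. real (n + m choose m) * z ^ n) sums (1 / (1 - z) ^ Suc m)"
proof (induction m)
  case 0
  then show ?case using geometric_sums[of z] assms by simp
next
  case (Suc m)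
  have "(\<lambda>k. \<Sum>i\<le>k. (real (i + m choose m) * z ^ i) * z ^ (k - i)) sums
     ((\<Sum>n. real (n + m choose m) * z ^ n) * (\<Sum>n. z ^ n))"
  proof (rule Cauchy_product_sums)
    show "summable (\<lambda>k. norm (real (k + m choose m) * z ^ k))"
      using sums_summable[OF Suc] assms by (simp add: abs_mult)
    show "summable (\<lambda>k. norm (z ^ k))" using assms by (simp add: summable_geometric)
  qed
  also have "(\<Sum>n. real (n + m choose m) * z ^ n) = 1 / (1 - z) ^ Suc m" using Suc by (rule sums_unique[symmetric])
  also have "(\<Sum>n. z ^ n) = 1 / (1 - z)" using assms by (intro suminf_geometric) auto
  also have "(\<lambda>k. \<Sum>i\<le>k. (real (i + m choose m) * z ^ i) * z ^ (k - i)) = (\<lambda>n. real (n + Suc m choose Suc m) * z ^ n)"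
  proof
    fix n
    have "(\<Sum>i\<le>n. (real (i + m choose m) * z ^ i) * z ^ (n - i)) = (\<Sum>i\<le>n. real (m + i choose m) * z ^ n)"
      by (intro sum.cong) (auto simp: power_add[symmetric] add.commute)
    also have "\<dots> = real (\<Sum>i\<le>n. (m + i choose m)) * z ^ n" by (simp add: sum_distrib_right)
    also have "(\<Sum>i\<le>n. (m + i choose m)) = n + Suc m choose Suc m"
      using choose_rising_sum(1)[of m n] by (simp add: add_ac)
    finally show "(\<Sum>i\<le>n. (real (i + m choose m) * z ^ i) * z ^ (n - i)) = real (n + Suc m choose Suc m) * z ^ n" .
  qed
  finally show ?case by (simp add: mult_ac)
qed

lemma choose_add_vandermonde: "(n + m) choose m = (\<Sum>j\<le>m. (m choose j) * (n choose j))"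
proof -
  have "(n + m) choose m = (\<Sum>j\<le>m. (n choose j) * (m choose (m - j)))" by (rule vandermonde[symmetric])
  also have "\<dots> = (\<Sum>j\<le>m. (m choose j) * (n choose j))"
    by (intro sum.cong) (auto simp: binomial_symmetric[symmetric])
  finally show ?thesis .
qed

text \<open>Vandermonde expands one factor, and the other is absorbed into each term. Afterwards
  \<open>n\<close> occurs only in \<open>n + m choose (m + j)\<close>, whose generating function is
  a shifted negative binomial series.\<close>

lemma choose_square_expand:
  "((n + m) choose m)\<^sup>2 = (\<Sum>j\<le>m. (m choose j) * ((m + j) choose m) * ((n + m) choose (m + j)))"
proof -
  have *: "((n + m) choose m) * (n choose j) = ((m + j) choose m) * ((n + m) choose (m + j))" for j
  proof (cases "j \<le> n")
    case True
    then show ?thesis using choose_mult[of m "m + j" "n + m"] by (simp add: mult.commute)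
  qed (simp add: binomial_eq_0)
  have "((n + m) choose m)\<^sup>2 = ((n + m) choose m) * (\<Sum>j\<le>m. (m choose j) * (n choose j))"
    unfolding power2_eq_square by (subst (2) choose_add_vandermonde) (rule refl)
  also have "\<dots> = (\<Sum>j\<le>m. (m choose j) * (((n + m) choose m) * (n choose j)))"
    by (simp add: sum_distrib_left algebra_simps)
  finally show ?thesis unfolding * by (simp add: mult.assoc)
qed

text \<open>Expand \<open>C(m + j, m)\<close> by Vandermonde and sum over \<open>j\<close> by the binomial theorem.\<close>

lemma Spoly_bernstein:
  "(\<Sum>j\<le>m. real ((m choose j) * ((m + j) choose m)) * z ^ j * (1 - z) ^ (m - j)) = Spoly m z"
proof -
  have in1: "(\<Sum>j\<le>m. real ((m choose j) * (j choose i)) * z ^ j * (1 - z) ^ (m - j)) = real (m choose i) * z ^ i"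
    if "i \<le> m" for i
  proof -
    have "(\<Sum>j\<le>m. real ((m choose j) * (j choose i)) * z ^ j * (1 - z) ^ (m - j)) =
       (\<Sum>j\<in>{i..m}. real ((m choose j) * (j choose i)) * z ^ j * (1 - z) ^ (m - j))"
      by (rule sum.mono_neutral_right) (auto simp: binomial_eq_0)
    also have "\<dots> = (\<Sum>j\<in>{i..m}. real (m choose i) * z ^ i * (real (m - i choose (j - i)) * z ^ (j - i) * (1 - z) ^ (m - i - (j - i))))"
    proof (intro sum.cong refl)
      fix j assume j: "j \<in> {i..m}"
      then have "(m choose j) * (j choose i) = (m choose i) * ((m - i) choose (j - i))"
        by (intro choose_mult) auto
      moreover have "z ^ j = z ^ i * z ^ (j - i)" using j by (simp add: power_add[symmetric])
      ultimately show "real ((m choose j) * (j choose i)) * z ^ j * (1 - z) ^ (m - j) =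
         real (m choose i) * z ^ i * (real (m - i choose (j - i)) * z ^ (j - i) * (1 - z) ^ (m - i - (j - i)))"
        using j by simp
    qed
    also have "\<dots> = real (m choose i) * z ^ i * (\<Sum>j\<in>{i..m}. real (m - i choose (j - i)) * z ^ (j - i) * (1 - z) ^ (m - i - (j - i)))"
      by (simp add: sum_distrib_left)
    also have "(\<Sum>j\<in>{i..m}. real (m - i choose (j - i)) * z ^ (j - i) * (1 - z) ^ (m - i - (j - i)))
        = (\<Sum>j\<le>m - i. real (m - i choose j) * z ^ j * (1 - z) ^ (m - i - j))"
      using that by (intro sum.reindex_bij_witness[of _ "\<lambda>j. j + i" "\<lambda>j. j - i"]) auto
    also have "\<dots> = (z + (1 - z)) ^ (m - i)" by (rule binomial_ring[symmetric])
    finally show ?thesis by simp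
  qed
  have "(\<Sum>j\<le>m. real ((m choose j) * ((m + j) choose m)) * z ^ j * (1 - z) ^ (m - j)) =
     (\<Sum>j\<le>m. \<Sum>i\<le>m. real (m choose i) * (real ((m choose j) * (j choose i)) * z ^ j * (1 - z) ^ (m - j)))"
    by (intro sum.cong refl)
      (simp add: add.commute[of m] choose_add_vandermonde sum_distrib_left sum_distrib_right mult_ac)
  also have "\<dots> = (\<Sum>i\<le>m. real (m choose i) * (real (m choose i) * z ^ i))"
    by (subst sum.swap, intro sum.cong refl) (simp only: sum_distrib_left[symmetric] in1 atMost_iff)
  also have "\<dots> = Spoly m z"
    by (simp add: Spoly_def atLeast0AtMost power2_eq_square mult_ac)
  finally show ?thesis .
qed

lemma choose_square_series:
  fixes z :: real
  assumes "0 \<le> z" "z < 1"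
  shows "(\<lambda>n. (real (n + m choose m))\<^sup>2 * z ^ n) sums (Spoly m z / (1 - z) ^ (2 * m + 1))"
proof -
  have s: "(\<lambda>n. real (n + m choose (m + j)) * z ^ n) sums (z ^ j / (1 - z) ^ Suc (m + j))" for j
  proof -
    have "(\<lambda>i. z ^ j * (real (i + (m + j) choose (m + j)) * z ^ i)) sums (z ^ j * (1 / (1 - z) ^ Suc (m + j)))"
      by (intro sums_mult binomial_series assms)
    then have "(\<lambda>i. real (i + j + m choose (m + j)) * z ^ (i + j)) sums (z ^ j / (1 - z) ^ Suc (m + j))"
      by (simp add: power_add mult_ac add_ac)
    \<comment> \<open>The first \<open>j\<close> terms are zero, so the index can be shifted without
      a correction.\<close>
    then show ?thesis by (subst (asm) sums_zero_iff_shift) (auto simp: binomial_eq_0)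
  qed
  have "(\<lambda>n. \<Sum>j\<le>m. real ((m choose j) * ((m + j) choose m)) * (real (n + m choose (m + j)) * z ^ n)) sums
     (\<Sum>j\<le>m. real ((m choose j) * ((m + j) choose m)) * (z ^ j / (1 - z) ^ Suc (m + j)))"
    by (intro sums_sum sums_mult s)
  also have "(\<lambda>n. \<Sum>j\<le>m. real ((m choose j) * ((m + j) choose m)) * (real (n + m choose (m + j)) * z ^ n)) =
     (\<lambda>n. (real (n + m choose m))\<^sup>2 * z ^ n)"
  proof
    fix n
    have "(real (n + m choose m))\<^sup>2 = real (((n + m) choose m)\<^sup>2)" by simp
    then show "(\<Sum>j\<le>m. real ((m choose j) * ((m + j) choose m)) * (real (n + m choose (m + j)) * z ^ n)) = (real (n + m choose m))\<^sup>2 * z ^ n"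
      unfolding choose_square_expand by (simp add: sum_distrib_right sum_distrib_left mult_ac)
  qed
  \<comment> \<open>The common denominator leaves a polynomial in Bernstein form in the
    numerator.\<close>
  also have "(\<Sum>j\<le>m. real ((m choose j) * ((m + j) choose m)) * (z ^ j / (1 - z) ^ Suc (m + j))) =
    (\<Sum>j\<le>m. real ((m choose j) * ((m + j) choose m)) * z ^ j * (1 - z) ^ (m - j)) / (1 - z) ^ (2 * m + 1)"
    unfolding sum_divide_distrib
  proof (intro sum.cong refl)
    fix j assume "j \<in> {..m}"
    then have "2 * m + 1 = Suc (m + j) + (m - j)" by auto
    then have "(1 - z) ^ (2 * m + 1) = (1 - z) ^ Suc (m + j) * (1 - z) ^ (m - j)" by (simp only: power_add)
    then show "real ((m choose j) * ((m + j) choose m)) * (z ^ j / (1 - z) ^ Suc (m + j)) =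
       real ((m choose j) * ((m + j) choose m)) * z ^ j * (1 - z) ^ (m - j) / (1 - z) ^ (2 * m + 1)"
      using assms by simp
  qed
  finally show ?thesis unfolding Spoly_bernstein .
qed

abbreviation nsph :: "nat \<Rightarrow> nat \<Rightarrow> real" where
  "nsph m d \<equiv> real (card (sph (Suc m) d))"

text \<open>The sphere of level \<open>d\<close> enters layer \<open>d\<close> with weight 1. The
  bound secures convergence of the series of sphere sizes before its value is known.\<close>

lemma nsph_le:
  assumes m: "0 < m"
  shows "nsph m d \<le> (real (d + m choose m))\<^sup>2"
proof -
  have "real (d + m - d choose m) * nsph m d \<le> (\<Sum>k\<le>d. real (d + m - k choose m) * nsph m k)"
    by (rule member_le_sum[of d "{..d}" "\<lambda>k. real (d + m - k choose m) * nsph m k"]) auto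
  also have "\<dots> = (real (d + m choose m))\<^sup>2" using layer_one[OF m, of d] by (simp add: layer_def)
  finally show ?thesis by simp
qed

text \<open>\<open>layer_one\<close> says that the sphere sizes convolved with
  \<open>k + m choose m\<close> give the squared binomials; on generating functions this becomes a
  division by \<open>1 / (1 - z) ^ Suc m\<close>.\<close>

lemma nsph_series:
  fixes z :: real
  assumes m: "0 < m" and z01: "0 \<le> z" "z < 1"
  shows "(\<lambda>d. nsph m d * z ^ d) sums (Spoly m z / (1 - z) ^ m)"
proof -
  have sm: "summable (\<lambda>d. nsph m d * z ^ d)"
    by (rule summable_comparison_test'[OF sums_summable[OF choose_square_series[OF z01, of m]], of 0])
      (use nsph_le[OF m] z01 in \<open>auto intro!: mult_right_mono simp: abs_mult\<close>)
  have "(\<lambda>k. \<Sum>i\<le>k. (nsph m i * z ^ i) * (real (k - i + m choose m) * z ^ (k - i))) sums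
     ((\<Sum>d. nsph m d * z ^ d) * (\<Sum>n. real (n + m choose m) * z ^ n))"
  proof (rule Cauchy_product_sums)
    show "summable (\<lambda>d. norm (nsph m d * z ^ d))" using sm z01 by (simp add: abs_mult)
    show "summable (\<lambda>k. norm (real (k + m choose m) * z ^ k))"
      using sums_summable[OF binomial_series[OF z01]] z01 by (simp add: abs_mult)
  qed
  also have "(\<Sum>n. real (n + m choose m) * z ^ n) = 1 / (1 - z) ^ Suc m"
    using binomial_series[OF z01] by (rule sums_unique[symmetric])
  also have "(\<lambda>k. \<Sum>i\<le>k. (nsph m i * z ^ i) * (real (k - i + m choose m) * z ^ (k - i)))
     = (\<lambda>n. (real (n + m choose m))\<^sup>2 * z ^ n)"
  proof
    fix n
    have "(\<Sum>i\<le>n. (nsph m i * z ^ i) * (real (n - i + m choose m) * z ^ (n - i))) =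
       (\<Sum>i\<le>n. real (n + m - i choose m) * nsph m i * z ^ n)"
      by (intro sum.cong refl) (auto simp: power_add[symmetric])
    then show "(\<Sum>i\<le>n. (nsph m i * z ^ i) * (real (n - i + m choose m) * z ^ (n - i))) = (real (n + m choose m))\<^sup>2 * z ^ n"
      unfolding layer_one[OF m, symmetric] by (simp add: layer_def sum_distrib_right)
  qed
  finally have 1: "(\<Sum>d. nsph m d * z ^ d) * (1 / (1 - z) ^ Suc m) = Spoly m z / (1 - z) ^ (2 * m + 1)"
    by (rule sums_unique2[OF _ choose_square_series[OF z01]])
  have 2: "(1 - z) ^ (2 * m + 1) = (1 - z) ^ Suc m * (1 - z) ^ m"
    by (simp add: power_add[symmetric] mult_2)
  have 3: "A = S / v" if "A * (1 / u) = S / w" "w = u * v" "u \<noteq> 0" for A S u v w :: real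
    using that by (auto simp: divide_simps split: if_splits)
  have "(\<Sum>d. nsph m d * z ^ d) = Spoly m z / (1 - z) ^ m"
    by (rule 3[OF 1 2]) (use z01 in simp)
  with summable_sums[OF sm] show ?thesis by simp
qed

section \<open>Levels on the whole lattice and the Ehrhart series\<close>

definition lat :: "nat \<Rightarrow> (nat \<Rightarrow> int) set" where
  "lat K = {x. (\<forall>k. K \<le> k \<longrightarrow> x k = 0) \<and> (\<Sum>k<K. x k) = 0}"

definition level :: "nat \<Rightarrow> (nat \<Rightarrow> int) \<Rightarrow> nat" where
  "level K x = nat ((\<Sum>k<K. \<bar>x k\<bar>) div 2)"

text \<open>From \<open>|t| = 2 * max 0 t - t\<close> and the zero sum, the L1 norm is even. So the
  integer halving in \<open>level\<close> is exact.\<close>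

lemma lat_sph: "x \<in> lat K \<Longrightarrow> x \<in> sph K (level K x)"
proof -
  assume x: "x \<in> lat K"
  define P where "P = (\<Sum>k<K. max 0 (x k))"
  have "(\<Sum>k<K. \<bar>x k\<bar>) = (\<Sum>k<K. 2 * max 0 (x k) - x k)" by (intro sum.cong) auto
  also have "\<dots> = 2 * P" using x by (simp add: sum_subtractf sum_distrib_left P_def lat_def)
  finally have s: "(\<Sum>k<K. \<bar>x k\<bar>) = 2 * P" .
  have "P \<ge> 0" unfolding P_def by (intro sum_nonneg) auto
  then show ?thesis using x s by (auto simp: sph_def lat_def level_def)
qed

lemma sph_lat: "x \<in> sph K d \<longleftrightarrow> x \<in> lat K \<and> level K x = d"
  using lat_sph[of x K] by (auto simp: sph_def lat_def level_def)

lemma LP_eq_sum: "real (LP (Suc m) d) = (\<Sum>j\<le>d. nsph m j)"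
proof -
  have "{x :: nat \<Rightarrow> int. (\<forall>k. Suc m \<le> k \<longrightarrow> x k = 0) \<and> (\<Sum>k<Suc m. x k) = 0
                  \<and> (\<Sum>k<Suc m. \<bar>x k\<bar>) \<le> 2 * int d} = (\<Union>j\<le>d. sph (Suc m) j)" (is "?L = ?R")
  proof
    show "?R \<subseteq> ?L" by (auto simp: sph_def)
    show "?L \<subseteq> ?R"
    proof
      fix x assume x: "x \<in> ?L"
      then have s: "x \<in> sph (Suc m) (level (Suc m) x)" by (intro lat_sph) (auto simp: lat_def)
      then have "level (Suc m) x \<le> d" using x by (auto simp: sph_def)
      with s show "x \<in> ?R" by auto
    qed
  qed
  moreover have "card (\<Union>j\<le>d. sph (Suc m) j) = (\<Sum>j\<le>d. card (sph (Suc m) j))"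
    by (rule card_UN_disjoint) (auto simp: finite_sph, auto simp: sph_def)
  ultimately show ?thesis unfolding LP_def by simp
qed

text \<open>Balls are partial sums of spheres, which costs one more factor
  \<open>1 / (1 - z)\<close>. The separate summand 1 in \<open>Ehr\<close> is the term of the
  origin.\<close>

lemma Ehr_eq:
  fixes z :: real
  assumes m: "0 < m" and z01: "0 \<le> z" "z < 1"
  shows "Ehr (Suc m) z = Spoly m z / (1 - z) ^ Suc m"
proof -
  have "(\<lambda>k. \<Sum>i\<le>k. (nsph m i * z ^ i) * z ^ (k - i)) sums ((\<Sum>d. nsph m d * z ^ d) * (\<Sum>n. z ^ n))"
  proof (rule Cauchy_product_sums)
    show "summable (\<lambda>d. norm (nsph m d * z ^ d))" using sums_summable[OF nsph_series[OF m z01]] z01 by (simp add: abs_mult)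
    show "summable (\<lambda>k. norm (z ^ k))" using z01 by (simp add: summable_geometric)
  qed
  also have "(\<Sum>d. nsph m d * z ^ d) = Spoly m z / (1 - z) ^ m" using nsph_series[OF m z01] by (rule sums_unique[symmetric])
  also have "(\<Sum>n. z ^ n) = 1 / (1 - z)" using z01 by (intro suminf_geometric) auto
  also have "(\<lambda>k. \<Sum>i\<le>k. (nsph m i * z ^ i) * z ^ (k - i)) = (\<lambda>d. real (LP (Suc m) d) * z ^ d)"
  proof
    fix d
    have "(\<Sum>i\<le>d. (nsph m i * z ^ i) * z ^ (d - i)) = (\<Sum>i\<le>d. nsph m i * z ^ d)"
      by (intro sum.cong) (auto simp: power_add[symmetric])
    then show "(\<Sum>i\<le>d. (nsph m i * z ^ i) * z ^ (d - i)) = real (LP (Suc m) d) * z ^ d"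
      by (simp add: LP_eq_sum sum_distrib_right)
  qed
  finally have "(\<lambda>d. real (LP (Suc m) d) * z ^ d) sums (Spoly m z / (1 - z) ^ Suc m)"
    by (simp add: mult.commute)
  then have "(\<lambda>d. real (LP (Suc m) (Suc d)) * z ^ Suc d) sums (Spoly m z / (1 - z) ^ Suc m - real (LP (Suc m) 0) * z ^ 0)"
    by (subst sums_Suc_iff)  simp
  moreover have "real (LP (Suc m) 0) = 1" by (simp add: LP_eq_sum sph_0)
  ultimately show ?thesis unfolding Ehr_def by (simp add: sums_unique[symmetric])
qed

text \<open>Turns a closed form into a first moment. The closed form is known on [0, 1) only, so its
  derivative is identified with the termwise one inside the open unit interval.\<close>

lemma series_derivative:
  fixes c :: "nat \<Rightarrow> real"
  assumes s: "\<And>z. 0 \<le> z \<Longrightarrow> z < 1 \<Longrightarrow> (\<lambda>n. c n * z ^ n) sums F z"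
    and t: "0 < t" "t < 1" and D: "(F has_real_derivative F') (at t)"
  shows "(\<lambda>n. real n * c n * t ^ n) sums (t * F')"
proof -
  obtain k where k: "t < k" "k < 1" using t(2) dense by blast
  have sk: "summable (\<lambda>n. c n * k ^ n)" using s[of k] t k by (auto simp: sums_iff)
  have "((\<lambda>z. \<Sum>n. c n * z ^ n) has_real_derivative (\<Sum>n. diffs c n * t ^ n)) (at t)"
    by (rule termdiffs_strong[OF sk]) (use t k in auto)
  then have "(F has_real_derivative (\<Sum>n. diffs c n * t ^ n)) (at t)"
  proof (rule has_field_derivative_transform_within_open[of _ _ _ "{0<..<1}"])
    fix z :: real assume "z \<in> {0<..<1}"
    then show "(\<Sum>n. c n * z ^ n) = F z" using s[of z] by (simp add: sums_unique[symmetric])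
  qed (use t in auto)
  then have F': "F' = (\<Sum>n. diffs c n * t ^ n)" using D DERIV_unique by blast
  have "summable (\<lambda>n. diffs c n * t ^ n)"
    using t k powser_inside[OF sk] by (intro termdiff_converges[of t k]) auto
  then have "(\<lambda>n. t * (diffs c n * t ^ n)) sums (t * F')" unfolding F' by (intro sums_mult summable_sums)
  then have "(\<lambda>n. real (Suc n) * c (Suc n) * t ^ Suc n) sums (t * F')"
    by (simp add: diffs_def mult_ac)
  then show ?thesis by (subst (asm) sums_Suc_iff) simp
qed

section \<open>Counting lattice points\<close>

definition compositions :: "nat set \<Rightarrow> nat \<Rightarrow> (nat \<Rightarrow> int) set" where
  "compositions R d = {u. (\<forall>k. k \<notin> R \<longrightarrow> u k = 0) \<and> (\<forall>k\<in>R. 0 \<le> u k) \<and> (\<Sum>k\<in>R. u k) = int d}"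

lemma finite_compositions:
  assumes "finite R"
  shows "finite (compositions R d)"
proof -
  have "finite {x :: nat \<Rightarrow> int. \<forall>k. (k \<in> R \<longrightarrow> x k \<in> {0..int d}) \<and> (k \<notin> R \<longrightarrow> x k = 0)}"
    by (rule finite_set_of_finite_funs) (use assms in auto)
  then show ?thesis
  proof (rule rev_finite_subset, safe)
    fix x k assume x: "x \<in> compositions R d"
    then show "k \<notin> R \<Longrightarrow> x k = 0" by (auto simp: compositions_def)
    assume k: "k \<in> R"
    have "x k \<le> sum x R" by (rule member_le_sum) (use k x assms in \<open>auto simp: compositions_def\<close>)
    then show "x k \<in> {0..int d}" using x k by (auto simp: compositions_def)
  qed
qed

lemma card_compositions:
  assumes "finite R" "R \<noteq> {}"
  shows "card (compositions R d) = (d + card R - 1) choose (card R - 1)"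
  using assms
proof (induction R arbitrary: d rule: finite_ne_induct)
  case (singleton a)
  have "compositions {a} d = {(\<lambda>_. 0)(a := int d)}"
    by (auto simp: compositions_def fun_eq_iff)
  then show ?case by simp
next
  case (insert a R)
  have eq: "compositions (insert a R) d = (\<Union>j\<le>d. (\<lambda>u. u(a := int j)) ` compositions R (d - j))"
  proof (intro equalityI subsetI)
    fix u assume u: "u \<in> compositions (insert a R) d"
    then have s: "u a + sum u R = int d" "0 \<le> u a" "0 \<le> sum u R"
      using insert by (auto simp: compositions_def intro: sum_nonneg)
    define j where "j = nat (u a)"
    have "(\<Sum>k\<in>R. (u(a := 0)) k) = sum u R" using insert by (intro sum.cong) auto
    then have "u(a := 0) \<in> compositions R (d - j)" using u s insert by (auto simp: compositions_def j_def)
    moreover have "u = (u(a := 0))(a := int j)" using s by (auto simp: j_def)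
    ultimately have "u \<in> (\<lambda>u. u(a := int j)) ` compositions R (d - j)" by (metis (no_types, lifting) imageI)
    moreover have "j \<le> d" using s by (auto simp: j_def)
    ultimately show "u \<in> (\<Union>j\<le>d. (\<lambda>u. u(a := int j)) ` compositions R (d - j))" by blast
  next
    fix w assume "w \<in> (\<Union>j\<le>d. (\<lambda>u. u(a := int j)) ` compositions R (d - j))"
    then obtain j u where ju: "j \<le> d" "u \<in> compositions R (d - j)" "w = u(a := int j)" by auto
    have "(\<Sum>k\<in>R. w k) = sum u R" using insert ju by (intro sum.cong) auto
    then show "w \<in> compositions (insert a R) d" using ju insert by (auto simp: compositions_def)
  qed
  have inj: "inj_on (\<lambda>u. u(a := int j)) (compositions R (d - j))" for j
  proof (rule inj_onI)
    fix u v assume "u \<in> compositions R (d - j)" "v \<in> compositions R (d - j)" "u(a := int j) = v(a := int j)"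
    then show "u = v" using insert by (auto simp: compositions_def fun_eq_iff) metis
  qed
  have "card (compositions (insert a R) d) = (\<Sum>j\<le>d. card ((\<lambda>u. u(a := int j)) ` compositions R (d - j)))"
    unfolding eq
  proof (rule card_UN_disjoint)
    show "\<forall>i\<in>{..d}. \<forall>j\<in>{..d}. i \<noteq> j \<longrightarrow> (\<lambda>u. u(a := int i)) ` compositions R (d - i) \<inter> (\<lambda>u. u(a := int j)) ` compositions R (d - j) = {}"
      by (auto dest: fun_cong[of _ _ a])
  qed (use insert finite_compositions in auto)
  also have "\<dots> = (\<Sum>j\<le>d. (d - j + card R - 1) choose (card R - 1))"
    by (simp add: card_image inj insert)
  also have "\<dots> = (\<Sum>i\<le>d. (i + card R - 1) choose (card R - 1))"
    by (rule sum.reindex_bij_witness[of _ "\<lambda>i. d - i" "\<lambda>i. d - i"]) auto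
  also have "\<dots> = (\<Sum>i\<le>d. ((card R - 1) + i) choose (card R - 1))"
    using insert by (intro sum.cong refl) (metis One_nat_def Suc_leI add.commute add_diff_assoc card_gt_0_iff)
  also have "\<dots> = (d + card R) choose card R"
    using choose_rising_sum(1)[of "card R - 1" d] insert
    by (metis (no_types, lifting) One_nat_def Suc_eq_plus1 Suc_pred add.commute add_Suc_right card_gt_0_iff)
  finally show ?case using insert by simp
qed

text \<open>Strict here, weak in \<open>compositions\<close>: zeros are counted with the positive
  coordinates, so every lattice vector belongs to exactly one set \<open>R\<close> of nonnegative
  coordinates. This is the source of the two different binomials in the count.\<close>

definition neg_compositions :: "nat set \<Rightarrow> nat \<Rightarrow> (nat \<Rightarrow> int) set" where
  "neg_compositions R d = {v. (\<forall>k. k \<notin> R \<longrightarrow> v k = 0) \<and> (\<forall>k\<in>R. v k < 0) \<and> (\<Sum>k\<in>R. v k) = - int d}"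

lemma card_neg_compositions:
  assumes "finite R" "R \<noteq> {}"
  shows "card (neg_compositions R (Suc d)) = d choose (card R - 1)"
proof (cases "card R \<le> Suc d")
  case True
  \<comment> \<open>Lowering each absolute value by one makes the inequalities weak and takes
    \<open>card R\<close> off the total. Negation and shift combine to a map given by the same
    formula as its inverse.\<close>
  have "bij_betw (\<lambda>v k. if k \<in> R then - v k - 1 else 0) (neg_compositions R (Suc d)) (compositions R (Suc d - card R))"
    by (rule bij_betwI[where g = "\<lambda>v k. if k \<in> R then - v k - 1 else 0"])
      (use True in \<open>auto simp: neg_compositions_def compositions_def sum_subtractf sum_negf fun_eq_iff int_Suc\<close>)
  then have "card (neg_compositions R (Suc d)) = card (compositions R (Suc d - card R))" by (rule bij_betw_same_card)
  also have "\<dots> = (Suc d - card R + card R - 1) choose (card R - 1)" by (rule card_compositions[OF assms])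
  finally show ?thesis using True by simp
next
  case False
  have "neg_compositions R (Suc d) = {}"
  proof (rule ccontr)
    assume "neg_compositions R (Suc d) \<noteq> {}"
    then obtain v where v: "v \<in> neg_compositions R (Suc d)" by blast
    then have "(\<Sum>k\<in>R. v k) \<le> (\<Sum>k\<in>R. -1)" by (intro sum_mono) (auto simp: neg_compositions_def)
    then show False using v False by (auto simp: neg_compositions_def)
  qed
  then show ?thesis using False by simp
qed

lemma card_sph_cell:
  assumes "R \<subseteq> {..<K}"
  shows "card {x \<in> sph K (Suc d). {k\<in>{..<K}. 0 \<le> x k} = R} = card (compositions R (Suc d)) * card (neg_compositions ({..<K} - R) (Suc d))"
proof -
  let ?Q = "{..<K} - R"
  have fin: "finite R" using assms finite_subset by blast
  have split: "sum f {..<K} = sum f R + sum f ?Q" for f :: "nat \<Rightarrow> int"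
    using assms by (simp add: sum.subset_diff[of R "{..<K}"] add.commute)
  have "bij_betw (\<lambda>(u, v) k. u k + v k) (compositions R (Suc d) \<times> neg_compositions ?Q (Suc d)) {x \<in> sph K (Suc d). {k\<in>{..<K}. 0 \<le> x k} = R}"
  proof (rule bij_betwI[where g = "\<lambda>x. (\<lambda>k. if k \<in> R then x k else 0, \<lambda>k. if k \<in> ?Q then x k else 0)"])
    show "(\<lambda>(u, v) k. u k + v k) \<in> compositions R (Suc d) \<times> neg_compositions ?Q (Suc d) \<rightarrow> {x \<in> sph K (Suc d). {k\<in>{..<K}. 0 \<le> x k} = R}"
    proof (rule funcsetI)
      fix uv assume "uv \<in> compositions R (Suc d) \<times> neg_compositions ?Q (Suc d)"
      then obtain u v where uv: "uv = (u, v)" and u: "u \<in> compositions R (Suc d)" and v: "v \<in> neg_compositions ?Q (Suc d)" by auto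
      have uR: "k \<notin> R \<Longrightarrow> u k = 0" "k \<in> R \<Longrightarrow> u k \<ge> 0" for k using u by (auto simp: compositions_def)
      have vR: "k \<notin> ?Q \<Longrightarrow> v k = 0" "k \<in> ?Q \<Longrightarrow> v k < 0" for k using v by (auto simp: neg_compositions_def)
      have 1: "(\<Sum>k\<in>R. F (u k + v k)) = (\<Sum>k\<in>R. F (u k))" "(\<Sum>k\<in>?Q. F (u k + v k)) = (\<Sum>k\<in>?Q. F (v k))" for F :: "int \<Rightarrow> int"
        using uR vR by (auto intro!: sum.cong)
      have 2: "(\<Sum>k\<in>R. \<bar>u k\<bar>) = (\<Sum>k\<in>R. u k)" "(\<Sum>k\<in>?Q. \<bar>v k\<bar>) = (\<Sum>k\<in>?Q. - v k)"
        using uR vR by (auto intro!: sum.cong simp: abs_of_neg)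
      have 3: "(\<Sum>k\<in>R. u k) = int (Suc d)" "(\<Sum>k\<in>?Q. v k) = - int (Suc d)" using u v by (auto simp: compositions_def neg_compositions_def)
      have 4: "u k + v k = 0" if "k \<ge> K" for k
      proof -
        have "k \<notin> R" "k \<notin> ?Q" using that assms by auto
        then show ?thesis using uR(1) vR(1) by simp
      qed
      have 5: "(\<lambda>k. u k + v k) \<in> sph K (Suc d)"
        unfolding sph_def using 4 by (simp add: split 1(1)[of "\<lambda>t. t"] 1(2)[of "\<lambda>t. t"] 1(1)[of abs] 1(2)[of abs] 2 3 sum_negf)
      have 6: "0 \<le> u k + v k \<longleftrightarrow> k \<in> R" if "k < K" for k
        using that uR[of k] vR[of k] by (cases "k \<in> R") auto
      have "{k\<in>{..<K}. 0 \<le> u k + v k} = R" using 6 assms by auto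
      with 5 show "(\<lambda>(u, v) k. u k + v k) uv \<in> {x \<in> sph K (Suc d). {k\<in>{..<K}. 0 \<le> x k} = R}" by (simp add: uv)
    qed
    show "(\<lambda>x. (\<lambda>k. if k \<in> R then x k else 0, \<lambda>k. if k \<in> ?Q then x k else 0)) \<in>
        {x \<in> sph K (Suc d). {k\<in>{..<K}. 0 \<le> x k} = R} \<rightarrow> compositions R (Suc d) \<times> neg_compositions ?Q (Suc d)"
    proof (rule funcsetI)
      fix x assume "x \<in> {x \<in> sph K (Suc d). {k\<in>{..<K}. 0 \<le> x k} = R}"
      then have x: "x \<in> sph K (Suc d)" and R: "R = {k\<in>{..<K}. 0 \<le> x k}" by auto
      have "sum x R + sum x ?Q = 0" "(\<Sum>k\<in>R. \<bar>x k\<bar>) + (\<Sum>k\<in>?Q. \<bar>x k\<bar>) = 2 * int (Suc d)"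
        using x unfolding sph_def split by auto
      moreover have "(\<Sum>k\<in>R. \<bar>x k\<bar>) = sum x R" "(\<Sum>k\<in>?Q. \<bar>x k\<bar>) = - sum x ?Q"
        unfolding sum_negf[symmetric] using R by (auto intro!: sum.cong)
      ultimately have s: "sum x R = int (Suc d)" "sum x ?Q = - int (Suc d)" by auto
      have "(\<lambda>k. if k \<in> R then x k else 0) \<in> compositions R (Suc d)"
        using s(1) R by (auto simp: compositions_def)
      moreover have "(\<lambda>k. if k \<in> ?Q then x k else 0) \<in> neg_compositions ?Q (Suc d)"
      proof -
        have "(\<Sum>k\<in>?Q. if k \<in> ?Q then x k else 0) = sum x ?Q" by (intro sum.cong) auto
        then show ?thesis using s(2) R by (auto simp: neg_compositions_def)
      qed
      ultimately show "((\<lambda>k. if k \<in> R then x k else 0, \<lambda>k. if k \<in> ?Q then x k else 0)) \<in> compositions R (Suc d) \<times> neg_compositions ?Q (Suc d)" by simp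
    qed
  next
    fix uv assume "uv \<in> compositions R (Suc d) \<times> neg_compositions ?Q (Suc d)"
    then show "(\<lambda>k. if k \<in> R then (case uv of (u, v) \<Rightarrow> \<lambda>k. u k + v k) k else 0,
        \<lambda>k. if k \<in> ?Q then (case uv of (u, v) \<Rightarrow> \<lambda>k. u k + v k) k else 0) = uv"
      by (cases uv) (auto simp: compositions_def neg_compositions_def fun_eq_iff)
  next
    fix x assume "x \<in> {x \<in> sph K (Suc d). {k\<in>{..<K}. 0 \<le> x k} = R}"
    then show "(case (\<lambda>k. if k \<in> R then x k else 0, \<lambda>k. if k \<in> ?Q then x k else 0) of (u, v) \<Rightarrow> \<lambda>k. u k + v k) = x"
      by (auto simp: sph_def fun_eq_iff)
  qed
  then have "card {x \<in> sph K (Suc d). {k\<in>{..<K}. 0 \<le> x k} = R} = card (compositions R (Suc d) \<times> neg_compositions ?Q (Suc d))"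
    by (rule bij_betw_same_card[symmetric])
  then show ?thesis by (simp add: card_cartesian_product)
qed

lemma card_sph:
  "card (sph K (Suc d)) = (\<Sum>r=1..K-1. (K choose r) * ((Suc d + r - 1) choose (r - 1)) * (d choose (K - r - 1)))"
proof -
  define g where "g r = ((Suc d + r - 1) choose (r - 1)) * (d choose (K - r - 1))" for r
  have "card (sph K (Suc d)) = (\<Sum>x\<in>sph K (Suc d). 1)" by simp
  also have "\<dots> = (\<Sum>R\<in>Pow {..<K}. \<Sum>x | x \<in> sph K (Suc d) \<and> {k\<in>{..<K}. 0 \<le> x k} = R. 1)"
    by (rule sum.group[symmetric]) (auto simp: finite_sph)
  also have "\<dots> = (\<Sum>R\<in>Pow {..<K}. card (compositions R (Suc d)) * card (neg_compositions ({..<K} - R) (Suc d)))"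
    by (intro sum.cong refl) (subst card_sph_cell[symmetric], auto)
  \<comment> \<open>An empty set of coordinates cannot carry the nonzero total \<open>Suc d\<close>,
    so these two index sets contribute nothing.\<close>
  also have "\<dots> = (\<Sum>R\<in>Pow {..<K} - {{}, {..<K}}. card (compositions R (Suc d)) * card (neg_compositions ({..<K} - R) (Suc d)))"
    by (rule sum.mono_neutral_right) (auto simp: compositions_def neg_compositions_def)
  also have "\<dots> = (\<Sum>R\<in>Pow {..<K} - {{}, {..<K}}. g (card R))"
  proof (intro sum.cong refl)
    fix R assume R: "R \<in> Pow {..<K} - {{}, {..<K}}"
    then have f: "finite R" using finite_subset by auto
    have "card (compositions R (Suc d)) = (Suc d + card R - 1) choose (card R - 1)"
      by (rule card_compositions) (use R f in auto)
    moreover have "card (neg_compositions ({..<K} - R) (Suc d)) = d choose (card ({..<K} - R) - 1)"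
      by (rule card_neg_compositions) (use R in auto)
    moreover have "card ({..<K} - R) = K - card R" using R f by (simp add: card_Diff_subset)
    ultimately show "card (compositions R (Suc d)) * card (neg_compositions ({..<K} - R) (Suc d)) = g (card R)"
      by (simp add: g_def)
  qed
  also have "\<dots> = (\<Sum>r\<in>{1..K-1}. \<Sum>R | R \<in> Pow {..<K} - {{}, {..<K}} \<and> card R = r. g (card R))"
  proof (rule sum.group[symmetric])
    show "card ` (Pow {..<K} - {{}, {..<K}}) \<subseteq> {1..K - 1}"
    proof
      fix r assume "r \<in> card ` (Pow {..<K} - {{}, {..<K}})"
      then obtain R where R: "R \<subset> {..<K}" "R \<noteq> {}" "r = card R" by auto
      then have "card R < card {..<K}" by (intro psubset_card_mono) auto
      moreover have "card R > 0" using R by (metis card_gt_0_iff finite_lessThan finite_subset psubset_imp_subset)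
      ultimately show "r \<in> {1..K - 1}" using R by auto
    qed
  qed auto
  also have "\<dots> = (\<Sum>r\<in>{1..K-1}. (K choose r) * g r)"
  proof (intro sum.cong refl)
    fix r assume r: "r \<in> {1..K-1}"
    then have "{R. R \<in> Pow {..<K} - {{}, {..<K}} \<and> card R = r} = {R. R \<subseteq> {..<K} \<and> card R = r}" by auto
    then have "card {R. R \<in> Pow {..<K} - {{}, {..<K}} \<and> card R = r} = K choose r"
      using n_subsets[of "{..<K}" r] by simp
    then show "(\<Sum>R | R \<in> Pow {..<K} - {{}, {..<K}} \<and> card R = r. g (card R)) = (K choose r) * g r" by simp
  qed
  finally show ?thesis by (simp add: g_def mult.assoc)
qed

lemma Ehr_binomial_series:
  assumes m: "0 < m" and \<theta>: "0 < \<theta>" "\<theta> < 1"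
  shows "Ehr (Suc m) \<theta> = 1 / (1 - \<theta>) + (\<Sum>d. (\<Sum>r=1..Suc m-1. real (Suc m choose r) * real (Suc d + r - 1 choose (r - 1))
          * real (Suc d - 1 choose (Suc m - r - 1))) * \<theta> ^ Suc d / (1 - \<theta>))"
proof -
  have c: "(\<Sum>r=1..Suc m-1. real (Suc m choose r) * real (Suc d + r - 1 choose (r - 1))
          * real (Suc d - 1 choose (Suc m - r - 1))) = nsph m (Suc d)" for d
    unfolding card_sph by simp
  have "(\<lambda>d. nsph m d * \<theta> ^ d) sums (Spoly m \<theta> / (1 - \<theta>) ^ m)"
    using \<theta> by (intro nsph_series[OF m]) auto
  then have "(\<lambda>d. nsph m (Suc d) * \<theta> ^ Suc d) sums (Spoly m \<theta> / (1 - \<theta>) ^ m - 1)"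
    by (subst sums_Suc_iff) (simp add: sph_0)
  then have "(\<lambda>d. nsph m (Suc d) * \<theta> ^ Suc d / (1 - \<theta>)) sums ((Spoly m \<theta> / (1 - \<theta>) ^ m - 1) / (1 - \<theta>))"
    by (rule sums_divide)
  then have "(\<Sum>d. nsph m (Suc d) * \<theta> ^ Suc d / (1 - \<theta>)) = (Spoly m \<theta> / (1 - \<theta>) ^ m - 1) / (1 - \<theta>)"
    by (rule sums_unique[symmetric])
  then show ?thesis unfolding c using Ehr_eq[OF m, of \<theta>] \<theta> by (simp add: diff_divide_distrib)
qed

section \<open>Positive correlation with the level\<close>

text \<open>Deviations from the weighted mean \<nu> sum to zero, so \<open>h n\<close> may be
  replaced by \<open>h n - h N\<close> with \<open>N\<close> the integer part of \<nu>. Then both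
  factors of each term change sign at the same place.\<close>

lemma chebyshev_weighted:
  fixes c h :: "nat \<Rightarrow> real"
  assumes c: "\<And>n. n \<le> R \<Longrightarrow> 0 < c n" and h: "\<And>i j. i \<le> j \<Longrightarrow> j \<le> R \<Longrightarrow> h i \<le> h j"
    and \<nu>_def: "\<nu> = (\<Sum>n\<le>R. real n * c n) / (\<Sum>n\<le>R. c n)"
  shows "0 \<le> \<nu>" "\<nu> \<le> real R" "0 \<le> (\<Sum>n\<le>R. c n * h n * (real n - \<nu>))"
proof -
  have C: "0 < (\<Sum>n\<le>R. c n)" by (rule sum_pos) (use c in auto)
  show "0 \<le> \<nu>" unfolding \<nu>_def using c by (intro divide_nonneg_nonneg sum_nonneg mult_nonneg_nonneg) (auto simp: less_imp_le)
  have "(\<Sum>n\<le>R. real n * c n) \<le> (\<Sum>n\<le>R. real R * c n)"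
    by (intro sum_mono mult_right_mono) (use c in \<open>auto simp: less_imp_le\<close>)
  then show "\<nu> \<le> real R" unfolding \<nu>_def using C by (simp add: divide_le_eq sum_distrib_left)
  define N where "N = nat \<lfloor>\<nu>\<rfloor>"
  have N: "N \<le> R" "real N \<le> \<nu>" "\<nu> < real N + 1"
    using \<open>\<nu> \<le> real R\<close> \<open>0 \<le> \<nu>\<close> unfolding N_def by linarith+
  have "0 \<le> (\<Sum>n\<le>R. c n * ((h n - h N) * (real n - \<nu>)))"
  proof (rule sum_nonneg, rule mult_nonneg_nonneg)
    fix n assume n: "n \<in> {..R}"
    then show "0 \<le> c n" using c[of n] by simp
    show "0 \<le> (h n - h N) * (real n - \<nu>)"
    proof (cases "n \<le> N")
      case True
      then have "h n \<le> h N" "real n \<le> \<nu>" using h[of n N] N by auto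
      then show ?thesis by (simp add: mult_nonpos_nonpos)
    next
      case False
      then have "h N \<le> h n" "real n \<ge> \<nu>" using h[of N n] N n by auto
      then show ?thesis by simp
    qed
  qed
  also have "\<dots> = (\<Sum>n\<le>R. c n * h n * (real n - \<nu>)) - h N * ((\<Sum>n\<le>R. real n * c n) - \<nu> * (\<Sum>n\<le>R. c n))"
    by (simp add: sum_subtractf[symmetric] sum_distrib_left algebra_simps)
  also have "(\<Sum>n\<le>R. real n * c n) - \<nu> * (\<Sum>n\<le>R. c n) = 0" unfolding \<nu>_def using C by simp
  finally show "0 \<le> (\<Sum>n\<le>R. c n * h n * (real n - \<nu>))" by simp
qed

lemma sum_triangle_swap:
  fixes F :: "nat \<Rightarrow> nat \<Rightarrow> real"
  shows "(\<Sum>n\<le>R. \<Sum>d\<le>n. F n d) = (\<Sum>d\<le>R. \<Sum>k\<le>R - d. F (d + k) d)"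
proof -
  have "(\<Sum>n\<le>R. \<Sum>d\<le>n. F n d) = (\<Sum>(n, d)\<in>(SIGMA n:{..R}. {..n}). F n d)"
    by (simp add: sum.Sigma)
  also have "\<dots> = (\<Sum>(d, k)\<in>(SIGMA d:{..R}. {..R - d}). F (d + k) d)"
    by (rule sum.reindex_bij_witness[of _ "\<lambda>(d, k). (d + k, d)" "\<lambda>(n, d). (d, n - d)"]) auto
  finally show ?thesis by (simp add: sum.Sigma)
qed

lemma quotient_power_deriv:
  fixes F :: "real \<Rightarrow> real"
  assumes F: "(F has_real_derivative F') (at t)" and "t < 1"
  shows "((\<lambda>z. F z / (1 - z) ^ n) has_real_derivative (F' / (1 - t) ^ n + real n * F t / (1 - t) ^ Suc n)) (at t)"
proof -
  have ne: "1 - t \<noteq> 0" using assms by simp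
  have "((\<lambda>z. F z / (1 - z) ^ n) has_real_derivative
     (F' * (1 - t) ^ n - F t * (real n * (1 - t) ^ (n - 1) * (-1))) / ((1 - t) ^ n * (1 - t) ^ n)) (at t)"
    using ne by (auto intro!: derivative_eq_intros F)
  also have "(F' * (1 - t) ^ n - F t * (real n * (1 - t) ^ (n - 1) * (-1))) / ((1 - t) ^ n * (1 - t) ^ n)
     = F' / (1 - t) ^ n + real n * F t / (1 - t) ^ Suc n"
  proof (cases n)
    case (Suc k)
    have "(D * (c * v) - S * (r * v * (-1))) / (c * v * (c * v)) = D / (c * v) + r * S / (c * (c * v))"
      if "c \<noteq> 0" "v \<noteq> 0" for D S c v r :: real using that by (simp add: field_simps)
    from this[OF ne, of "(1 - t) ^ k"] ne show ?thesis unfolding Suc power_Suc diff_Suc_1 by simp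
  qed simp
  finally show ?thesis .
qed

text \<open>The mean size \<open>n\<close> of a weighted pair of compositions, cut off at
  \<open>R\<close>. In the limit it exceeds the mean level by
  \<open>Suc m * \<theta> / (1 - \<theta>)\<close>, the mean size of the common minimum.\<close>

definition meanlevel :: "nat \<Rightarrow> real \<Rightarrow> nat \<Rightarrow> real" where
  "meanlevel m \<theta> R = (\<Sum>n\<le>R. real n * ((real (n + m choose m))\<^sup>2 * \<theta> ^ n)) / (\<Sum>n\<le>R. (real (n + m choose m))\<^sup>2 * \<theta> ^ n)"

text \<open>Dividing \<phi> by \<theta> to the level turns the hypothesis on edges into
  monotonicity, so the averages over pairs increase with \<open>n\<close> and correlate
  nonnegatively with it. Writing \<open>n = d + k\<close> and summing the negative binomial weights
  over \<open>k\<close> replaces \<open>n\<close> by \<open>d\<close> plus their mean. Only levels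
  up to \<open>R\<close> are involved, which suits a function known on a ball.\<close>

lemma ball_inequality:
  assumes m: "0 < m" and \<theta>: "0 < \<theta>" "\<theta> < 1"
    and pos: "\<And>d x. d \<le> R \<Longrightarrow> x \<in> sph (Suc m) d \<Longrightarrow> 0 \<le> \<phi> x"
    and lip: "\<And>d x i j. d < R \<Longrightarrow> x \<in> sph (Suc m) d \<Longrightarrow> (i, j) \<in> upedge (Suc m) x \<Longrightarrow> \<theta> * \<phi> x \<le> \<phi> (shift x i j)"
  shows "0 \<le> (\<Sum>d\<le>R. (real d + real (Suc m) * \<theta> / (1 - \<theta>) - meanlevel m \<theta> R) * (\<Sum>x\<in>sph (Suc m) d. \<phi> x))"
proof -
  define \<nu> where "\<nu> = meanlevel m \<theta> R"
  define \<Phi> where "\<Phi> d = (\<Sum>x\<in>sph (Suc m) d. \<phi> x)" for d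
  define \<psi> where "\<psi> x = \<phi> x / \<theta> ^ nat ((\<Sum>k<Suc m. \<bar>x k\<bar>) div 2)" for x
  have \<psi>: "\<psi> x = \<phi> x / \<theta> ^ d" if "x \<in> sph (Suc m) d" for x d
    using that by (auto simp: \<psi>_def sph_def)
  define C where "C n = real (n + m choose m)" for n
  have C: "C n > 0" for n by (simp add: C_def)
  define h where "h n = layer m \<psi> n / (C n)\<^sup>2" for n
  have step: "h n \<le> h (Suc n)" if "n < R" for n
  proof -
    have "(real (Suc n + m))\<^sup>2 * layer m \<psi> n \<le> (real (Suc n))\<^sup>2 * layer m \<psi> (Suc n)"
    proof (rule layer_mono[OF m])
      fix d x i j assume d: "d \<le> n" and x: "x \<in> sph (Suc m) d" and ij: "(i, j) \<in> upedge (Suc m) x"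
      have "(shift x i j, i, j) \<in> (SIGMA y:sph (Suc m) (Suc d). posc (Suc m) y \<times> negc (Suc m) y)"
        using bij_betwE[OF up_edge_bij[of "Suc m" d]] x ij by fastforce
      then have "shift x i j \<in> sph (Suc m) (Suc d)" by auto
      then have "\<psi> (shift x i j) = \<phi> (shift x i j) / \<theta> ^ Suc d" by (rule \<psi>)
      moreover have "\<psi> x = \<theta> * \<phi> x / \<theta> ^ Suc d" using \<psi>[OF x] \<theta> by simp
      moreover have "\<theta> * \<phi> x \<le> \<phi> (shift x i j)" using lip[OF _ x ij] d that by simp
      ultimately show "\<psi> x \<le> \<psi> (shift x i j)"
        using \<theta> by (simp only:) (intro divide_right_mono, auto)
    qed
    moreover have "real (Suc n) * C (Suc n) = real (Suc n + m) * C n" unfolding C_def by (rule binomial_step)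
    then have "(real (Suc n + m))\<^sup>2 = (real (Suc n))\<^sup>2 * (C (Suc n))\<^sup>2 / (C n)\<^sup>2"
      using C[of n] by (metis nonzero_mult_div_cancel_right order_less_irrefl power_mult_distrib power_not_zero)
    ultimately have "(real (Suc n))\<^sup>2 * ((C (Suc n))\<^sup>2 / (C n)\<^sup>2 * layer m \<psi> n) \<le> (real (Suc n))\<^sup>2 * layer m \<psi> (Suc n)"
      by (simp add: mult.assoc del: of_nat_Suc)
    then have "(C (Suc n))\<^sup>2 / (C n)\<^sup>2 * layer m \<psi> n \<le> layer m \<psi> (Suc n)"
      by (subst (asm) mult_le_cancel_left_pos) auto
    then show ?thesis using C[of n] C[of "Suc n"] by (simp add: h_def field_simps)
  qed
  have mono: "h i \<le> h j" if "i \<le> j" "j \<le> R" for i j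
    using that by (induction j rule: dec_induct) (auto intro: order_trans[OF _ step])
  define c where "c n = (C n)\<^sup>2 * \<theta> ^ n" for n
  have cpos: "0 < c n" for n using C[of n] \<theta> by (simp add: c_def)
  have \<nu>c: "\<nu> = (\<Sum>n\<le>R. real n * c n) / (\<Sum>n\<le>R. c n)"
    by (simp add: \<nu>_def meanlevel_def c_def C_def)
  note cheb = chebyshev_weighted[of R c h, OF cpos mono \<nu>c]
  have A: "(\<lambda>k. C k * \<theta> ^ k) sums (1 / (1 - \<theta>) ^ Suc m)"
    unfolding C_def by (rule binomial_series) (use \<theta> in auto)
  have A': "(\<lambda>k. real k * C k * \<theta> ^ k) sums (\<theta> * (real (Suc m) / (1 - \<theta>) ^ (Suc (Suc m))))"
  proof (rule series_derivative)
    show "(\<lambda>n. C n * z ^ n) sums (1 / (1 - z) ^ Suc m)" if "0 \<le> z" "z < 1" for z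
      unfolding C_def using that by (rule binomial_series)
    show "((\<lambda>z. 1 / (1 - z) ^ Suc m) has_real_derivative real (Suc m) / (1 - \<theta>) ^ (Suc (Suc m))) (at \<theta>)"
      using quotient_power_deriv[OF DERIV_const \<theta>(2), of 1 "Suc m"] by simp
  qed (use \<theta> in auto)
  \<comment> \<open>Extending the sum over \<open>k\<close> to infinity can only increase it: the
    added terms have \<open>d + k > R\<close>, and \<open>R\<close> is at least the truncated mean
    \<nu>. The sphere sums of \<phi> are nonnegative, so the estimate may be used under
    them.\<close>
  have tail: "(\<Sum>k\<le>R - d. C k * \<theta> ^ k * (real (d + k) - \<nu>)) \<le>
     (real d + real (Suc m) * \<theta> / (1 - \<theta>) - \<nu>) / (1 - \<theta>) ^ Suc m" if "d \<le> R" for d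
  proof -
    have "(\<lambda>k. real k * C k * \<theta> ^ k + (real d - \<nu>) * (C k * \<theta> ^ k)) sums
       (\<theta> * (real (Suc m) / (1 - \<theta>) ^ (Suc (Suc m))) + (real d - \<nu>) * (1 / (1 - \<theta>) ^ Suc m))"
      by (intro sums_add sums_mult A A')
    also have "(\<lambda>k. real k * C k * \<theta> ^ k + (real d - \<nu>) * (C k * \<theta> ^ k)) = (\<lambda>k. C k * \<theta> ^ k * (real (d + k) - \<nu>))"
      by (auto simp: algebra_simps)
    also have "\<theta> * (real (Suc m) / (1 - \<theta>) ^ (Suc (Suc m))) + (real d - \<nu>) * (1 / (1 - \<theta>) ^ Suc m) =
      (real d + real (Suc m) * \<theta> / (1 - \<theta>) - \<nu>) / (1 - \<theta>) ^ Suc m"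
    proof -
      have "\<theta> * (k / (c * v)) + (e - \<nu>) * (1 / v) = (e + k * \<theta> / c - \<nu>) / v"
        if "c \<noteq> 0" "v \<noteq> 0" for c v k e :: real using that by (simp add: field_simps)
      from this[of "1 - \<theta>" "(1 - \<theta>) ^ Suc m"] show ?thesis
        using \<theta> unfolding power_Suc[of _ "Suc m"] by simp
    qed
    finally have s: "(\<lambda>k. C k * \<theta> ^ k * (real (d + k) - \<nu>)) sums ((real d + real (Suc m) * \<theta> / (1 - \<theta>) - \<nu>) / (1 - \<theta>) ^ Suc m)" .
    have "(\<Sum>k\<le>R - d. C k * \<theta> ^ k * (real (d + k) - \<nu>)) \<le> (\<Sum>k. C k * \<theta> ^ k * (real (d + k) - \<nu>))"
    proof (rule sum_le_suminf[OF sums_summable[OF s]])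
      fix k assume "k \<in> - {..R - d}"
      then have "real R \<le> real (d + k)" by auto
      then have "real (d + k) - \<nu> \<ge> 0" using cheb(2) by linarith
      then show "0 \<le> C k * \<theta> ^ k * (real (d + k) - \<nu>)" using C[of k] \<theta> by (intro mult_nonneg_nonneg) auto
    qed simp
    then show ?thesis using sums_unique[OF s] by simp
  qed
  have lay: "\<theta> ^ n * layer m \<psi> n = (\<Sum>d\<le>n. C (n - d) * \<theta> ^ (n - d) * \<Phi> d)" for n
    unfolding layer_def sum_distrib_left[of "\<theta> ^ n"]
  proof (intro sum.cong refl)
    fix d assume d: "d \<in> {..n}"
    have "(\<Sum>x\<in>sph (Suc m) d. \<psi> x) = \<Phi> d / \<theta> ^ d"
      unfolding \<Phi>_def sum_divide_distrib by (intro sum.cong refl \<psi>)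
    moreover have "\<theta> ^ n = \<theta> ^ (n - d) * \<theta> ^ d" using d by (simp add: power_add[symmetric])
    moreover have "n + m - d = n - d + m" using d by auto
    ultimately show "\<theta> ^ n * (real (n + m - d choose m) * (\<Sum>x\<in>sph (Suc m) d. \<psi> x)) = C (n - d) * \<theta> ^ (n - d) * \<Phi> d"
      using \<theta> by (simp add: C_def)
  qed
  have "0 \<le> (\<Sum>n\<le>R. c n * h n * (real n - \<nu>))" by (rule cheb(3))
  also have "\<dots> = (\<Sum>n\<le>R. (\<theta> ^ n * layer m \<psi> n) * (real n - \<nu>))"
    using C by (intro sum.cong refl) (auto simp: c_def h_def less_imp_neq[symmetric])
  also have "\<dots> = (\<Sum>n\<le>R. \<Sum>d\<le>n. C (n - d) * \<theta> ^ (n - d) * \<Phi> d * (real n - \<nu>))"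
    unfolding lay by (simp add: sum_distrib_right)
  also have "\<dots> = (\<Sum>d\<le>R. \<Sum>k\<le>R - d. C k * \<theta> ^ k * \<Phi> d * (real (d + k) - \<nu>))"
    unfolding sum_triangle_swap by simp
  also have "\<dots> = (\<Sum>d\<le>R. \<Phi> d * (\<Sum>k\<le>R - d. C k * \<theta> ^ k * (real (d + k) - \<nu>)))"
    by (simp add: sum_distrib_left mult_ac)
  also have "\<dots> \<le> (\<Sum>d\<le>R. \<Phi> d * ((real d + real (Suc m) * \<theta> / (1 - \<theta>) - \<nu>) / (1 - \<theta>) ^ Suc m))"
    by (intro sum_mono mult_left_mono tail) (auto simp: \<Phi>_def intro!: sum_nonneg pos)
  also have "\<dots> = (\<Sum>d\<le>R. (real d + real (Suc m) * \<theta> / (1 - \<theta>) - \<nu>) * \<Phi> d) / (1 - \<theta>) ^ Suc m"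
    by (simp add: sum_divide_distrib mult.commute)
  finally have "0 \<le> (\<Sum>d\<le>R. (real d + real (Suc m) * \<theta> / (1 - \<theta>) - \<nu>) * \<Phi> d) / (1 - \<theta>) ^ Suc m" .
  moreover have "0 < (1 - \<theta>) ^ Suc m" using \<theta> by simp
  ultimately show ?thesis unfolding \<nu>_def \<Phi>_def by (simp only: pos_le_divide_eq mult_zero_left)
qed

section \<open>The limiting constant as a logarithmic derivative\<close>

lemma Spoly_pos: "0 \<le> z \<Longrightarrow> 0 < Spoly m z"
proof -
  assume z: "0 \<le> z"
  have "z ^ 0 * real (m choose 0) ^ 2 \<le> Spoly m z"
    unfolding Spoly_def by (rule member_le_sum) (use z in auto)
  then show ?thesis by simp
qed

lemma Spoly_deriv: "(Spoly m has_real_derivative deriv (Spoly m) z) (at z)"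
proof -
  have "Spoly m = (\<lambda>z. \<Sum>j=0..m. z ^ j * real (m choose j) ^ 2)" by (rule ext) (simp add: Spoly_def)
  moreover have "(\<lambda>z::real. \<Sum>j=0..m. z ^ j * real (m choose j) ^ 2) field_differentiable at z"
    by (intro derivative_intros)
  ultimately show ?thesis by (simp add: field_differentiable_derivI)
qed

lemmas Spoly_quotient_deriv = quotient_power_deriv[OF Spoly_deriv]

text \<open>\<open>\<theta> * F' / F\<close> for \<open>F z = Spoly m z / (1 - z) ^ m\<close>, the
  generating function of the spheres: the mean level of the geometric noise. The claimed limit is
  twice this, an L1 distance being twice a level.\<close>

definition meandist :: "nat \<Rightarrow> real \<Rightarrow> real" where
  "meandist m \<theta> = \<theta> * (real m / (1 - \<theta>) + deriv (Spoly m) \<theta> / Spoly m \<theta>)"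

text \<open>The squared binomials have generating function
  \<open>Spoly m z / (1 - z) ^ (2 * m + 1)\<close>. Its logarithmic derivative contributes
  \<open>2 * m + 1\<close> at the pole, and taking off \<open>Suc m\<close> for the common minimum
  leaves the \<open>m\<close> of the spheres.\<close>

lemma meanlevel_limit:
  assumes \<theta>: "0 < \<theta>" "\<theta> < 1"
  shows "(\<lambda>R. meanlevel m \<theta> R - real (Suc m) * \<theta> / (1 - \<theta>)) \<longlonglongrightarrow> meandist m \<theta>"
proof -
  define S where "S = Spoly m \<theta>"
  have S: "S > 0" using Spoly_pos[of \<theta> m] \<theta> by (simp add: S_def)
  define D where "D = deriv (Spoly m) \<theta>"
  have 1: "(\<lambda>n. (real (n + m choose m))\<^sup>2 * \<theta> ^ n) sums (S / (1 - \<theta>) ^ (2 * m + 1))"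
    unfolding S_def by (rule choose_square_series) (use \<theta> in auto)
  have 2: "(\<lambda>n. real n * (real (n + m choose m))\<^sup>2 * \<theta> ^ n) sums
     (\<theta> * (D / (1 - \<theta>) ^ (2 * m + 1) + real (2 * m + 1) * S / (1 - \<theta>) ^ Suc (2 * m + 1)))"
    unfolding S_def D_def
    by (rule series_derivative[OF choose_square_series]; (assumption | rule \<theta> Spoly_quotient_deriv)+)
  have "(\<lambda>R. meanlevel m \<theta> R - real (Suc m) * \<theta> / (1 - \<theta>)) \<longlonglongrightarrow>
     (\<theta> * (D / (1 - \<theta>) ^ (2 * m + 1) + real (2 * m + 1) * S / (1 - \<theta>) ^ Suc (2 * m + 1))) / (S / (1 - \<theta>) ^ (2 * m + 1))
      - real (Suc m) * \<theta> / (1 - \<theta>)"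
    unfolding meanlevel_def using 1[unfolded sums_def_le] 2[unfolded sums_def_le] S \<theta>
    by (intro tendsto_intros) (auto simp: mult.assoc)
  also have "(\<theta> * (D / (1 - \<theta>) ^ (2 * m + 1) + real (2 * m + 1) * S / (1 - \<theta>) ^ Suc (2 * m + 1))) / (S / (1 - \<theta>) ^ (2 * m + 1))
      - real (Suc m) * \<theta> / (1 - \<theta>) = meandist m \<theta>"
  proof -
    have "(\<theta> * (D / u + k * S / (c * u))) / (S / u) - l * \<theta> / c = \<theta> * ((k - l) / c + D / S)"
      if "u \<noteq> 0" "c \<noteq> 0" for u c k l :: real using that S by (simp add: field_simps)
    from this[of "(1 - \<theta>) ^ (2 * m + 1)" "1 - \<theta>" "real (2 * m + 1)" "real (Suc m)"]
    show ?thesis using \<theta> unfolding meandist_def S_def[symmetric] D_def[symmetric] power_Suc[of _ "2 * m + 1"]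
      by simp
  qed
  finally show ?thesis .
qed

lemma nsph_moment:
  assumes m: "0 < m" and \<theta>: "0 < \<theta>" "\<theta> < 1"
  shows "(\<lambda>d. real d * nsph m d * \<theta> ^ d) sums (meandist m \<theta> * (Spoly m \<theta> / (1 - \<theta>) ^ m))"
proof -
  have "(\<lambda>n. real n * nsph m n * \<theta> ^ n) sums
     (\<theta> * (deriv (Spoly m) \<theta> / (1 - \<theta>) ^ m + real m * Spoly m \<theta> / (1 - \<theta>) ^ Suc m))"
    by (rule series_derivative[OF nsph_series[OF m]]; (assumption | rule \<theta> Spoly_quotient_deriv)+)
  also have "\<theta> * (deriv (Spoly m) \<theta> / (1 - \<theta>) ^ m + real m * Spoly m \<theta> / (1 - \<theta>) ^ Suc m) = meandist m \<theta> * (Spoly m \<theta> / (1 - \<theta>) ^ m)"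
    using \<theta> Spoly_pos[of \<theta> m] by (simp add: meandist_def field_simps)
  finally show ?thesis .
qed

text \<open>The subtracted \<open>2 * \<theta> / (1 - \<theta>)\<close> lowers the order of the pole
  by one, from \<open>Suc m\<close> for balls to \<open>m\<close> for spheres.\<close>

lemma Ehr_log_deriv:
  assumes m: "0 < m" and \<theta>: "0 < \<theta>" "\<theta> < 1"
  shows "2 * \<theta> / Ehr (Suc m) \<theta> * deriv (Ehr (Suc m)) \<theta> - 2 * \<theta> / (1 - \<theta>) = 2 * meandist m \<theta>"
proof -
  have "(Ehr (Suc m) has_real_derivative (deriv (Spoly m) \<theta> / (1 - \<theta>) ^ Suc m + real (Suc m) * Spoly m \<theta> / (1 - \<theta>) ^ Suc (Suc m))) (at \<theta>)"
    by (rule has_field_derivative_transform_within_open[OF Spoly_quotient_deriv, where S = "{0<..<1}"])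
      (use \<theta> Ehr_eq[OF m] in auto)
  then have d: "deriv (Ehr (Suc m)) \<theta> = deriv (Spoly m) \<theta> / (1 - \<theta>) ^ Suc m + real (Suc m) * Spoly m \<theta> / (1 - \<theta>) ^ Suc (Suc m)"
    by (rule DERIV_imp_deriv)
  have "2 * \<theta> / (S / u) * (D / u + k * S / (c * u)) - 2 * \<theta> / c = 2 * (\<theta> * ((k - 1) / c + D / S))"
    if "u \<noteq> 0" "c \<noteq> 0" "S \<noteq> 0" for u c S D k :: real
    using that by (simp add: field_simps)
  from this[of "(1 - \<theta>) ^ Suc m" "1 - \<theta>" "Spoly m \<theta>" "deriv (Spoly m) \<theta>" "real (Suc m)"]
  show ?thesis using \<theta> Spoly_pos[of \<theta> m]
    unfolding d Ehr_eq[OF m less_imp_le[OF \<theta>(1)] \<theta>(2)] power_Suc[of _ "Suc m"] meandist_def by simp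
qed

section \<open>The multinomial prior\<close>

definition mpmf :: "nat \<Rightarrow> (nat \<Rightarrow> real) \<Rightarrow> nat \<Rightarrow> (nat \<Rightarrow> int) \<Rightarrow> real" where
  "mpmf K p n h = multinom K n h * (\<Prod>k<K. p k ^ nat (h k))"

lemma hist_eq_compositions: "hist K n = compositions {..<K} n"
  unfolding hist_def compositions_def by (auto simp: not_less)

lemma finite_hist: "finite (hist K n)"
  by (simp add: hist_eq_compositions finite_compositions)

lemma mpmf_altdef: "mpmf K p n h = fact n * (\<Prod>k<K. p k ^ nat (h k) / fact (nat (h k)))"
  by (simp add: mpmf_def multinom_def prod_dividef)

lemma mpmf_nonneg: "\<forall>k<K. 0 < p k \<Longrightarrow> 0 \<le> mpmf K p n h"
  unfolding mpmf_altdef by (intro mult_nonneg_nonneg prod_nonneg) (auto intro!: divide_nonneg_nonneg simp: less_imp_le)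

lemma mpmf_step:
  assumes "k < K" "0 \<le> h k"
  shows "(real_of_int (h k) + 1) * mpmf K p (Suc n) (h(k := h k + 1)) = real (Suc n) * p k * mpmf K p n h"
proof -
  define Q where "Q = (\<Prod>j\<in>{..<K} - {k}. p j ^ nat (h j) / fact (nat (h j)))"
  have 1: "mpmf K p n h = fact n * (p k ^ nat (h k) / fact (nat (h k)) * Q)"
    unfolding mpmf_altdef Q_def using assms by (subst prod.remove[of _ k]) auto
  have "(\<Prod>j\<in>{..<K} - {k}. p j ^ nat ((h(k := h k + 1)) j) / fact (nat ((h(k := h k + 1)) j))) = Q"
    unfolding Q_def by (intro prod.cong) auto
  then have 2: "mpmf K p (Suc n) (h(k := h k + 1)) = fact (Suc n) * (p k ^ nat (h k + 1) / fact (nat (h k + 1)) * Q)"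
    unfolding mpmf_altdef using assms by (subst prod.remove[of _ k]) auto
  have 3: "nat (h k + 1) = Suc (nat (h k))" using assms by simp
  have 4: "real_of_int (h k) + 1 = real (Suc (nat (h k)))" using assms by simp
  show ?thesis unfolding 1 2 3 4 power_Suc fact_Suc by (simp add: field_simps del: of_nat_Suc)
qed

text \<open>All moments of the multinomial distribution used here come from this size-biasing identity.\<close>

lemma mpmf_moment_shift:
  assumes k: "k < K"
  shows "(\<Sum>h\<in>hist K (Suc n). real_of_int (h k) * F h * mpmf K p (Suc n) h) =
    real (Suc n) * p k * (\<Sum>h\<in>hist K n. F (h(k := h k + 1)) * mpmf K p n h)"
proof -
  have "(\<Sum>h\<in>hist K (Suc n). real_of_int (h k) * F h * mpmf K p (Suc n) h) =
    (\<Sum>h\<in>{h \<in> hist K (Suc n). h k \<noteq> 0}. real_of_int (h k) * F h * mpmf K p (Suc n) h)"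
    by (rule sum.mono_neutral_right) (auto simp: finite_hist)
  also have "\<dots> = (\<Sum>h\<in>hist K n. real_of_int (h k + 1) * F (h(k := h k + 1)) * mpmf K p (Suc n) (h(k := h k + 1)))"
  proof (rule sum.reindex_bij_witness[of _ "\<lambda>h. h(k := h k + 1)" "\<lambda>h. h(k := h k - 1)"])
    have up: "(\<Sum>j<K. (h(k := c)) j) = (\<Sum>j<K. h j) + c - h k" for h :: "nat \<Rightarrow> int" and c
      using k by (simp add: sum.remove[of _ k])
    show "h(k := h k - 1) \<in> hist K n" if "h \<in> {h \<in> hist K (Suc n). h k \<noteq> 0}" for h
    proof -
      have "h k \<ge> 0" using that k by (auto simp: hist_def)
      then show ?thesis using that k by (auto simp: hist_def up simp del: fun_upd_apply) auto
    qed
    show "h(k := h k + 1) \<in> {h \<in> hist K (Suc n). h k \<noteq> 0}" if "h \<in> hist K n" for h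
    proof -
      have "h k \<ge> 0" using that k by (auto simp: hist_def)
      then show ?thesis using that k by (auto simp: hist_def up simp del: fun_upd_apply) auto
    qed
  qed auto
  also have "\<dots> = (\<Sum>h\<in>hist K n. real (Suc n) * p k * (F (h(k := h k + 1)) * mpmf K p n h))"
  proof (intro sum.cong refl)
    fix h assume "h \<in> hist K n"
    then have "0 \<le> h k" using k by (auto simp: hist_def)
    note st = mpmf_step[of k K h p n, OF k this]
    have "real_of_int (h k + 1) * F (h(k := h k + 1)) * mpmf K p (Suc n) (h(k := h k + 1)) =
       F (h(k := h k + 1)) * ((real_of_int (h k) + 1) * mpmf K p (Suc n) (h(k := h k + 1)))"
      by (simp only: of_int_add of_int_1 mult_ac)
    also have "\<dots> = real (Suc n) * p k * (F (h(k := h k + 1)) * mpmf K p n h)"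
      unfolding st by (simp only: mult_ac)
    finally show "real_of_int (h k + 1) * F (h(k := h k + 1)) * mpmf K p (Suc n) (h(k := h k + 1)) =
       real (Suc n) * p k * (F (h(k := h k + 1)) * mpmf K p n h)" .
  qed
  finally show ?thesis by (simp add: sum_distrib_left)
qed

lemma hist_0: "hist K 0 = {\<lambda>_. 0}"
proof -
  have "h = (\<lambda>_. 0)" if "h \<in> hist K 0" for h
  proof
    fix k
    have "\<forall>k\<in>{..<K}. h k = 0"
      using that sum_nonneg_eq_0_iff[of "{..<K}" h] by (auto simp: hist_def)
    then show "h k = 0" using that by (cases "k < K") (auto simp: hist_def)
  qed
  then show ?thesis by (auto simp: hist_def)
qed

text \<open>Writing \<open>Suc n\<close> as the sum of the coordinates and size-biasing each of them
  reduces the total mass to that for \<open>n\<close>.\<close>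

lemma mpmf_total:
  assumes "(\<Sum>k<K. p k) = 1"
  shows "(\<Sum>h\<in>hist K n. mpmf K p n h) = 1"
proof (induction n)
  case 0
  then show ?case by (simp add: hist_0 mpmf_altdef)
next
  case (Suc n)
  have "real (Suc n) * (\<Sum>h\<in>hist K (Suc n). mpmf K p (Suc n) h) =
    (\<Sum>h\<in>hist K (Suc n). (\<Sum>k<K. real_of_int (h k)) * mpmf K p (Suc n) h)"
    unfolding sum_distrib_left
  proof (intro sum.cong refl)
    fix h assume "h \<in> hist K (Suc n)"
    then have "real_of_int (\<Sum>k<K. h k) = real (Suc n)" by (auto simp: hist_def)
    then show "real (Suc n) * mpmf K p (Suc n) h = (\<Sum>k<K. real_of_int (h k)) * mpmf K p (Suc n) h" by simp
  qed
  also have "\<dots> = (\<Sum>k<K. \<Sum>h\<in>hist K (Suc n). real_of_int (h k) * 1 * mpmf K p (Suc n) h)"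
    unfolding sum_distrib_right by (subst sum.swap) simp
  also have "\<dots> = (\<Sum>k<K. real (Suc n) * p k)"
    by (intro sum.cong refl) (subst mpmf_moment_shift, auto simp: Suc)
  also have "\<dots> = real (Suc n)" using assms by (simp add: sum_distrib_left[symmetric] del: of_nat_Suc)
  finally show ?case by (simp del: of_nat_Suc)
qed

lemma mpmf_mean:
  assumes "(\<Sum>k<K. p k) = 1" "k < K"
  shows "(\<Sum>h\<in>hist K n. real_of_int (h k) * mpmf K p n h) = real n * p k"
proof (cases n)
  case 0
  then show ?thesis by (simp add: hist_0)
next
  case (Suc n')
  then show ?thesis using mpmf_moment_shift[OF assms(2), of "\<lambda>_. 1" p n'] mpmf_total[OF assms(1), of n'] by simp
qed

lemma mpmf_variance:
  assumes "(\<Sum>k<K. p k) = 1" "k < K"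
  shows "(\<Sum>h\<in>hist K n. (real_of_int (h k) - real n * p k)\<^sup>2 * mpmf K p n h) = real n * p k * (1 - p k)"
proof (cases n)
  case 0
  then show ?thesis by (simp add: hist_0)
next
  case (Suc n')
  have "(\<Sum>h\<in>hist K n. real_of_int (h k) * real_of_int (h k) * mpmf K p n h) =
      real n * p k * (\<Sum>h\<in>hist K n'. real_of_int (h k + 1) * mpmf K p n' h)"
    unfolding Suc using mpmf_moment_shift[OF assms(2), of "\<lambda>h. real_of_int (h k)" p n'] by simp
  also have "(\<Sum>h\<in>hist K n'. real_of_int (h k + 1) * mpmf K p n' h) = real n' * p k + 1"
    using mpmf_mean[OF assms, of n'] mpmf_total[OF assms(1), of n'] by (simp add: distrib_right sum.distrib)
  finally have 2: "(\<Sum>h\<in>hist K n. real_of_int (h k) * real_of_int (h k) * mpmf K p n h) = real n * p k * (real n' * p k + 1)" .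
  have "(\<Sum>h\<in>hist K n. (real_of_int (h k) - real n * p k)\<^sup>2 * mpmf K p n h) =
     (\<Sum>h\<in>hist K n. real_of_int (h k) * real_of_int (h k) * mpmf K p n h)
     - 2 * (real n * p k) * (\<Sum>h\<in>hist K n. real_of_int (h k) * mpmf K p n h)
     + (real n * p k)\<^sup>2 * (\<Sum>h\<in>hist K n. mpmf K p n h)"
    unfolding sum_distrib_left sum_subtractf[symmetric] sum.distrib[symmetric]
    by (intro sum.cong refl) (simp add: power2_eq_square algebra_simps)
  also have "\<dots> = real n * p k * (1 - p k)"
    unfolding 2 mpmf_mean[OF assms] mpmf_total[OF assms(1)] by (simp add: Suc power2_eq_square algebra_simps)
  finally show ?thesis .
qed

section \<open>Concentration and local flatness of the prior\<close>

definition typical :: "nat \<Rightarrow> (nat \<Rightarrow> real) \<Rightarrow> real \<Rightarrow> nat \<Rightarrow> (nat \<Rightarrow> int) set" where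
  "typical K p \<delta> n = {h \<in> hist K n. \<forall>k<K. \<bar>real_of_int (h k) - real n * p k\<bar> \<le> \<delta> * (real n * p k)}"

lemma typical_mass:
  assumes p: "\<forall>k<K. 0 < p k" "(\<Sum>k<K. p k) = 1" and \<delta>: "0 < \<delta>"
  shows "(\<lambda>n. \<Sum>h\<in>typical K p \<delta> n. mpmf K p n h) \<longlonglongrightarrow> 1"
proof -
  \<comment> \<open>Union bound over Chebyshev's inequality: a variance of at most
    \<open>n * p k\<close> over \<open>(\<delta> * n * p k)^2\<close> leaves
    \<open>1 / (\<delta>^2 * p k)\<close> divided by \<open>n\<close>.\<close>
  define B where "B = (\<Sum>k<K. 1 / (\<delta>\<^sup>2 * p k))"
  have bd: "1 - B / real n \<le> (\<Sum>h\<in>typical K p \<delta> n. mpmf K p n h)" if n: "n > 0" for n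
  proof -
    have "(\<Sum>h\<in>hist K n - typical K p \<delta> n. mpmf K p n h) \<le>
       (\<Sum>h\<in>hist K n - typical K p \<delta> n. \<Sum>k<K. (real_of_int (h k) - real n * p k)\<^sup>2 / (\<delta> * (real n * p k))\<^sup>2 * mpmf K p n h)"
    proof (rule sum_mono)
      fix h assume h: "h \<in> hist K n - typical K p \<delta> n"
      then obtain k where k: "k < K" "\<bar>real_of_int (h k) - real n * p k\<bar> > \<delta> * (real n * p k)"
        by (auto simp: typical_def not_le)
      have pk: "\<delta> * (real n * p k) > 0" using p k n \<delta> by simp
      then have "(\<delta> * (real n * p k))\<^sup>2 \<le> \<bar>real_of_int (h k) - real n * p k\<bar>\<^sup>2" using k by (intro power_mono) auto
      then have "1 \<le> (real_of_int (h k) - real n * p k)\<^sup>2 / (\<delta> * (real n * p k))\<^sup>2"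
        using zero_less_power[OF pk, of 2] by (simp add: pos_le_divide_eq)
      then have "mpmf K p n h \<le> (real_of_int (h k) - real n * p k)\<^sup>2 / (\<delta> * (real n * p k))\<^sup>2 * mpmf K p n h"
        using mult_right_mono[of 1 _ "mpmf K p n h"] mpmf_nonneg[OF p(1), of n h] by fastforce
      also have "\<dots> \<le> (\<Sum>k<K. (real_of_int (h k) - real n * p k)\<^sup>2 / (\<delta> * (real n * p k))\<^sup>2 * mpmf K p n h)"
        by (rule member_le_sum[of k "{..<K}"]) (use k mpmf_nonneg[OF p(1), of n h] in auto)
      finally show "mpmf K p n h \<le> (\<Sum>k<K. (real_of_int (h k) - real n * p k)\<^sup>2 / (\<delta> * (real n * p k))\<^sup>2 * mpmf K p n h)" .
    qed
    also have "\<dots> \<le> (\<Sum>h\<in>hist K n. \<Sum>k<K. (real_of_int (h k) - real n * p k)\<^sup>2 / (\<delta> * (real n * p k))\<^sup>2 * mpmf K p n h)"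
      by (rule sum_mono2) (use mpmf_nonneg[OF p(1)] in \<open>auto simp: finite_hist intro!: sum_nonneg\<close>)
    also have "\<dots> = (\<Sum>k<K. (\<Sum>h\<in>hist K n. (real_of_int (h k) - real n * p k)\<^sup>2 * mpmf K p n h) / (\<delta> * (real n * p k))\<^sup>2)"
      by (subst sum.swap) (simp add: sum_divide_distrib)
    also have "\<dots> \<le> (\<Sum>k<K. 1 / (\<delta>\<^sup>2 * p k) / real n)"
    proof (rule sum_mono)
      fix k assume "k \<in> {..<K}"
      then have k: "k < K" "p k > 0" using p by auto
      have "real n * p k * (1 - p k) / (\<delta> * (real n * p k))\<^sup>2 \<le> real n * p k / (\<delta> * (real n * p k))\<^sup>2"
        by (intro divide_right_mono) (use k in \<open>auto simp: mult_left_le algebra_simps\<close>)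
      also have "\<dots> = 1 / (\<delta>\<^sup>2 * p k) / real n" using n k \<delta> by (simp add: power2_eq_square)
      finally show "(\<Sum>h\<in>hist K n. (real_of_int (h k) - real n * p k)\<^sup>2 * mpmf K p n h) / (\<delta> * (real n * p k))\<^sup>2 \<le> 1 / (\<delta>\<^sup>2 * p k) / real n"
        unfolding mpmf_variance[OF p(2) k(1)] .
    qed
    also have "\<dots> = B / real n" by (simp add: B_def sum_divide_distrib)
    finally have "(\<Sum>h\<in>hist K n - typical K p \<delta> n. mpmf K p n h) \<le> B / real n" .
    moreover have "(\<Sum>h\<in>hist K n - typical K p \<delta> n. mpmf K p n h) = 1 - (\<Sum>h\<in>typical K p \<delta> n. mpmf K p n h)"
      unfolding mpmf_total[OF p(2), of n, symmetric] by (rule sum_diff) (auto simp: finite_hist typical_def)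
    ultimately show ?thesis by linarith
  qed
  have le1: "(\<Sum>h\<in>typical K p \<delta> n. mpmf K p n h) \<le> 1" for n
    unfolding mpmf_total[OF p(2), of n, symmetric]
    by (rule sum_mono2) (use mpmf_nonneg[OF p(1)] in \<open>auto simp: finite_hist typical_def\<close>)
  show ?thesis
  proof (rule tendsto_sandwich)
    show "\<forall>\<^sub>F n in sequentially. 1 - B / real n \<le> (\<Sum>h\<in>typical K p \<delta> n. mpmf K p n h)"
      using eventually_gt_at_top[of 0] by eventually_elim (rule bd)
    show "\<forall>\<^sub>F n in sequentially. (\<Sum>h\<in>typical K p \<delta> n. mpmf K p n h) \<le> 1" by (simp add: le1)
    have "(\<lambda>n. 1 - B / real n) \<longlonglongrightarrow> 1 - 0" by (intro tendsto_intros lim_const_over_n)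
    then show "(\<lambda>n. 1 - B / real n) \<longlonglongrightarrow> 1" by simp
  qed simp
qed

text \<open>Consecutive terms \<open>t ^ c / fact c\<close> have the ratio
  \<open>t / (c + 1)\<close>. Between \<open>a\<close> and \<open>b\<close> it stays within
  \<open>1 - \<delta>\<close> and \<open>1 / (1 - \<delta>)\<close>, the lower end because
  \<open>(1 - \<delta>) * (1 + \<delta>) \<le> 1\<close>. Each unit step thus costs one factor
  \<open>1 - \<delta>\<close>.\<close>

lemma power_fact_ratio:
  fixes t \<delta> :: real
  assumes \<delta>: "0 < \<delta>" "\<delta> < 1" and t: "0 < t" and ab: "a \<le> b" "(1 - \<delta>) * t \<le> real a" "real b \<le> (1 + \<delta>) * t"
  shows "(1 - \<delta>) ^ (b - a) * (t ^ a / fact a) \<le> t ^ b / fact b" "(1 - \<delta>) ^ (b - a) * (t ^ b / fact b) \<le> t ^ a / fact a"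
proof -
  define q where "q c = t ^ c / fact c" for c
  have q: "q c > 0" "q (Suc c) * real (Suc c) = q c * t" for c using t by (auto simp: q_def divide_simps)
  have s1: "(1 - \<delta>) * q c \<le> q (Suc c)" if "Suc c \<le> b" for c
  proof -
    have "(1 - \<delta>) * real (Suc c) \<le> (1 - \<delta>) * ((1 + \<delta>) * t)" using that ab \<delta> by (intro mult_left_mono) auto
    also have "\<dots> \<le> t" using t \<delta> mult_nonneg_nonneg[of \<delta> "\<delta> * t"] by (simp add: algebra_simps)
    finally have "q c * ((1 - \<delta>) * real (Suc c)) \<le> q c * t" using q(1)[of c] by (intro mult_left_mono) auto
    then have "((1 - \<delta>) * q c) * real (Suc c) \<le> q (Suc c) * real (Suc c)" unfolding q(2) by (simp only: mult_ac)
    then show ?thesis by (subst (asm) mult_le_cancel_right_pos) auto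
  qed
  have s2: "(1 - \<delta>) * q (Suc c) \<le> q c" if "a \<le> c" for c
  proof -
    have "(1 - \<delta>) * t \<le> real (Suc c)" using that ab by simp
    then have "q c * ((1 - \<delta>) * t) \<le> q c * real (Suc c)" using q(1)[of c] by (intro mult_left_mono) auto
    then have "((1 - \<delta>) * q (Suc c)) * real (Suc c) \<le> q c * real (Suc c)" using q(2)[of c] by (simp only: mult_ac)
    then show ?thesis by (subst (asm) mult_le_cancel_right_pos) auto
  qed
  have "(1 - \<delta>) ^ (c - a) * q a \<le> q c \<and> (1 - \<delta>) ^ (c - a) * q c \<le> q a" if "a \<le> c" "c \<le> b" for c
    using that
  proof (induction c rule: dec_induct)
    case base
    then show ?case by simp
  next
    case (step c)
    have e: "Suc c - a = Suc (c - a)" using step by simp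
    have "(1 - \<delta>) ^ (Suc c - a) * q a \<le> (1 - \<delta>) * q c" unfolding e using step \<delta> by (simp add: mult.assoc)
    moreover have "(1 - \<delta>) ^ (Suc c - a) * q (Suc c) \<le> (1 - \<delta>) ^ (c - a) * q c"
      unfolding e using s2[of c] step \<delta> by (simp add: mult_ac mult_left_mono)
    ultimately show ?case using step s1[of c] by (auto intro: order_trans)
  qed
  from this[of b] show "(1 - \<delta>) ^ (b - a) * (t ^ a / fact a) \<le> t ^ b / fact b" "(1 - \<delta>) ^ (b - a) * (t ^ b / fact b) \<le> t ^ a / fact a"
    using ab unfolding q_def by auto
qed

text \<open>As the coordinates sum to \<open>n\<close>, a factor \<open>fact n / n ^ n\<close> can
  be pulled out, and a product of Poisson-like weights with means \<open>n * p k\<close> remains.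
  These are compared coordinate by coordinate, and the exponents add up to the L1 distance.\<close>

lemma mpmf_ratio:
  assumes p: "\<forall>k<K. 0 < p k" and \<delta>: "0 < \<delta>" "\<delta> < 1" and n: "0 < n" and g: "g \<in> typical K p \<delta> n" and h: "h \<in> typical K p \<delta> n"
  shows "(1 - \<delta>) ^ nat (l1dist K g h) * mpmf K p n g \<le> mpmf K p n h"
proof -
  define t where "t k = real n * p k" for k
  have alt: "mpmf K p n x = fact n / real n ^ n * (\<Prod>k<K. t k ^ nat (x k) / fact (nat (x k)))" if "x \<in> hist K n" for x
  proof -
    have "(\<Sum>k<K. nat (x k)) = n"
    proof -
      have "int (\<Sum>k<K. nat (x k)) = (\<Sum>k<K. x k)"
        unfolding of_nat_sum using that by (intro sum.cong) (auto simp: hist_def)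
      then have "int (\<Sum>k<K. nat (x k)) = int n" using that by (simp only: hist_def mem_Collect_eq)
      then show ?thesis by (simp only: of_nat_eq_iff)
    qed
    then have "(\<Prod>k<K. real n ^ nat (x k)) = real n ^ n" by (simp add: power_sum[symmetric])
    then have "(\<Prod>k<K. t k ^ nat (x k) / fact (nat (x k))) = real n ^ n * (\<Prod>k<K. p k ^ nat (x k) / fact (nat (x k)))"
      by (simp add: t_def power_mult_distrib prod_dividef prod.distrib)
    then show ?thesis unfolding mpmf_altdef using n by simp
  qed
  have gh: "g \<in> hist K n" "h \<in> hist K n" using g h by (auto simp: typical_def)
  have "nat (l1dist K g h) = (\<Sum>k<K. nat \<bar>g k - h k\<bar>)"
  proof -
    have "int (\<Sum>k<K. nat \<bar>g k - h k\<bar>) = l1dist K g h" by (simp add: l1dist_def)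
    then show ?thesis by (metis nat_int)
  qed
  then have "(1 - \<delta>) ^ nat (l1dist K g h) * (\<Prod>k<K. t k ^ nat (g k) / fact (nat (g k))) =
     (\<Prod>k<K. (1 - \<delta>) ^ nat \<bar>g k - h k\<bar> * (t k ^ nat (g k) / fact (nat (g k))))"
    by (simp only: power_sum prod.distrib)
  also have "\<dots> \<le> (\<Prod>k<K. t k ^ nat (h k) / fact (nat (h k)))"
  proof (rule prod_mono)
    fix k assume "k \<in> {..<K}"
    then have k: "k < K" by simp
    have t: "t k > 0" using p n k by (simp add: t_def)
    have nn: "0 \<le> g k" "0 \<le> h k" using gh k by (auto simp: hist_def)
    have r: "(1 - \<delta>) * t k \<le> real (nat (x k)) \<and> real (nat (x k)) \<le> (1 + \<delta>) * t k" if "x \<in> typical K p \<delta> n" for x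
    proof -
      have "\<bar>real_of_int (x k) - t k\<bar> \<le> \<delta> * t k" "0 \<le> x k" using that k by (auto simp: typical_def t_def hist_def)
      then show ?thesis by (auto simp: algebra_simps)
    qed
    show "0 \<le> (1 - \<delta>) ^ nat \<bar>g k - h k\<bar> * (t k ^ nat (g k) / fact (nat (g k))) \<and>
       (1 - \<delta>) ^ nat \<bar>g k - h k\<bar> * (t k ^ nat (g k) / fact (nat (g k))) \<le> t k ^ nat (h k) / fact (nat (h k))"
    proof (cases "g k \<le> h k")
      case True
      then have e: "nat \<bar>g k - h k\<bar> = nat (h k) - nat (g k)" using nn by auto
      have "(1 - \<delta>) ^ (nat (h k) - nat (g k)) * (t k ^ nat (g k) / fact (nat (g k))) \<le> t k ^ nat (h k) / fact (nat (h k))"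
        by (rule power_fact_ratio(1)) (use \<delta> t True r[OF g] r[OF h] in auto)
      then show ?thesis unfolding e using \<delta> t by auto
    next
      case False
      then have e: "nat \<bar>g k - h k\<bar> = nat (g k) - nat (h k)" using nn by auto
      have "(1 - \<delta>) ^ (nat (g k) - nat (h k)) * (t k ^ nat (g k) / fact (nat (g k))) \<le> t k ^ nat (h k) / fact (nat (h k))"
        by (rule power_fact_ratio(2)) (use \<delta> t False r[OF g] r[OF h] in auto)
      then show ?thesis unfolding e using \<delta> t by auto
    qed
  qed
  finally have "fact n / real n ^ n * ((1 - \<delta>) ^ nat (l1dist K g h) * (\<Prod>k<K. t k ^ nat (g k) / fact (nat (g k)))) \<le>
     fact n / real n ^ n * (\<Prod>k<K. t k ^ nat (h k) / fact (nat (h k)))"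
    by (intro mult_left_mono) auto
  then show ?thesis unfolding alt[OF gh(1)] alt[OF gh(2)] by (simp only: mult_ac)
qed

section \<open>Truncated geometric mechanism\<close>

lemma radial_has_sum:
  fixes r :: "nat \<Rightarrow> real"
  assumes r: "\<And>d. 0 \<le> r d" and s: "(\<lambda>d. nsph m d * r d) sums S"
  shows "((\<lambda>x. r (level (Suc m) x)) has_sum S) (lat (Suc m))"
proof -
  let ?S = "SIGMA d:UNIV. sph (Suc m) d"
  have g: "((\<lambda>d. nsph m d * r d) has_sum S) UNIV"
    by (rule sums_nonneg_imp_has_sum[OF s]) (simp add: r)
  have f: "((\<lambda>x. case (d, x) of (d, x) \<Rightarrow> r d) has_sum (nsph m d * r d)) (sph (Suc m) d)" for d
    by (rule has_sum_finiteI) (auto simp: finite_sph)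
  have sm: "(\<lambda>(d, x). r d) summable_on ?S"
    by (rule summable_on_SigmaI[OF f]) (use r g in \<open>auto intro: has_sum_imp_summable\<close>)
  have "((\<lambda>(d, x). r d) has_sum S) ?S"
    by (rule has_sum_SigmaI[OF f g sm])
  moreover have "((\<lambda>(d, x). r d) has_sum S) ?S = ((\<lambda>x. r (level (Suc m) x)) has_sum S) (lat (Suc m))"
    by (rule has_sum_reindex_bij_witness[of _ "\<lambda>x. (level (Suc m) x, x)" snd]) (auto simp: sph_lat)
  ultimately show ?thesis by simp
qed

lemma hist_ext_radial_has_sum:
  fixes r :: "nat \<Rightarrow> real"
  assumes r: "\<And>d. 0 \<le> r d" and s: "(\<lambda>d. nsph m d * r d) sums S" and h: "h \<in> hist_ext (Suc m) n"
  shows "((\<lambda>b. r (level (Suc m) (\<lambda>k. b k - h k))) has_sum S) (hist_ext (Suc m) n)"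
proof -
  have "((\<lambda>b. r (level (Suc m) (\<lambda>k. b k - h k))) has_sum S) (hist_ext (Suc m) n) =
     ((\<lambda>x. r (level (Suc m) x)) has_sum S) (lat (Suc m))"
    by (rule has_sum_reindex_bij_witness[of _ "\<lambda>x k. x k + h k" "\<lambda>b k. b k - h k"])
      (use h in \<open>auto simp: hist_ext_def lat_def sum.distrib sum_subtractf\<close>)
  then show ?thesis using radial_has_sum[OF r s] by simp
qed

lemma hist_sub_ext: "hist K n \<subseteq> hist_ext K n"
  by (auto simp: hist_def hist_ext_def)

lemma diff_lat: "b \<in> hist_ext K n \<Longrightarrow> h \<in> hist_ext K n \<Longrightarrow> (\<lambda>k. b k - h k) \<in> lat K"
  by (auto simp: hist_ext_def lat_def sum_subtractf)

lemma l1dist_level: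
  assumes "b \<in> hist_ext K n" "h \<in> hist_ext K n"
  shows "l1dist K b h = 2 * int (level K (\<lambda>k. b k - h k))"
  using lat_sph[OF diff_lat[OF assms]] by (auto simp: sph_def l1dist_def)

lemma l1dist_sym: "l1dist K a b = l1dist K b a"
  by (simp add: l1dist_def abs_minus_commute)

lemma l1dist_triangle: "l1dist K a c \<le> l1dist K a b + l1dist K b c"
  unfolding l1dist_def sum.distrib[symmetric] by (rule sum_mono) auto

lemma l1dist_nonneg: "0 \<le> l1dist K a b"
  unfolding l1dist_def by (rule sum_nonneg) auto

text \<open>The sum of \<theta> to the level over the whole lattice, hence the normalising constant
  of the noise.\<close>

definition zsum :: "nat \<Rightarrow> real \<Rightarrow> real" where
  "zsum m \<theta> = Spoly m \<theta> / (1 - \<theta>) ^ m"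

text \<open>The distance is even, so the real exponent is a natural number; multiplying
  \<open>Ehr\<close> by \<open>1 - \<theta>\<close> leads back from balls to spheres.\<close>

lemma geomU_eq:
  assumes m: "0 < m" and \<theta>: "0 < \<theta>" "\<theta> < 1" and b: "b \<in> hist_ext (Suc m) n" and h: "h \<in> hist_ext (Suc m) n"
  shows "geomU (Suc m) \<theta> b h = \<theta> ^ level (Suc m) (\<lambda>k. b k - h k) / zsum m \<theta>"
proof -
  have "(1 - \<theta>) * Ehr (Suc m) \<theta> = zsum m \<theta>"
    using Ehr_eq[OF m, of \<theta>] \<theta> by (simp add: zsum_def)
  then show ?thesis unfolding geomU_def l1dist_level[OF b h] using \<theta> by (simp add: powr_realpow)
qed

section \<open>Push-forward to the nearest histogram\<close>

lemma partition_infsum: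
  fixes F :: "'a \<Rightarrow> real"
  assumes F: "(F has_sum S) B" and f: "f ` B \<subseteq> G" and G: "finite G"
  shows "S = (\<Sum>g\<in>G. infsum F {b \<in> B. f b = g})"
proof -
  have "((\<lambda>(g, b). F b) has_sum S) (SIGMA g:G. {b \<in> B. f b = g}) = (F has_sum S) B"
    by (rule has_sum_reindex_bij_witness[of _ "\<lambda>b. (f b, b)" snd]) (use f in auto)
  then have 1: "((\<lambda>(g, b). F b) has_sum S) (SIGMA g:G. {b \<in> B. f b = g})" using F by simp
  have 2: "((\<lambda>b. case (g, b) of (g, b) \<Rightarrow> F b) has_sum infsum F {b \<in> B. f b = g}) {b \<in> B. f b = g}" for g
    using summable_on_subset_banach[OF has_sum_imp_summable[OF F], of "{b \<in> B. f b = g}"] by auto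
  have "((\<lambda>g. infsum F {b \<in> B. f b = g}) has_sum S) G" by (rule has_sum_SigmaD[OF 1 2])
  moreover have "((\<lambda>g. infsum F {b \<in> B. f b = g}) has_sum (\<Sum>g\<in>G. infsum F {b \<in> B. f b = g})) G" using G by simp
  ultimately show ?thesis using has_sum_unique by blast
qed

definition nearest :: "nat \<Rightarrow> nat \<Rightarrow> (nat \<Rightarrow> int) \<Rightarrow> (nat \<Rightarrow> int)" where
  "nearest K n b = (if b \<in> hist K n then b else arg_min_on (l1dist K b) (hist K n))"

lemma hist_nonempty: "hist (Suc m) n \<noteq> {}"
proof -
  have "(\<lambda>k. if k = 0 then int n else 0) \<in> hist (Suc m) n"
    by (auto simp: hist_def lessThan_Suc_eq_insert_0 sum.insert)
  then show ?thesis by blast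
qed

lemma nearest_in: "nearest (Suc m) n b \<in> hist (Suc m) n"
  unfolding nearest_def using arg_min_if_finite(1)[OF finite_hist hist_nonempty] by auto

text \<open>The triangle inequality through \<open>b\<close>, whose distance to the nearest
  histogram is at most that to \<open>h\<close>. The doubling is kept as a separate summand so that
  it can be charged to large noise alone.\<close>

lemma nearest_dist:
  assumes "h \<in> hist (Suc m) n"
  shows "l1dist (Suc m) h (nearest (Suc m) n b) \<le> l1dist (Suc m) b h + (if b \<in> hist (Suc m) n then 0 else l1dist (Suc m) b h)"
proof (cases "b \<in> hist (Suc m) n")
  case True
  then show ?thesis by (simp add: nearest_def l1dist_sym)
next
  case False
  have "l1dist (Suc m) b (nearest (Suc m) n b) \<le> l1dist (Suc m) b h"
    unfolding nearest_def using False arg_min_least[OF finite_hist hist_nonempty assms, of "l1dist (Suc m) b"] by simp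
  then show ?thesis using False l1dist_triangle[of "Suc m" h "nearest (Suc m) n b" b] l1dist_sym[of "Suc m" h b] by simp
qed

definition trunc :: "nat \<Rightarrow> real \<Rightarrow> nat \<Rightarrow> (nat \<Rightarrow> int) \<Rightarrow> (nat \<Rightarrow> int) \<Rightarrow> real" where
  "trunc K \<theta> n g h = infsum (\<lambda>b. geomU K \<theta> b h) {b \<in> hist_ext K n. nearest K n b = g}"

lemma distortion_eq:
  "distortion K n W p = (\<Sum>h\<in>hist K n. mpmf K p n h * (\<Sum>g\<in>hist K n. W g h * real_of_int (l1dist K h g)))"
  unfolding distortion_def mpmf_def by (simp add: sum_distrib_left mult.assoc)

context
  fixes m :: nat and \<theta> :: real
  assumes m: "0 < m" and \<theta>: "0 < \<theta>" "\<theta> < 1"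
begin

abbreviation "Zc \<equiv> zsum m \<theta>"

lemma Zc_pos: "0 < Zc"
  using \<theta> Spoly_pos[of \<theta> m] by (simp add: zsum_def)

lemma geomU_nonneg: "b \<in> hist_ext (Suc m) n \<Longrightarrow> h \<in> hist_ext (Suc m) n \<Longrightarrow> 0 \<le> geomU (Suc m) \<theta> b h"
  using geomU_eq[OF m \<theta>] Zc_pos \<theta> by simp

text \<open>Common source of the total mass (\<open>c d = 1\<close>), the mean distance
  (\<open>c d = 2 * d\<close>) and its part above a threshold.\<close>

lemma geomU_weighted_has_sum:
  assumes c: "\<And>d. 0 \<le> c d" and s: "(\<lambda>d. c d * (nsph m d * \<theta> ^ d)) sums S" and h: "h \<in> hist_ext (Suc m) n"
  shows "((\<lambda>b. geomU (Suc m) \<theta> b h * c (level (Suc m) (\<lambda>k. b k - h k))) has_sum (S / Zc)) (hist_ext (Suc m) n)"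
proof -
  have "((\<lambda>b. \<theta> ^ level (Suc m) (\<lambda>k. b k - h k) * c (level (Suc m) (\<lambda>k. b k - h k)) / Zc) has_sum (S / Zc)) (hist_ext (Suc m) n)"
    by (rule hist_ext_radial_has_sum[of "\<lambda>d. \<theta> ^ d * c d / Zc"])
      (use c \<theta> Zc_pos h sums_divide[OF s, of Zc] in \<open>auto simp: mult_ac\<close>)
  then show ?thesis
    by (rule has_sum_cong[THEN iffD1, rotated]) (simp add: geomU_eq[OF m \<theta> _ h])
qed

lemma geomU_has_sum: "h \<in> hist_ext (Suc m) n \<Longrightarrow> ((\<lambda>b. geomU (Suc m) \<theta> b h) has_sum 1) (hist_ext (Suc m) n)"
  using geomU_weighted_has_sum[of "\<lambda>_. 1" Zc h n] nsph_series[OF m, of \<theta>, folded zsum_def] \<theta> Zc_pos by simp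

lemma trunc_HSM: "is_HSM (Suc m) n (trunc (Suc m) \<theta> n)"
  unfolding is_HSM_def
proof (intro ballI conjI)
  fix h assume "h \<in> hist (Suc m) n"
  then have h: "h \<in> hist_ext (Suc m) n" using hist_sub_ext by blast
  show "0 \<le> trunc (Suc m) \<theta> n g h" for g
    unfolding trunc_def by (rule infsum_nonneg) (use geomU_nonneg h in auto)
  show "(\<Sum>g\<in>hist (Suc m) n. trunc (Suc m) \<theta> n g h) = 1"
    unfolding trunc_def by (rule partition_infsum[symmetric, OF geomU_has_sum[OF h]]) (auto simp: nearest_in finite_hist)
qed

text \<open>Passing to a neighbour changes the level of \<open>b - h\<close> by at most one, and so
  each weight by at most one factor \<theta>. A deterministic map merely adds up such
  inequalities.\<close>

lemma trunc_DP_half: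
  assumes h: "h \<in> hist (Suc m) n" "h' \<in> hist (Suc m) n" and nb: "l1dist (Suc m) h h' = 2"
  shows "\<theta> * trunc (Suc m) \<theta> n g h \<le> trunc (Suc m) \<theta> n g h'"
proof -
  have he: "h \<in> hist_ext (Suc m) n" "h' \<in> hist_ext (Suc m) n" using h hist_sub_ext by blast+
  let ?A = "{b \<in> hist_ext (Suc m) n. nearest (Suc m) n b = g}"
  have sm: "(\<lambda>b. geomU (Suc m) \<theta> b x) summable_on ?A" if "x \<in> hist_ext (Suc m) n" for x
    by (rule summable_on_subset_banach[OF has_sum_imp_summable[OF geomU_has_sum[OF that]]]) auto
  have "\<theta> * trunc (Suc m) \<theta> n g h = infsum (\<lambda>b. \<theta> * geomU (Suc m) \<theta> b h) ?A"
    unfolding trunc_def by (rule infsum_cmult_right[symmetric]) (rule sm[OF he(1)])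
  also have "\<dots> \<le> infsum (\<lambda>b. geomU (Suc m) \<theta> b h') ?A"
  proof (rule infsum_mono)
    show "(\<lambda>b. \<theta> * geomU (Suc m) \<theta> b h) summable_on ?A" by (rule summable_on_cmult_right[OF sm[OF he(1)]])
    show "(\<lambda>b. geomU (Suc m) \<theta> b h') summable_on ?A" by (rule sm[OF he(2)])
    fix b assume "b \<in> ?A"
    then have b: "b \<in> hist_ext (Suc m) n" by simp
    define l l' where "l = level (Suc m) (\<lambda>k. b k - h k)" and "l' = level (Suc m) (\<lambda>k. b k - h' k)"
    have "l1dist (Suc m) b h' \<le> l1dist (Suc m) b h + 2" using l1dist_triangle[of "Suc m" b h' h] nb by simp
    then have "l' \<le> Suc l" unfolding l1dist_level[OF b he(1)] l1dist_level[OF b he(2)] l_def l'_def by simp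
    then have "\<theta> ^ Suc l \<le> \<theta> ^ l'" using \<theta> by (intro power_decreasing) auto
    then have "\<theta> ^ Suc l / Zc \<le> \<theta> ^ l' / Zc" using Zc_pos by (intro divide_right_mono) auto
    then show "\<theta> * geomU (Suc m) \<theta> b h \<le> geomU (Suc m) \<theta> b h'"
      unfolding geomU_eq[OF m \<theta> b he(1)] geomU_eq[OF m \<theta> b he(2)] l_def[symmetric] l'_def[symmetric] by simp
  qed
  finally show ?thesis by (simp only: trunc_def)
qed

lemma trunc_DP: "is_DP (Suc m) n \<theta> (trunc (Suc m) \<theta> n)"
  unfolding is_DP_def neighboring_def
proof (intro ballI impI conjI)
  fix h h' g assume h: "h \<in> hist (Suc m) n" "h' \<in> hist (Suc m) n" and nb: "l1dist (Suc m) h h' = 2"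
  show "\<theta> * trunc (Suc m) \<theta> n g h \<le> trunc (Suc m) \<theta> n g h'" by (rule trunc_DP_half[OF h nb])
  have "\<theta> * trunc (Suc m) \<theta> n g h' \<le> trunc (Suc m) \<theta> n g h"
    by (rule trunc_DP_half[OF h(2,1)]) (use nb l1dist_sym in metis)
  then show "trunc (Suc m) \<theta> n g h' \<le> trunc (Suc m) \<theta> n g h / \<theta>" using \<theta> by (simp add: pos_le_divide_eq mult.commute)
qed

section \<open>Distortion of the truncated mechanism\<close>

definition tail_dist :: "nat \<Rightarrow> real" where
  "tail_dist \<tau> = (\<Sum>d. (if \<tau> < d then 2 * real d else 0) * (nsph m d * \<theta> ^ d)) / Zc"

lemma moment_sums: "(\<lambda>d. 2 * real d * (nsph m d * \<theta> ^ d)) sums (2 * meandist m \<theta> * Zc)"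
  using sums_mult[OF nsph_moment[OF m \<theta>, folded zsum_def], of 2] by (simp add: mult_ac)

lemma tail_dist_summable: "summable (\<lambda>d. (if \<tau> < d then 2 * real d else 0) * (nsph m d * \<theta> ^ d))"
  by (rule summable_comparison_test'[OF sums_summable[OF moment_sums], of 0]) (use \<theta> in auto)

lemma tail_dist_le: "tail_dist \<tau> \<le> 2 * meandist m \<theta>"
proof -
  have "(\<Sum>d. (if \<tau> < d then 2 * real d else 0) * (nsph m d * \<theta> ^ d)) \<le> (\<Sum>d. 2 * real d * (nsph m d * \<theta> ^ d))"
    by (rule suminf_le[OF _ tail_dist_summable sums_summable[OF moment_sums]]) (use \<theta> in auto)
  also have "\<dots> = 2 * meandist m \<theta> * Zc" by (rule sums_unique[OF moment_sums, symmetric])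
  finally show ?thesis unfolding tail_dist_def using Zc_pos by (simp add: pos_divide_le_eq)
qed

lemma tail_dist_limit: "tail_dist \<longlonglongrightarrow> 0"
proof -
  let ?a = "\<lambda>d. 2 * real d * (nsph m d * \<theta> ^ d)"
  have "tail_dist = (\<lambda>\<tau>. (2 * meandist m \<theta> * Zc - (\<Sum>d<Suc \<tau>. ?a d)) / Zc)"
  proof
    fix \<tau>
    have "(\<lambda>d. ?a d - (if d \<in> {..<Suc \<tau>} then ?a d else 0)) sums (2 * meandist m \<theta> * Zc - (\<Sum>d\<in>{..<Suc \<tau>}. ?a d))"
      by (intro sums_diff moment_sums sums_If_finite_set) auto
    also have "(\<lambda>d. ?a d - (if d \<in> {..<Suc \<tau>} then ?a d else 0)) = (\<lambda>d. (if \<tau> < d then 2 * real d else 0) * (nsph m d * \<theta> ^ d))"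
      by (auto simp: fun_eq_iff)
    finally have "(\<Sum>d. (if \<tau> < d then 2 * real d else 0) * (nsph m d * \<theta> ^ d)) = 2 * meandist m \<theta> * Zc - (\<Sum>d\<in>{..<Suc \<tau>}. ?a d)"
      by (rule sums_unique[symmetric])
    then show "tail_dist \<tau> = (2 * meandist m \<theta> * Zc - (\<Sum>d<Suc \<tau>. ?a d)) / Zc" unfolding tail_dist_def by (simp only:)
  qed
  moreover have "(\<lambda>\<tau>. (2 * meandist m \<theta> * Zc - (\<Sum>d<Suc \<tau>. ?a d)) / Zc) \<longlonglongrightarrow> (2 * meandist m \<theta> * Zc - 2 * meandist m \<theta> * Zc) / Zc"
  proof (intro tendsto_intros)
    show "(\<lambda>\<tau>. \<Sum>d<Suc \<tau>. ?a d) \<longlonglongrightarrow> 2 * meandist m \<theta> * Zc"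
      using moment_sums unfolding sums_def by (rule LIMSEQ_Suc)
  qed (use Zc_pos in auto)
  ultimately show ?thesis by simp
qed

text \<open>Leaving the histograms requires noise above \<tau>, so the surcharge for rounding is at
  most the tail. With \<tau> = 0 the condition is met by every \<open>h\<close>, and the result is
  the crude bound for untypical inputs.\<close>

lemma trunc_row:
  assumes h: "h \<in> hist (Suc m) n" and \<tau>: "\<And>b. b \<in> hist_ext (Suc m) n \<Longrightarrow> b \<notin> hist (Suc m) n \<Longrightarrow> \<tau> < level (Suc m) (\<lambda>k. b k - h k) \<or> \<tau> = 0"
  shows "(\<Sum>g\<in>hist (Suc m) n. trunc (Suc m) \<theta> n g h * real_of_int (l1dist (Suc m) h g)) \<le> 2 * meandist m \<theta> + tail_dist \<tau>"
proof -
  let ?N = "nearest (Suc m) n" and ?E = "hist_ext (Suc m) n" and ?U = "\<lambda>b. geomU (Suc m) \<theta> b h"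
  let ?l = "\<lambda>b. level (Suc m) (\<lambda>k. b k - h k)"
  have he: "h \<in> ?E" using h hist_sub_ext by blast
  have up: "((\<lambda>b. ?U b * (2 * real (?l b)) + ?U b * (if \<tau> < ?l b then 2 * real (?l b) else 0)) has_sum (2 * meandist m \<theta> + tail_dist \<tau>)) ?E"
  proof (rule has_sum_add)
    show "((\<lambda>b. ?U b * (2 * real (?l b))) has_sum (2 * meandist m \<theta>)) ?E"
      using geomU_weighted_has_sum[of "\<lambda>d. 2 * real d", OF _ moment_sums he] Zc_pos by simp
    show "((\<lambda>b. ?U b * (if \<tau> < ?l b then 2 * real (?l b) else 0)) has_sum tail_dist \<tau>) ?E"
      using geomU_weighted_has_sum[of "\<lambda>d. if \<tau> < d then 2 * real d else 0", OF _ summable_sums[OF tail_dist_summable] he]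
      unfolding tail_dist_def by simp
  qed
  have le: "?U b * real_of_int (l1dist (Suc m) h (?N b)) \<le> ?U b * (2 * real (?l b)) + ?U b * (if \<tau> < ?l b then 2 * real (?l b) else 0)"
    if b: "b \<in> ?E" for b
  proof -
    have l: "l1dist (Suc m) b h = 2 * int (?l b)" by (rule l1dist_level[OF b he])
    have "l1dist (Suc m) h (?N b) \<le> 2 * int (?l b) + (if \<tau> < ?l b then 2 * int (?l b) else 0)"
    proof (cases "b \<in> hist (Suc m) n")
      case True
      then show ?thesis using nearest_dist[OF h, of b] l by auto
    next
      case False
      then show ?thesis using nearest_dist[OF h, of b] l \<tau>[OF b False] by auto
    qed
    then have "real_of_int (l1dist (Suc m) h (?N b)) \<le> real_of_int (2 * int (?l b) + (if \<tau> < ?l b then 2 * int (?l b) else 0))"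
      by (simp only: of_int_le_iff)
    also have "\<dots> = 2 * real (?l b) + (if \<tau> < ?l b then 2 * real (?l b) else 0)" by simp
    finally show ?thesis unfolding distrib_left[symmetric] by (rule mult_left_mono) (rule geomU_nonneg[OF b he])
  qed
  have sm: "(\<lambda>b. ?U b * real_of_int (l1dist (Suc m) h (?N b))) summable_on ?E"
    by (rule summable_on_comparison_test[OF has_sum_imp_summable[OF up] le]) (use geomU_nonneg he l1dist_nonneg in auto)
  have "(\<Sum>g\<in>hist (Suc m) n. trunc (Suc m) \<theta> n g h * real_of_int (l1dist (Suc m) h g)) =
     (\<Sum>g\<in>hist (Suc m) n. infsum (\<lambda>b. ?U b * real_of_int (l1dist (Suc m) h (?N b))) {b \<in> ?E. ?N b = g})"
  proof (intro sum.cong refl)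
    fix g
    have "trunc (Suc m) \<theta> n g h * real_of_int (l1dist (Suc m) h g) =
       infsum (\<lambda>b. ?U b * real_of_int (l1dist (Suc m) h g)) {b \<in> ?E. ?N b = g}"
      unfolding trunc_def by (rule infsum_cmult_left'[symmetric])
    also have "\<dots> = infsum (\<lambda>b. ?U b * real_of_int (l1dist (Suc m) h (?N b))) {b \<in> ?E. ?N b = g}"
      by (rule infsum_cong) auto
    finally show "trunc (Suc m) \<theta> n g h * real_of_int (l1dist (Suc m) h g) = infsum (\<lambda>b. ?U b * real_of_int (l1dist (Suc m) h (?N b))) {b \<in> ?E. ?N b = g}" .
  qed
  also have "\<dots> = infsum (\<lambda>b. ?U b * real_of_int (l1dist (Suc m) h (?N b))) ?E"
    by (rule partition_infsum[symmetric, OF has_sum_infsum[OF sm]]) (auto simp: nearest_in finite_hist)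
  also have "\<dots> \<le> 2 * meandist m \<theta> + tail_dist \<tau>"
    by (rule has_sum_mono[OF has_sum_infsum[OF sm] up le])
  finally show ?thesis .
qed

lemma trunc_upper:
  assumes p: "\<forall>k<Suc m. 0 < p k" "(\<Sum>k<Suc m. p k) = 1"
  shows "\<exists>u. u \<longlonglongrightarrow> 2 * meandist m \<theta> \<and> (\<forall>n. distortion (Suc m) n (trunc (Suc m) \<theta> n) p \<le> u n)"
proof -
  let ?K = "Suc m"
  define D where "D = meandist m \<theta>"
  define c where "c = Min (p ` {..<?K})"
  have "0 < c" unfolding c_def by (subst Min_gr_iff) (use p in auto)
  moreover have "c \<le> p k" if "k < ?K" for k unfolding c_def by (rule Min_le) (use that in auto)
  ultimately have c: "0 < c" "\<And>k. k < ?K \<Longrightarrow> c \<le> p k" by auto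
  \<comment> \<open>For typical \<open>h\<close> each coordinate is at least
    \<open>n * c / 2\<close>. A point with a negative coordinate is therefore farther than that in
    L1 distance, which is a level above \<open>n * c / 4\<close>.\<close>
  define \<tau> where "\<tau> n = nat \<lfloor>real n * c / 4\<rfloor>" for n
  define M where "M n = (\<Sum>h\<in>typical ?K p (1/2) n. mpmf ?K p n h)" for n
  have T: "typical ?K p (1/2) n \<subseteq> hist ?K n" for n by (auto simp: typical_def)
  define row where "row n h = (\<Sum>g\<in>hist ?K n. trunc ?K \<theta> n g h * real_of_int (l1dist ?K h g))" for n h
  have row1: "row n h \<le> 4 * D" if "h \<in> hist ?K n" for n h
    using trunc_row[OF that, of 0] tail_dist_le[of 0] unfolding row_def D_def by simp
  have row2: "row n h \<le> 2 * D + tail_dist (\<tau> n)" if h: "h \<in> typical ?K p (1/2) n" for n h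
    unfolding row_def D_def
  proof (rule trunc_row)
    show hh: "h \<in> hist ?K n" using h T by blast
    then have he: "h \<in> hist_ext ?K n" using hist_sub_ext by blast
    fix b assume b: "b \<in> hist_ext ?K n" "b \<notin> hist ?K n"
    then obtain k where k: "k < ?K" "b k < 0" by (auto simp: hist_def hist_ext_def not_le)
    have "\<bar>real_of_int (h k) - real n * p k\<bar> \<le> 1/2 * (real n * p k)" using h k by (auto simp: typical_def)
    then have "real n * p k / 2 \<le> real_of_int (h k)" by linarith
    moreover have "real n * c \<le> real n * p k" using c(2)[OF k(1)] by (intro mult_left_mono) auto
    moreover have "real_of_int (b k) < 0" using k by simp
    ultimately have "real n * c / 2 < \<bar>real_of_int (b k - h k)\<bar>" unfolding of_int_diff by linarith
    also have "\<bar>b k - h k\<bar> \<le> l1dist ?K b h" unfolding l1dist_def by (rule member_le_sum) (use k in auto)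
    then have "\<bar>real_of_int (b k - h k)\<bar> \<le> real_of_int (l1dist ?K b h)" by linarith
    also have "\<dots> = 2 * real (level ?K (\<lambda>k. b k - h k))" unfolding l1dist_level[OF b(1) he] by simp
    finally have "real n * c / 4 < real (level ?K (\<lambda>k. b k - h k))" by simp
    moreover have "real (\<tau> n) \<le> real n * c / 4" unfolding \<tau>_def by (rule of_nat_floor) (use c in simp)
    ultimately show "\<tau> n < level ?K (\<lambda>k. b k - h k) \<or> \<tau> n = 0" by linarith
  qed
  \<comment> \<open>The sharp row bound on typical inputs, the crude bound \<open>4 * D\<close> on
    the remaining mass.\<close>
  define u where "u n = (2 * D + tail_dist (\<tau> n)) * M n + 4 * D * (1 - M n)" for n
  have "distortion ?K n (trunc ?K \<theta> n) p \<le> u n" for n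
  proof -
    have "distortion ?K n (trunc ?K \<theta> n) p = (\<Sum>h\<in>hist ?K n. mpmf ?K p n h * row n h)"
      unfolding distortion_eq row_def ..
    also have "\<dots> = (\<Sum>h\<in>typical ?K p (1/2) n. mpmf ?K p n h * row n h) + (\<Sum>h\<in>hist ?K n - typical ?K p (1/2) n. mpmf ?K p n h * row n h)"
      using sum.subset_diff[OF T finite_hist] by (simp add: add.commute)
    also have "\<dots> \<le> (\<Sum>h\<in>typical ?K p (1/2) n. mpmf ?K p n h * (2 * D + tail_dist (\<tau> n))) + (\<Sum>h\<in>hist ?K n - typical ?K p (1/2) n. mpmf ?K p n h * (4 * D))"
      by (intro add_mono sum_mono mult_left_mono row1 row2 mpmf_nonneg[OF p(1)]) auto
    also have "\<dots> = M n * (2 * D + tail_dist (\<tau> n)) + (1 - M n) * (4 * D)"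
      unfolding sum_distrib_right[symmetric] M_def sum_diff[OF finite_hist T] mpmf_total[OF p(2)] ..
    finally show ?thesis by (simp add: u_def mult.commute)
  qed
  moreover have "u \<longlonglongrightarrow> 2 * meandist m \<theta>"
  proof -
    have M: "M \<longlonglongrightarrow> 1" unfolding M_def using typical_mass[OF p, of "1/2"] by simp
    have "filterlim (\<lambda>n. real n * (c / 4)) at_top sequentially"
      by (rule filterlim_at_top_mult_tendsto_pos[OF tendsto_const _ filterlim_real_sequentially]) (use c in auto)
    then have "filterlim \<tau> at_top sequentially" unfolding \<tau>_def
      by (intro filterlim_compose[OF filterlim_nat_sequentially] filterlim_compose[OF filterlim_floor_sequentially]) simp
    then have "(\<lambda>n. tail_dist (\<tau> n)) \<longlonglongrightarrow> 0" by (rule filterlim_compose[OF tail_dist_limit])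
    then have "u \<longlonglongrightarrow> (2 * D + 0) * 1 + 4 * D * (1 - 1)" unfolding u_def by (intro tendsto_intros M)
    then show ?thesis by (simp add: D_def)
  qed
  ultimately show ?thesis by blast
qed

end

section \<open>Lower bound\<close>

text \<open>Half of the tolerance is used up by \<open>h\<close>, the other half by the distance to
  \<open>g\<close>. As \<delta> < 1, this also forces \<open>g\<close> to be nonnegative, so lattice
  points near a typical histogram are histograms.\<close>

lemma typical_near:
  assumes h: "h \<in> typical K p (\<delta> / 2) n" and g: "g \<in> hist_ext K n" and \<delta>: "0 < \<delta>" "\<delta> < 1" and p: "\<forall>k<K. 0 < p k"
    and d: "real_of_int (l1dist K h g) \<le> r" and r: "\<And>k. k < K \<Longrightarrow> r \<le> \<delta> / 2 * (real n * p k)"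
  shows "g \<in> typical K p \<delta> n"
proof -
  have c: "\<bar>real_of_int (g k) - real n * p k\<bar> \<le> \<delta> * (real n * p k)" if k: "k < K" for k
  proof -
    have "\<bar>h k - g k\<bar> \<le> l1dist K h g" unfolding l1dist_def by (rule member_le_sum) (use k in auto)
    then have "\<bar>real_of_int (h k) - real_of_int (g k)\<bar> \<le> \<delta> / 2 * (real n * p k)"
      using d r[OF k] by linarith
    moreover have "\<bar>real_of_int (h k) - real n * p k\<bar> \<le> \<delta> / 2 * (real n * p k)" using h k by (auto simp: typical_def)
    ultimately show ?thesis by linarith
  qed
  have "0 \<le> g k" if k: "k < K" for k
  proof -
    have "real n * p k \<ge> 0" using p k by (simp add: less_imp_le)
    then have "\<delta> * (real n * p k) \<le> real n * p k" using \<delta> by (simp add: mult_left_le_one_le)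
    then show ?thesis using c[OF k] by linarith
  qed
  then show ?thesis using c g by (auto simp: typical_def hist_def hist_ext_def)
qed

context
  fixes m :: nat and \<theta> :: real and p :: "nat \<Rightarrow> real"
  assumes m: "0 < m" and \<theta>: "0 < \<theta>" "\<theta> < 1" and p: "\<forall>k<Suc m. 0 < p k" "(\<Sum>k<Suc m. p k) = 1"
begin

text \<open>For a fixed output \<open>g\<close>, privacy says precisely that the column
  \<open>W g\<close> drops by at most a factor \<theta> per edge, so \<open>ball_inequality\<close>
  applies to it around \<open>g\<close>. The point \<open>h0\<close> guarantees that the whole ball
  consists of typical histograms, on which \<open>W\<close> is controlled and the prior nearly
  constant.\<close>

lemma output_column_bound:
  assumes W: "is_HSM (Suc m) n W" "is_DP (Suc m) n \<theta> W" and g: "g \<in> hist (Suc m) n"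
    and \<delta>: "0 < \<delta>" "\<delta> < 1" and n: "0 < n"
    and E: "0 \<le> E" "E \<le> meanlevel m \<theta> R - real (Suc m) * \<theta> / (1 - \<theta>)"
    and r: "\<And>k. k < Suc m \<Longrightarrow> 4 * real R \<le> \<delta> / 2 * (real n * p k)"
    and h0: "h0 \<in> typical (Suc m) p (\<delta> / 2) n" "l1dist (Suc m) h0 g \<le> 2 * int R"
  shows "0 \<le> (\<Sum>h\<in>{h \<in> hist (Suc m) n. l1dist (Suc m) h g \<le> 2 * int R}.
     mpmf (Suc m) p n h * W g h * (real_of_int (l1dist (Suc m) h g) - 2 * ((1 - \<delta>) ^ (4 * R) * E)))"
proof -
  let ?K = "Suc m"
  define Y where "Y x = (\<lambda>k. g k + x k)" for x
  \<comment> \<open>Points of the ball have L1 distance at most \<open>2 * R\<close> from its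
    centre, so \<rho> bounds the change of the prior between centre and point, in either
    direction.\<close>
  define \<rho> where "\<rho> = (1 - \<delta>) ^ (2 * R)"
  have \<rho>: "0 \<le> \<rho>" unfolding \<rho>_def using \<delta> by simp
  have \<rho>2: "(1 - \<delta>) ^ (4 * R) = \<rho> * \<rho>" unfolding \<rho>_def by (simp add: power_add[symmetric])
  have ge: "g \<in> hist_ext ?K n" using g hist_sub_ext by blast
  have Yext: "Y x \<in> hist_ext ?K n" if "x \<in> sph ?K d" for x d
    using that ge by (auto simp: Y_def hist_ext_def sph_def sum.distrib)
  have Ydist: "l1dist ?K g (Y x) = 2 * int d" if "x \<in> sph ?K d" for x d
    using that by (auto simp: l1dist_def Y_def sph_def)
  have Ytyp: "Y x \<in> typical ?K p \<delta> n" if x: "x \<in> sph ?K d" and d: "d \<le> R" for x d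
  proof (rule typical_near[OF h0(1) Yext[OF x] \<delta> p(1) _ r])
    \<comment> \<open>Both \<open>h0\<close> and \<open>Y x\<close> are within \<open>2 * R\<close>
      of \<open>g\<close>; this is the \<open>4 * R\<close> of assumption \<open>r\<close>.\<close>
    have "l1dist ?K h0 (Y x) \<le> 4 * int R"
      using l1dist_triangle[of ?K h0 "Y x" g] h0(2) Ydist[OF x] d by simp
    then show "real_of_int (l1dist ?K h0 (Y x)) \<le> 4 * real R" by linarith
  qed
  have gtyp: "g \<in> typical ?K p \<delta> n"
    by (rule typical_near[OF h0(1) ge \<delta> p(1) _ r]) (use h0(2) in linarith)
  have Yh: "Y x \<in> hist ?K n" if "x \<in> sph ?K d" "d \<le> R" for x d using Ytyp[OF that] by (auto simp: typical_def)
  have W0: "0 \<le> W g (Y x)" if "x \<in> sph ?K d" "d \<le> R" for x d using W(1) Yh[OF that] g by (auto simp: is_HSM_def)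
  define \<Phi> where "\<Phi> d = (\<Sum>x\<in>sph ?K d. W g (Y x))" for d
  have \<Phi>0: "0 \<le> \<Phi> d" if "d \<le> R" for d unfolding \<Phi>_def using W0 that by (intro sum_nonneg) auto
  have "0 \<le> (\<Sum>d\<le>R. (real d + real ?K * \<theta> / (1 - \<theta>) - meanlevel m \<theta> R) * (\<Sum>x\<in>sph ?K d. W g (Y x)))"
  proof (rule ball_inequality[OF m \<theta>])
    show "0 \<le> W g (Y x)" if "d \<le> R" "x \<in> sph ?K d" for d x using W0 that by auto
    fix d x i j assume d: "d < R" and x: "x \<in> sph ?K d" and ij: "(i, j) \<in> upedge ?K x"
    have "(shift x i j, i, j) \<in> (SIGMA y:sph ?K (Suc d). posc ?K y \<times> negc ?K y)"
      using bij_betwE[OF up_edge_bij[of ?K d]] x ij by fastforce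
    then have s: "shift x i j \<in> sph ?K (Suc d)" by auto
    have ij': "i < ?K" "j < ?K" "i \<noteq> j" using ij by (auto simp: upedge_def)
    have "neighboring ?K (Y x) (Y (shift x i j))"
    proof -
      have "l1dist ?K (Y x) (Y (shift x i j)) = (\<Sum>k<?K. (if k = i then 1 else 0) + (if k = j then 1 else 0))"
        unfolding l1dist_def Y_def shift_def by (intro sum.cong) (use ij' in auto)
      also have "\<dots> = 2" using ij' by (simp add: sum.distrib)
      finally show ?thesis by (simp add: neighboring_def)
    qed
    then show "\<theta> * W g (Y x) \<le> W g (Y (shift x i j))"
      using W(2) Yh[OF x] Yh[OF s] g d unfolding is_DP_def by auto
  qed
  also have "\<dots> \<le> (\<Sum>d\<le>R. (real d - E) * \<Phi> d)"
    unfolding \<Phi>_def[symmetric] by (intro sum_mono mult_right_mono \<Phi>0) (use E in auto)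
  finally have 1: "E * (\<Sum>d\<le>R. \<Phi> d) \<le> (\<Sum>d\<le>R. real d * \<Phi> d)"
    by (simp add: left_diff_distrib sum_subtractf sum_distrib_left)
  have rat: "\<rho> * mpmf ?K p n g \<le> mpmf ?K p n (Y x)" "\<rho> * mpmf ?K p n (Y x) \<le> mpmf ?K p n g"
    if x: "x \<in> sph ?K d" and d: "d \<le> R" for x d
  proof -
    have "\<rho> \<le> (1 - \<delta>) ^ nat (l1dist ?K g (Y x))"
      unfolding \<rho>_def Ydist[OF x] using \<delta> d by (intro power_decreasing) auto
    then show "\<rho> * mpmf ?K p n g \<le> mpmf ?K p n (Y x)" "\<rho> * mpmf ?K p n (Y x) \<le> mpmf ?K p n g"
      using mpmf_ratio[OF p(1) \<delta> n gtyp Ytyp[OF x d]] mpmf_ratio[OF p(1) \<delta> n Ytyp[OF x d] gtyp] mpmf_nonneg[OF p(1)]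
      by (auto simp: l1dist_sym[of ?K "Y x" g] intro: order_trans[OF mult_right_mono])
  qed
  \<comment> \<open>\<open>ball_inequality\<close> knows nothing of the prior. On the left the prior
    is replaced by its value at \<open>g\<close>, on the right that value is replaced by the prior
    again; each exchange costs one factor \<rho>.\<close>
  have "\<rho> * \<rho> * E * (\<Sum>d\<le>R. \<Sum>x\<in>sph ?K d. mpmf ?K p n (Y x) * W g (Y x)) =
     \<rho> * E * (\<Sum>d\<le>R. \<Sum>x\<in>sph ?K d. (\<rho> * mpmf ?K p n (Y x)) * W g (Y x))"
    by (simp add: sum_distrib_left mult_ac)
  also have "\<dots> \<le> \<rho> * E * (\<Sum>d\<le>R. \<Sum>x\<in>sph ?K d. mpmf ?K p n g * W g (Y x))"
    using \<rho> E(1) rat(2) W0 by (intro mult_left_mono sum_mono mult_right_mono mult_nonneg_nonneg) auto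
  also have "\<dots> = \<rho> * mpmf ?K p n g * (E * (\<Sum>d\<le>R. \<Phi> d))"
    by (simp add: \<Phi>_def sum_distrib_left mult_ac)
  also have "\<dots> \<le> \<rho> * mpmf ?K p n g * (\<Sum>d\<le>R. real d * \<Phi> d)"
    using 1 \<rho> mpmf_nonneg[OF p(1)] by (intro mult_left_mono mult_nonneg_nonneg)
  also have "\<dots> = (\<Sum>d\<le>R. \<Sum>x\<in>sph ?K d. (\<rho> * mpmf ?K p n g) * (real d * W g (Y x)))"
    by (simp add: \<Phi>_def sum_distrib_left mult_ac)
  also have "\<dots> \<le> (\<Sum>d\<le>R. \<Sum>x\<in>sph ?K d. mpmf ?K p n (Y x) * (real d * W g (Y x)))"
    using rat(1) W0 by (intro sum_mono mult_right_mono mult_nonneg_nonneg) auto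
  finally have 2: "\<rho> * \<rho> * E * (\<Sum>d\<le>R. \<Sum>x\<in>sph ?K d. mpmf ?K p n (Y x) * W g (Y x))
     \<le> (\<Sum>d\<le>R. \<Sum>x\<in>sph ?K d. mpmf ?K p n (Y x) * (real d * W g (Y x)))" .
  have "(\<Sum>d\<le>R. \<Sum>x\<in>sph ?K d. mpmf ?K p n (Y x) * W g (Y x) * (2 * real d - 2 * (\<rho> * \<rho> * E))) =
     2 * (\<Sum>d\<le>R. \<Sum>x\<in>sph ?K d. mpmf ?K p n (Y x) * (real d * W g (Y x)))
     - 2 * (\<rho> * \<rho> * E * (\<Sum>d\<le>R. \<Sum>x\<in>sph ?K d. mpmf ?K p n (Y x) * W g (Y x)))"
    unfolding sum_distrib_left sum_subtractf[symmetric]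
    by (intro sum.cong refl) (simp add: algebra_simps)
  then have "0 \<le> (\<Sum>d\<le>R. \<Sum>x\<in>sph ?K d. mpmf ?K p n (Y x) * W g (Y x) * (2 * real d - 2 * (\<rho> * \<rho> * E)))"
    using 2 by linarith
  also have "\<dots> = (\<Sum>(d, x)\<in>(SIGMA d:{..R}. sph ?K d). mpmf ?K p n (Y x) * W g (Y x) * (2 * real d - 2 * (\<rho> * \<rho> * E)))"
    by (subst sum.Sigma) (auto simp: finite_sph)
  also have "\<dots> = (\<Sum>h\<in>{h \<in> hist ?K n. l1dist ?K h g \<le> 2 * int R}.
     mpmf ?K p n h * W g h * (real_of_int (l1dist ?K h g) - 2 * (\<rho> * \<rho> * E)))"
  proof (rule sum.reindex_bij_witness[of _ "\<lambda>h. (level ?K (\<lambda>k. h k - g k), \<lambda>k. h k - g k)" "\<lambda>(d, x). Y x"])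
    fix a assume a: "a \<in> (SIGMA d:{..R}. sph ?K d)"
    obtain d x where ax: "a = (d, x)" by (cases a)
    have x: "x \<in> sph ?K d" "d \<le> R" using a ax by auto
    have Yd: "(\<lambda>k. Y x k - g k) = x" by (simp add: Y_def)
    show "(level ?K (\<lambda>k. (case a of (d, x) \<Rightarrow> Y x) k - g k), \<lambda>k. (case a of (d, x) \<Rightarrow> Y x) k - g k) = a"
      using x by (simp add: ax Yd sph_lat)
    have ld: "l1dist ?K (Y x) g = 2 * int d" using Ydist[OF x(1)] l1dist_sym by metis
    show "(case a of (d, x) \<Rightarrow> Y x) \<in> {h \<in> hist ?K n. l1dist ?K h g \<le> 2 * int R}"
      using Yh[OF x] ld x by (simp add: ax)
    show "mpmf ?K p n (case a of (d, x) \<Rightarrow> Y x) * W g (case a of (d, x) \<Rightarrow> Y x) * (real_of_int (l1dist ?K (case a of (d, x) \<Rightarrow> Y x) g) - 2 * (\<rho> * \<rho> * E))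
       = (case a of (d, x) \<Rightarrow> mpmf ?K p n (Y x) * W g (Y x) * (2 * real d - 2 * (\<rho> * \<rho> * E)))"
      by (simp add: ax ld)
  next
    fix h assume "h \<in> {h \<in> hist ?K n. l1dist ?K h g \<le> 2 * int R}"
    then have h: "h \<in> hist_ext ?K n" "l1dist ?K h g \<le> 2 * int R" using hist_sub_ext by auto
    show "(case (level ?K (\<lambda>k. h k - g k), \<lambda>k. h k - g k) of (d, x) \<Rightarrow> Y x) = h" by (simp add: Y_def)
    show "(level ?K (\<lambda>k. h k - g k), \<lambda>k. h k - g k) \<in> (SIGMA d:{..R}. sph ?K d)"
      using lat_sph[OF diff_lat[OF h(1) ge]] l1dist_level[OF h(1) ge] h(2) by auto
  qed
  finally show ?thesis unfolding \<rho>2 .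
qed

text \<open>Every typical input is charged the amount \<open>c\<close>, and each output column is
  shown to pay for the charges in it. Far inputs pay through their own distance; near ones are
  either all untypical, hence not charged, or covered by \<open>output_column_bound\<close>. Since
  each row of \<open>W\<close> sums to 1, adding the columns charges every typical input exactly
  once.\<close>

lemma distortion_lower:
  assumes W: "is_HSM (Suc m) n W" "is_DP (Suc m) n \<theta> W"
    and \<delta>: "0 < \<delta>" "\<delta> < 1" and n: "0 < n"
    and E: "0 \<le> E" "E \<le> meanlevel m \<theta> R - real (Suc m) * \<theta> / (1 - \<theta>)" "E \<le> real R"
    and r: "\<And>k. k < Suc m \<Longrightarrow> 4 * real R \<le> \<delta> / 2 * (real n * p k)"
  shows "2 * ((1 - \<delta>) ^ (4 * R) * E) * (\<Sum>h\<in>typical (Suc m) p (\<delta> / 2) n. mpmf (Suc m) p n h) \<le> distortion (Suc m) n W p"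
proof -
  let ?K = "Suc m"
  define c where "c = 2 * ((1 - \<delta>) ^ (4 * R) * E)"
  define T where "T = typical ?K p (\<delta> / 2) n"
  have TH: "T \<subseteq> hist ?K n" by (auto simp: T_def typical_def)
  \<comment> \<open>The upper bound is for far inputs, whose distance exceeds \<open>2 * R\<close>;
    it is the purpose of \<open>E \<le> real R\<close>.\<close>
  have c: "0 \<le> c" "c \<le> 2 * real R"
  proof -
    show "0 \<le> c" unfolding c_def using \<delta> E by simp
    have "(1 - \<delta>) ^ (4 * R) * E \<le> 1 * E" using \<delta> E by (intro mult_right_mono power_le_one) auto
    then show "c \<le> 2 * real R" unfolding c_def using E by simp
  qed
  define t where "t h g = mpmf ?K p n h * W g h" for h g
  have t0: "0 \<le> t h g" if "h \<in> hist ?K n" "g \<in> hist ?K n" for h g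
    unfolding t_def using that W(1) mpmf_nonneg[OF p(1)] by (auto simp: is_HSM_def)
  have col: "0 \<le> (\<Sum>h\<in>hist ?K n. t h g * (real_of_int (l1dist ?K h g) - (if h \<in> T then c else 0)))"
    if g: "g \<in> hist ?K n" for g
  proof -
    define B where "B = {h \<in> hist ?K n. l1dist ?K h g \<le> 2 * int R}"
    have BH: "B \<subseteq> hist ?K n" by (auto simp: B_def)
    have far: "0 \<le> (\<Sum>h\<in>hist ?K n - B. t h g * (real_of_int (l1dist ?K h g) - (if h \<in> T then c else 0)))"
    proof (rule sum_nonneg, rule mult_nonneg_nonneg)
      fix h assume h: "h \<in> hist ?K n - B"
      then show "0 \<le> t h g" using t0 g by auto
      have "l1dist ?K h g > 2 * int R" using h by (auto simp: B_def)
      then have "real_of_int (l1dist ?K h g) \<ge> 2 * real R" by linarith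
      then show "0 \<le> real_of_int (l1dist ?K h g) - (if h \<in> T then c else 0)" using c by auto
    qed
    have near: "0 \<le> (\<Sum>h\<in>B. t h g * (real_of_int (l1dist ?K h g) - (if h \<in> T then c else 0)))"
    proof (cases "B \<inter> T = {}")
      case True
      show ?thesis
      proof (rule sum_nonneg, rule mult_nonneg_nonneg)
        fix h assume h: "h \<in> B"
        then show "0 \<le> t h g" using t0 g BH by auto
        show "0 \<le> real_of_int (l1dist ?K h g) - (if h \<in> T then c else 0)" using h True l1dist_nonneg[of ?K h g] by auto
      qed
    next
      case False
      then obtain h0 where h0: "h0 \<in> typical ?K p (\<delta> / 2) n" "l1dist ?K h0 g \<le> 2 * int R" by (auto simp: B_def T_def)
      have "0 \<le> (\<Sum>h\<in>B. t h g * (real_of_int (l1dist ?K h g) - c))"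
        using output_column_bound[OF W g \<delta> n E(1,2) r h0] unfolding B_def t_def c_def .
      also have "\<dots> \<le> (\<Sum>h\<in>B. t h g * (real_of_int (l1dist ?K h g) - (if h \<in> T then c else 0)))"
        by (intro sum_mono mult_left_mono) (use c t0 g BH in auto)
      finally show ?thesis .
    qed
    show ?thesis using far near sum.subset_diff[OF BH finite_hist, of "\<lambda>h. t h g * (real_of_int (l1dist ?K h g) - (if h \<in> T then c else 0))"]
      by linarith
  qed
  have "0 \<le> (\<Sum>g\<in>hist ?K n. \<Sum>h\<in>hist ?K n. t h g * (real_of_int (l1dist ?K h g) - (if h \<in> T then c else 0)))"
    by (rule sum_nonneg) (rule col)
  also have "\<dots> = (\<Sum>h\<in>hist ?K n. \<Sum>g\<in>hist ?K n. t h g * (real_of_int (l1dist ?K h g) - (if h \<in> T then c else 0)))"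
    by (rule sum.swap)
  also have "\<dots> = (\<Sum>h\<in>hist ?K n. (\<Sum>g\<in>hist ?K n. t h g * real_of_int (l1dist ?K h g)) - (if h \<in> T then c * mpmf ?K p n h else 0))"
  proof (intro sum.cong refl)
    fix h assume h: "h \<in> hist ?K n"
    have "(\<Sum>g\<in>hist ?K n. t h g) = mpmf ?K p n h"
      unfolding t_def sum_distrib_left[symmetric] using W(1) h by (simp add: is_HSM_def)
    then show "(\<Sum>g\<in>hist ?K n. t h g * (real_of_int (l1dist ?K h g) - (if h \<in> T then c else 0))) =
       (\<Sum>g\<in>hist ?K n. t h g * real_of_int (l1dist ?K h g)) - (if h \<in> T then c * mpmf ?K p n h else 0)"
      by (simp add: right_diff_distrib sum_subtractf sum_distrib_right[symmetric] mult.commute)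
  qed
  also have "\<dots> = distortion ?K n W p - c * (\<Sum>h\<in>T. mpmf ?K p n h)"
  proof -
    have "(\<Sum>h\<in>hist ?K n. if h \<in> T then c * mpmf ?K p n h else 0) = (\<Sum>h\<in>T. c * mpmf ?K p n h)"
      using sum.inter_restrict[OF finite_hist, of "\<lambda>h. c * mpmf ?K p n h" ?K n T] TH by (simp add: Int_absorb1)
    then show ?thesis unfolding sum_subtractf distortion_eq
      by (simp add: t_def sum_distrib_left mult.assoc)
  qed
  finally show ?thesis by (simp add: c_def T_def)
qed

section \<open>Passage to the limit\<close>

lemma distortion_nonneg:
  assumes "is_HSM (Suc m) n W"
  shows "0 \<le> distortion (Suc m) n W p"
  unfolding distortion_eq using assms mpmf_nonneg[OF p(1)] l1dist_nonneg
  by (auto simp: is_HSM_def intro!: sum_nonneg mult_nonneg_nonneg)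

text \<open>The order of choices matters: \<open>R\<close> comes first, to bring the truncated mean
  close to its limit; then \<delta>, since the loss \<open>(1 - \<delta>) ^ (4 * R)\<close> depends
  on \<open>R\<close>; finally \<open>n\<close>, so that typical inputs carry almost all mass and
  the balls fit. None of these depends on \<open>W\<close>, so the bound is uniform over
  mechanisms.\<close>

lemma distortion_liminf:
  assumes "a < 2 * meandist m \<theta>"
  shows "\<forall>\<^sub>F n in sequentially. \<forall>W. is_HSM (Suc m) n W \<and> is_DP (Suc m) n \<theta> W \<longrightarrow> a \<le> distortion (Suc m) n W p"
proof (cases "a < 0")
  \<comment> \<open>Split off because \<open>distortion_lower\<close> requires
    \<open>0 \<le> E\<close>, which follows from \<open>a / 2 < E\<close> once \<open>a\<close> is
    nonnegative.\<close>
  case True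
  then show ?thesis using distortion_nonneg by (intro always_eventually) (auto intro: order_trans less_imp_le)
next
  case False
  define e where "e R = meanlevel m \<theta> R - real (Suc m) * \<theta> / (1 - \<theta>)" for R
  have "e \<longlonglongrightarrow> meandist m \<theta>" unfolding e_def by (rule meanlevel_limit[OF \<theta>])
  then have "\<forall>\<^sub>F R in sequentially. a / 2 < e R \<and> e R < meandist m \<theta> + 1"
    using assms by (intro eventually_conj order_tendstoD) auto
  moreover have "\<forall>\<^sub>F R in sequentially. meandist m \<theta> + 1 \<le> real R"
    by (rule eventually_compose_filterlim[OF eventually_ge_at_top filterlim_real_sequentially])
  ultimately have "\<forall>\<^sub>F R in sequentially. a / 2 < e R \<and> e R \<le> real R" by eventually_elim auto
  then obtain R where R: "a / 2 < e R" "e R \<le> real R" using eventually_happens'[OF sequentially_bot] by blast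
  define E where "E = e R"
  have E: "0 \<le> E" "E \<le> meanlevel m \<theta> R - real (Suc m) * \<theta> / (1 - \<theta>)" "E \<le> real R" "a / 2 < E"
    using R False by (auto simp: E_def e_def)
  have "((\<lambda>\<delta>. 2 * ((1 - \<delta>) ^ (4 * R) * E)) \<longlongrightarrow> 2 * ((1 - 0) ^ (4 * R) * E)) (at_right 0)"
    by (intro tendsto_intros)
  then have "\<forall>\<^sub>F \<delta> in at_right 0. a < 2 * ((1 - \<delta>) ^ (4 * R) * E)"
    by (rule order_tendstoD) (use E in simp)
  moreover have "\<forall>\<^sub>F \<delta> in at_right (0::real). \<delta> \<in> {0<..<1}" by (rule eventually_at_right_real) simp
  ultimately have "\<forall>\<^sub>F \<delta> in at_right (0::real). a < 2 * ((1 - \<delta>) ^ (4 * R) * E) \<and> 0 < \<delta> \<and> \<delta> < 1"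
    by eventually_elim auto
  then obtain \<delta> where \<delta>: "a < 2 * ((1 - \<delta>) ^ (4 * R) * E)" "0 < \<delta>" "\<delta> < 1"
    using eventually_happens'[OF trivial_limit_at_right_real] by blast
  have "(\<lambda>n. 2 * ((1 - \<delta>) ^ (4 * R) * E) * (\<Sum>h\<in>typical (Suc m) p (\<delta> / 2) n. mpmf (Suc m) p n h)) \<longlonglongrightarrow> 2 * ((1 - \<delta>) ^ (4 * R) * E) * 1"
    by (intro tendsto_intros typical_mass p) (use \<delta> in simp)
  then have 1: "\<forall>\<^sub>F n in sequentially. a < 2 * ((1 - \<delta>) ^ (4 * R) * E) * (\<Sum>h\<in>typical (Suc m) p (\<delta> / 2) n. mpmf (Suc m) p n h)"
    by (rule order_tendstoD) (use \<delta> in simp)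
  have 2: "\<forall>\<^sub>F n in sequentially. \<forall>k\<in>{..<Suc m}. 4 * real R \<le> \<delta> / 2 * (real n * p k)"
  proof (rule eventually_ball_finite, simp, rule ballI)
    fix k assume "k \<in> {..<Suc m}"
    then have "0 < \<delta> / 2 * p k" using p \<delta> by simp
    then have "filterlim (\<lambda>n. real n * (\<delta> / 2 * p k)) at_top sequentially"
      by (rule filterlim_at_top_mult_tendsto_pos[OF tendsto_const _ filterlim_real_sequentially])
    then have "\<forall>\<^sub>F n in sequentially. 4 * real R \<le> real n * (\<delta> / 2 * p k)" unfolding filterlim_at_top by blast
    then show "\<forall>\<^sub>F n in sequentially. 4 * real R \<le> \<delta> / 2 * (real n * p k)" by (simp add: mult_ac)
  qed
  show ?thesis
    using 1 2 eventually_gt_at_top[of 0]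
  proof eventually_elim
    case (elim n)
    show ?case
    proof (intro allI impI)
      fix W assume W: "is_HSM (Suc m) n W \<and> is_DP (Suc m) n \<theta> W"
      have "2 * ((1 - \<delta>) ^ (4 * R) * E) * (\<Sum>h\<in>typical (Suc m) p (\<delta> / 2) n. mpmf (Suc m) p n h) \<le> distortion (Suc m) n W p"
        by (rule distortion_lower) (use W \<delta> E elim in auto)
      then show "a \<le> distortion (Suc m) n W p" using elim(1) by linarith
    qed
  qed
qed

lemma Dstar_le_trunc: "Dstar (Suc m) n \<theta> p \<le> distortion (Suc m) n (trunc (Suc m) \<theta> n) p"
  unfolding Dstar_def
proof (rule cInf_lower)
  show "distortion (Suc m) n (trunc (Suc m) \<theta> n) p \<in> {distortion (Suc m) n W p |W. is_HSM (Suc m) n W \<and> is_DP (Suc m) n \<theta> W}"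
    using trunc_HSM[OF m \<theta>] trunc_DP[OF m \<theta>] by blast
  show "bdd_below {distortion (Suc m) n W p |W. is_HSM (Suc m) n W \<and> is_DP (Suc m) n \<theta> W}"
    by (rule bdd_belowI[of _ 0]) (auto intro: distortion_nonneg)
qed

lemma Dstar_liminf:
  assumes "a < 2 * meandist m \<theta>"
  shows "\<forall>\<^sub>F n in sequentially. a < Dstar (Suc m) n \<theta> p"
proof -
  \<comment> \<open>An infimum inherits only a weak bound, so the strict inequality is obtained
    through an intermediate value.\<close>
  obtain b where b: "a < b" "b < 2 * meandist m \<theta>" using assms dense by blast
  show ?thesis using distortion_liminf[OF b(2)]
  proof eventually_elim
    case (elim n)
    have "b \<le> Dstar (Suc m) n \<theta> p"
      unfolding Dstar_def by (rule cInf_greatest) (use elim trunc_HSM[OF m \<theta>] trunc_DP[OF m \<theta>] in auto)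
    then show ?case using b by simp
  qed
qed

text \<open>One squeeze serves both sequences: \<open>Dstar\<close> is eventually above any smaller
  value, it lies below the distortion of \<open>trunc\<close>, and the latter lies below the
  majorant \<open>u\<close>.\<close>

lemma Dstar_trunc_limits:
  "(\<lambda>n. Dstar (Suc m) n \<theta> p) \<longlonglongrightarrow> 2 * meandist m \<theta>"
  "(\<lambda>n. distortion (Suc m) n (trunc (Suc m) \<theta> n) p) \<longlonglongrightarrow> 2 * meandist m \<theta>"
proof -
  obtain u where u: "u \<longlonglongrightarrow> 2 * meandist m \<theta>" "\<And>n. distortion (Suc m) n (trunc (Suc m) \<theta> n) p \<le> u n"
    using trunc_upper[OF m \<theta> p] by blast
  have up: "\<forall>\<^sub>F n in sequentially. u n < a" if "2 * meandist m \<theta> < a" for a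
    by (rule order_tendstoD(2)[OF u(1) that])
  show "(\<lambda>n. Dstar (Suc m) n \<theta> p) \<longlonglongrightarrow> 2 * meandist m \<theta>"
  proof (rule order_tendstoI)
    show "\<forall>\<^sub>F n in sequentially. Dstar (Suc m) n \<theta> p < a" if "2 * meandist m \<theta> < a" for a
      using up[OF that] by eventually_elim (use Dstar_le_trunc u(2) in \<open>meson le_less_trans order_trans\<close>)
  qed (rule Dstar_liminf)
  show "(\<lambda>n. distortion (Suc m) n (trunc (Suc m) \<theta> n) p) \<longlonglongrightarrow> 2 * meandist m \<theta>"
  proof (rule order_tendstoI)
    show "\<forall>\<^sub>F n in sequentially. distortion (Suc m) n (trunc (Suc m) \<theta> n) p < a" if "2 * meandist m \<theta> < a" for a
      using up[OF that] by eventually_elim (use u(2) in \<open>meson le_less_trans\<close>)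
    show "\<forall>\<^sub>F n in sequentially. a < distortion (Suc m) n (trunc (Suc m) \<theta> n) p" if "a < 2 * meandist m \<theta>" for a
      using Dstar_liminf[OF that] by eventually_elim (use Dstar_le_trunc in \<open>meson less_le_trans\<close>)
  qed
qed

end

theorem theorem1:
  fixes K :: nat and \<theta> :: real and p :: "nat \<Rightarrow> real"
  assumes "2 \<le> K" and "0 < \<theta>" and "\<theta> < 1"
    and "\<forall>k<K. 0 < p k" and "(\<Sum>k<K. p k) = 1"
  shows
    "(\<lambda>n. Dstar K n \<theta> p) \<longlonglongrightarrow>
        (2 * \<theta> / Ehr K \<theta> * deriv (Ehr K) \<theta> - 2 * \<theta> / (1 - \<theta>))
   \<and> Ehr K \<theta> = 1 / (1 - \<theta>) + (\<Sum>d. (\<Sum>r=1..K-1. real (K choose r) * real (Suc d + r - 1 choose (r - 1))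
          * real (Suc d - 1 choose (K - r - 1))) * \<theta> ^ Suc d / (1 - \<theta>))
   \<and> (\<lambda>n. Dstar K n \<theta> p) \<longlonglongrightarrow>
        (2 * \<theta> * (real (K - 1) / (1 - \<theta>) + deriv (Spoly (K - 1)) \<theta> / Spoly (K - 1) \<theta>))
   \<and> (\<exists>f :: nat \<Rightarrow> (nat \<Rightarrow> int) \<Rightarrow> (nat \<Rightarrow> int).
        (\<forall>n. f n ` hist_ext K n \<subseteq> hist K n) \<and>
        (let W = (\<lambda>n g h. infsum (\<lambda>b. geomU K \<theta> b h) {b \<in> hist_ext K n. f n b = g}) in
          (\<forall>n. is_HSM K n (W n) \<and> is_DP K n \<theta> (W n)) \<and>
          (\<lambda>n. distortion K n (W n) p) \<longlonglongrightarrow>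
             (2 * \<theta> / Ehr K \<theta> * deriv (Ehr K) \<theta> - 2 * \<theta> / (1 - \<theta>))))"
proof -
  obtain m where K: "K = Suc m" and m: "0 < m" using assms(1) by (cases K) auto
  note \<theta> = assms(2,3)
  note p = assms(4,5)[unfolded K]
  note lim = Dstar_trunc_limits[OF m \<theta> p]
  have a: "2 * \<theta> / Ehr K \<theta> * deriv (Ehr K) \<theta> - 2 * \<theta> / (1 - \<theta>) = 2 * meandist m \<theta>"
    unfolding K by (rule Ehr_log_deriv[OF m \<theta>])
  have c: "2 * \<theta> * (real (K - 1) / (1 - \<theta>) + deriv (Spoly (K - 1)) \<theta> / Spoly (K - 1) \<theta>) = 2 * meandist m \<theta>"
    by (simp add: K meandist_def)
  \<comment> \<open>The witness is \<open>nearest K\<close>; it depends on neither \<theta> nor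
    \<open>p\<close>.\<close>
  have tr: "(\<lambda>n g h. infsum (\<lambda>b. geomU K \<theta> b h) {b \<in> hist_ext K n. nearest K n b = g}) = trunc K \<theta>"
    by (intro ext) (simp add: trunc_def)
  have "\<exists>f :: nat \<Rightarrow> (nat \<Rightarrow> int) \<Rightarrow> (nat \<Rightarrow> int).
        (\<forall>n. f n ` hist_ext K n \<subseteq> hist K n) \<and>
        (let W = (\<lambda>n g h. infsum (\<lambda>b. geomU K \<theta> b h) {b \<in> hist_ext K n. f n b = g}) in
          (\<forall>n. is_HSM K n (W n) \<and> is_DP K n \<theta> (W n)) \<and>
          (\<lambda>n. distortion K n (W n) p) \<longlonglongrightarrow> 2 * meandist m \<theta>)"
    by (rule exI[of _ "nearest K"], unfold tr Let_def)
      (use nearest_in trunc_HSM[OF m \<theta>] trunc_DP[OF m \<theta>] lim(2) in \<open>auto simp: K\<close>)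
  then show ?thesis
    unfolding a c using lim(1) Ehr_binomial_series[OF m \<theta>] unfolding K by blast
qed

end
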